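(* Let $\tilde\gamma$ be the hyperbolic standardization of $\gamma$. Then for each $\mathrm{w}$, the curve $\tilde\gamma(\cdot,\mathrm{w})$ is an area constrained quasiperiodic hyperbolic elastica with translational monodromy. In particular, for each $\mathrm{w}$, the Euclidean unit tangents $\tilde Q=e^{i\tilde\sigma}=\tilde\gamma_u/|\tilde\gamma_u|$ satisfy $$\tilde Q_s^2+\tfrac14\tilde Q^4+\bar\Lambda\,\tilde Q^3+\mu\,\tilde Q^2+\Lambda\,\tilde Q+\tfrac14=0$$ for some $\mu\in\mathbb{R}$ and $\Lambda=\frac{1}{a}\frac{\partial}{\partial\mathrm{w}}\log W_1(\mathrm{w})\in\mathbb{C}$. Here $a=2|W_1(\mathrm{w})|$ and $s=a\,u$ is the hyperbolic arclength parameter.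
   Context: Theta functions (Whittaker–Watson convention): for $\operatorname{Im}\tau>0$, $q=e^{i\pi\tau}$, $q^{c}=e^{i\pi\tau c}$, $\vartheta_1(z)=2\sum_{n\ge0}(-1)^nq^{(n+1/2)^2}\sin((2n+1)z)$, $\vartheta_2(z)=2\sum_{n\ge0}q^{(n+1/2)^2}\cos((2n+1)z)$, $\vartheta_4(z)=1+2\sum_{n\ge1}(-1)^nq^{n^2}\cos 2nz$; primes denote $d/dz$. Let either $\tau\in i\mathbb{R}$, $\operatorname{Im}\tau>0$ and $\vartheta_*=\vartheta_4$ (rectangular case), or $\tau\in\frac12+i\mathbb{R}$, $\operatorname{Im}\tau>0$ and $\vartheta_*=\vartheta_2$ (rhombic case). Let $\omega\in\mathbb{R}$, $\omega\ne0,\frac\pi2$ modulo $\pi$, and define, for $u,\mathrm{w}\in\mathbb{R}$, $$\gamma(u,\mathrm{w})=-i\frac{2\vartheta_*(\omega)^2}{\vartheta_1'(0)\vartheta_1(2\omega)}\frac{\vartheta_1\left(\frac{u+i\mathrm{w}-3\omega}{2}\right)}{\vartheta_1\left(\frac{u+i\mathrm{w}+\omega}{2}\right)}e^{(u+i\mathrm{w})\frac{\vartheta_*'(\omega)}{\vartheta_*(\omega)}},\qquad W_1(\mathrm{w})=i\frac{\vartheta_1'(0)}{2\vartheta_*(\omega)}\frac{\vartheta_*(\omega-i\mathrm{w})}{\vartheta_1(i\mathrm{w})}e^{i\mathrm{w}\frac{\vartheta_*'(\omega)}{\vartheta_*(\omega)}}.$$ Here $\mathrm{w}$ ranges over values for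 which these curves are regular: $\mathrm{w}\notin\pi\operatorname{Im}\tau\,\mathbb{Z}$ (rectangular), $\mathrm{w}\notin2\pi\operatorname{Im}\tau\,\mathbb{Z}$ (rhombic). The hyperbolic standardization of $\gamma$ is $$\tilde\gamma(u,\mathrm{w})=-\frac{|W_1(\mathrm{w})|}{i\,W_1(\mathrm{w})}\gamma(u,\mathrm{w}),$$ considered as a curve in the hyperbolic plane $\mathbb{C}_+=\{x+iy: y>0\}$ with metric $(dx^2+dy^2)/y^2$, over one quasi-period $u\in[0,2\pi]$. For an arclength parametrized curve $\tilde\gamma:[0,L]\to\mathbb{C}_+$ with Euclidean unit tangent $e^{i\tilde\sigma}$, let $\kappa_{\mathrm{Hyp}}$ be its hyperbolic curvature. An area constrained quasiperiodic hyperbolic elastica with translational monodromy is an arclength parametrized curve $\tilde\gamma:[0,L]\to\mathbb{C}_+$ that is a critical point of $\int_0^L\kappa_{\mathrm{Hyp}}^2\,ds$ with fixed length $L>0$, fixed area, and fixed translational period $\mathrm p=\frac{\operatorname{Im}\tilde\gamma(L)}{\operatorname{Im}\tilde\gamma(0)}$, with equal tangent directions at its endpoints (the endpoints themselves are not constrained). Here the area is $\int_0^L(\tilde\sigma_s+\kappa_{\mathrm{Hyp}})\,ds$ and $\log\mathrm p=\int_0^L\sin\tilde\sigma\,ds$. *)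

theory Defs
  imports "HOL-Analysis.Analysis"
begin

section \<open>Theta functions in the convention of Whittaker and Watson\<close>

text \<open>The period of \<open>theta1\<close> is \<open>2 * pi\<close>, not 2. Powers of the nome are fixed by
  \<open>q^c = exp (pi i \<tau> c)\<close>, which selects the branch for fractional \<open>c\<close>.\<close>

definition nome_power :: "complex \<Rightarrow> real \<Rightarrow> complex" where
  "nome_power \<tau> c = exp (\<i> * of_real pi * \<tau> * of_real c)"

definition theta1 :: "complex \<Rightarrow> complex \<Rightarrow> complex" where
  "theta1 \<tau> z = 2 * (\<Sum>n. (-1) ^ n * nome_power \<tau> ((real n + 1/2)\<^sup>2) * sin (of_nat (2 * n + 1) * z))"

definition theta2 :: "complex \<Rightarrow> complex \<Rightarrow> complex" where
  "theta2 \<tau> z = 2 * (\<Sum>n. nome_power \<tau> ((real n + 1/2)\<^sup>2) * cos (of_nat (2 * n + 1) * z))"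

definition theta4 :: "complex \<Rightarrow> complex \<Rightarrow> complex" where
  "theta4 \<tau> z = 1 + 2 * (\<Sum>n. (-1) ^ Suc n * nome_power \<tau> ((real (Suc n))\<^sup>2) * cos (2 * of_nat (Suc n) * z))"


section \<open>The curves\<close>

text \<open>Here \<open>ths\<close> is \<open>theta4 \<tau>\<close> (rectangular case) or \<open>theta2 \<tau>\<close> (rhombic case).\<close>

definition gamma_curve ::
  "complex \<Rightarrow> (complex \<Rightarrow> complex) \<Rightarrow> real \<Rightarrow> real \<Rightarrow> real \<Rightarrow> complex" where
  "gamma_curve \<tau> ths \<omega> u w =
     - \<i> * (2 * (ths (of_real \<omega>))\<^sup>2 / (deriv (theta1 \<tau>) 0 * theta1 \<tau> (2 * of_real \<omega>)))
       * (theta1 \<tau> ((of_real u + \<i> * of_real w - 3 * of_real \<omega>) / 2)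
          / theta1 \<tau> ((of_real u + \<i> * of_real w + of_real \<omega>) / 2))
       * exp ((of_real u + \<i> * of_real w) * (deriv ths (of_real \<omega>) / ths (of_real \<omega>)))"

definition W1 :: "complex \<Rightarrow> (complex \<Rightarrow> complex) \<Rightarrow> real \<Rightarrow> real \<Rightarrow> complex" where
  "W1 \<tau> ths \<omega> w =
     \<i> * (deriv (theta1 \<tau>) 0 / (2 * ths (of_real \<omega>)))
       * (ths (of_real \<omega> - \<i> * of_real w) / theta1 \<tau> (\<i> * of_real w))
       * exp (\<i> * of_real w * (deriv ths (of_real \<omega>) / ths (of_real \<omega>)))"

definition hyp_standardization ::
  "complex \<Rightarrow> (complex \<Rightarrow> complex) \<Rightarrow> real \<Rightarrow> real \<Rightarrow> real \<Rightarrow> complex" where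
  "hyp_standardization \<tau> ths \<omega> u w =
     - (of_real (cmod (W1 \<tau> ths \<omega> w)) / (\<i> * W1 \<tau> ths \<omega> w)) * gamma_curve \<tau> ths \<omega> u w"

definition log_derivative :: "(real \<Rightarrow> complex) \<Rightarrow> real \<Rightarrow> complex" where
  "log_derivative f x = vector_derivative f (at x) / f x"


section \<open>Arclength parametrized curves in the upper half plane\<close>

definition smooth_curve :: "real \<Rightarrow> (real \<Rightarrow> complex) \<Rightarrow> bool" where
  "smooth_curve L c \<longleftrightarrow>
     (\<exists>D. D 0 = c \<and>
       (\<forall>n. \<forall>s\<in>{0..L}. (D n has_vector_derivative D (Suc n) s) (at s within {0..L})))"

definition arclength_curve :: "real \<Rightarrow> (real \<Rightarrow> complex) \<Rightarrow> bool" where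
  "arclength_curve L c \<longleftrightarrow>
     0 < L \<and> smooth_curve L c \<and>
     (\<forall>s\<in>{0..L}. 0 < Im (c s) \<and>
        cmod (vector_derivative c (at s within {0..L})) / Im (c s) = 1)"

text \<open>The Euclidean unit tangent \<open>T = exp (i \<sigma>)\<close>; recall \<open>sgn z = z / |z|\<close>.\<close>

definition unit_tangent :: "real set \<Rightarrow> (real \<Rightarrow> complex) \<Rightarrow> real \<Rightarrow> complex" where
  "unit_tangent S c s = sgn (vector_derivative c (at s within S))"

text \<open>The derivative \<open>\<sigma>\<^sub>s\<close> of the tangent angle, without choosing a lift \<open>\<sigma>\<close>:
  \<open>T = exp (i \<sigma>)\<close> gives \<open>T\<^sub>s = i \<sigma>\<^sub>s T\<close>, so \<open>\<sigma>\<^sub>s = Im (cnj T * T\<^sub>s)\<close>.\<close>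

definition angle_deriv :: "real \<Rightarrow> (real \<Rightarrow> complex) \<Rightarrow> real \<Rightarrow> real" where
  "angle_deriv L c s =
     Im (cnj (unit_tangent {0..L} c s)
         * vector_derivative (unit_tangent {0..L} c) (at s within {0..L}))"

text \<open>For a hyperbolic arclength parameter \<open>s\<close> the Euclidean curvature is \<open>\<sigma>\<^sub>s / y\<close>, and the
  conformal change to the metric \<open>(dx^2 + dy^2) / y^2\<close> turns it into the geodesic curvature
  \<open>\<kappa> = \<sigma>\<^sub>s + cos \<sigma>\<close> with respect to the left normal.\<close>

definition hyp_curvature :: "real \<Rightarrow> (real \<Rightarrow> complex) \<Rightarrow> real \<Rightarrow> real" where
  "hyp_curvature L c s = angle_deriv L c s + Re (unit_tangent {0..L} c s)"

definition bending_energy :: "real \<Rightarrow> (real \<Rightarrow> complex) \<Rightarrow> real" where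
  "bending_energy L c = integral {0..L} (\<lambda>s. (hyp_curvature L c s)\<^sup>2)"

text \<open>The integral of \<open>\<sigma>\<^sub>s\<close> is constant along any smooth family of curves with equal tangent
  directions at both ends, so as a constraint this is the same as fixing the integral of
  \<open>cos \<sigma> ds = dx / y\<close>, a primitive of the hyperbolic area form; in particular the constraint does
  not depend on the sign convention for the curvature.\<close>

definition hyp_area :: "real \<Rightarrow> (real \<Rightarrow> complex) \<Rightarrow> real" where
  "hyp_area L c = integral {0..L} (\<lambda>s. angle_deriv L c s + hyp_curvature L c s)"

definition translational_period :: "real \<Rightarrow> (real \<Rightarrow> complex) \<Rightarrow> real" where
  "translational_period L c = Im (c L) / Im (c 0)"

definition equal_end_tangents :: "real \<Rightarrow> (real \<Rightarrow> complex) \<Rightarrow> bool" where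
  "equal_end_tangents L c \<longleftrightarrow> unit_tangent {0..L} c 0 = unit_tangent {0..L} c L"


section \<open>Elastica\<close>

text \<open>\<open>D i j\<close> is the mixed partial derivative of order \<open>i\<close> in \<open>t\<close> and \<open>j\<close> in \<open>s\<close>; thus the family
  is jointly smooth on \<open>(- \<epsilon>, \<epsilon>) \<times> [0, L]\<close>, up to the boundary in \<open>s\<close>.\<close>

definition smooth_family :: "real \<Rightarrow> real \<Rightarrow> (real \<Rightarrow> real \<Rightarrow> complex) \<Rightarrow> bool" where
  "smooth_family \<epsilon> L \<Gamma> \<longleftrightarrow>
     (\<exists>D. D 0 0 = \<Gamma> \<and>
       (\<forall>i j. continuous_on ({-\<epsilon><..<\<epsilon>} \<times> {0..L}) (\<lambda>(t, s). D i j t s) \<and>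
         (\<forall>t\<in>{-\<epsilon><..<\<epsilon>}. \<forall>s\<in>{0..L}.
            ((\<lambda>t. D i j t s) has_vector_derivative D (Suc i) j t s) (at t) \<and>
            ((\<lambda>s. D i j t s) has_vector_derivative D i (Suc j) t s) (at s within {0..L}))))"

text \<open>Since every member of a variation is parametrized by arclength over the same interval
  \<open>[0, L]\<close>, the length is fixed. The endpoints are free.\<close>

definition admissible_variation ::
  "real \<Rightarrow> (real \<Rightarrow> complex) \<Rightarrow> real \<Rightarrow> (real \<Rightarrow> real \<Rightarrow> complex) \<Rightarrow> bool" where
  "admissible_variation L c \<epsilon> \<Gamma> \<longleftrightarrow>
     0 < \<epsilon> \<and> smooth_family \<epsilon> L \<Gamma> \<and> (\<forall>s\<in>{0..L}. \<Gamma> 0 s = c s) \<and>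
     (\<forall>t\<in>{-\<epsilon><..<\<epsilon>}.
        arclength_curve L (\<Gamma> t) \<and> equal_end_tangents L (\<Gamma> t) \<and>
        hyp_area L (\<Gamma> t) = hyp_area L c \<and>
        translational_period L (\<Gamma> t) = translational_period L c)"

definition area_constrained_quasiperiodic_elastica :: "real \<Rightarrow> (real \<Rightarrow> complex) \<Rightarrow> bool" where
  "area_constrained_quasiperiodic_elastica L c \<longleftrightarrow>
     arclength_curve L c \<and> equal_end_tangents L c \<and>
     (\<forall>\<epsilon> \<Gamma>. admissible_variation L c \<epsilon> \<Gamma> \<longrightarrow>
        ((\<lambda>t. bending_energy L (\<Gamma> t)) has_real_derivative 0) (at 0))"

end

theory Submission
  imports Defs "HOL-Complex_Analysis.Complex_Analysis"
begin

text \<open>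
  Write \<open>z = u + \<i>w\<close>. By Weierstrass' three term identity, the derivative of the meromorphic function
  \<open>\<gamma>(z)\<close> is the perfect square \<open>- \<i> (\<vartheta>\<^sub>*((z - \<omega>)/2) / \<vartheta>\<^sub>1((z + \<omega>)/2))\<^sup>2 exp (c z)\<close> with
  \<open>c = \<vartheta>\<^sub>*'(\<omega>) / \<vartheta>\<^sub>*(\<omega>)\<close>. The same identity, applied to a point and its complex conjugate, yields
  \<open>2 Re (\<gamma>(z) cnj (W\<^sub>1(w))) = |\<gamma>'(z)|\<close>, which says that the standardized curve has hyperbolic speed
  \<open>a = 2 |W\<^sub>1(w)|\<close>. Since \<open>\<gamma>\<close> is holomorphic, differentiating this relation in \<open>w\<close> gives the Euclidean
  curvature of the curve, and hence \<open>\<kappa> = Im \<Lambda> (x / y) - Re \<Lambda>\<close> for its hyperbolic curvature at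
  \<open>x + \<i>y\<close>.

  This relation alone implies both claims. Its derivative along the curve is a second order
  equation for the tangent angle whose first integral is the quartic equation. In the first
  variation of the energy, it lets one write the integrand, up to multiples of the integrands of the
  varied constraints, as the derivative of a function with equal values at both ends.
\<close>

section \<open>Theta series\<close>

text \<open>Two matters shape the proof besides the identities. The quotients divide by
  \<open>theta1\<close>, and the curve must be regular with W1 nonzero, so the zeros of the theta
  functions have to be located. Only an inclusion of each zero set in a shifted lattice is used, and
  a finite form of the triple product supplies it. In the rhombic case conjugation moves \<tau> to
  \<tau> - 1, so \<open>theta1\<close> and \<open>theta2\<close> are real on the real axis only up
  to a constant phase. The phase is the same for both and cancels in all quotients, hence one
  argument serves both cases. The speed relation is proved for all nearby values of w and can
  therefore be differentiated across the curve. By holomorphy the w-derivative of the squared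
  modulus of \<gamma>' is - 2 Im (cnj \<gamma>' \<gamma>''), which measures the turning of the
  tangent along the curve. Up to constant factors, Re \<Lambda> and Im \<Lambda> are the Lagrange
  multipliers of area and translational period.\<close>

definition theta_term :: "complex \<Rightarrow> real \<Rightarrow> complex \<Rightarrow> complex" where
  "theta_term \<tau> r z = exp (\<i> * of_real pi * \<tau> * (of_real r)\<^sup>2 + 2 * \<i> * of_real r * z)"

text \<open>The common source of the three functions in the statement: they arise from it by shifts
  of the argument and exponential factors, so convergence, holomorphy and zeros are treated once. An
  unordered sum can be reindexed by any bijection.\<close>

definition theta3 :: "complex \<Rightarrow> complex \<Rightarrow> complex" where
  "theta3 \<tau> z = (\<Sum>\<^sub>\<infinity>n\<in>UNIV. theta_term \<tau> (of_int n) z)"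

section \<open>Convergence and holomorphy of the bilateral series\<close>

lemma norm_theta_term:
  "norm (theta_term \<tau> r z) = exp (- pi * Im \<tau> * r\<^sup>2 - 2 * r * Im z)"
  by (simp add: theta_term_def power2_eq_square)

lemma norm_theta_term_le:
  assumes "\<bar>Im z\<bar> \<le> R"
  shows "norm (theta_term \<tau> r z) \<le> exp (- pi * Im \<tau> * r\<^sup>2 + 2 * R * \<bar>r\<bar>)"
proof -
  have "- (2 * r * Im z) \<le> 2 * (\<bar>r\<bar> * \<bar>Im z\<bar>)"
    by (metis abs_ge_minus_self abs_mult abs_numeral mult.assoc)
  also have "\<dots> \<le> 2 * (\<bar>r\<bar> * R)"
    using assms by (intro mult_left_mono) auto
  finally show ?thesis by (simp add: norm_theta_term mult_ac)
qed

lemma summable_gaussian: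
  fixes a b :: real
  assumes "a > 0"
  shows "summable (\<lambda>n::nat. exp (- a * (real n)\<^sup>2 + b * real n))"
proof (rule summable_comparison_test_ev)
  show "summable (\<lambda>n. exp (-1 :: real) ^ n)"
    by (rule summable_geometric) simp
  show "\<forall>\<^sub>F n in sequentially.
          norm (exp (- a * (real n)\<^sup>2 + b * real n)) \<le> exp (-1) ^ n"
    \<comment> \<open>From this index on a * n >= b + 1, so the exponent is at most - n and a
      geometric series dominates.\<close>
    using eventually_ge_at_top[of "nat \<lceil>(b + 1) / a\<rceil>"]
  proof eventually_elim
    case (elim n)
    then have "(b + 1) / a \<le> real n" by linarith
    then have "b + 1 \<le> a * real n"
      using assms by (simp add: field_simps)
    then have "(b + 1) * real n \<le> a * real n * real n"
      by (intro mult_right_mono) auto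
    then have "- a * (real n)\<^sup>2 + b * real n \<le> - real n"
      by (simp add: power2_eq_square algebra_simps)
    then show ?case
      by (simp add: exp_of_nat_mult[symmetric])
  qed
qed

text \<open>The partner of n is - n - 1 rather than - n: after adding 1/2 the two indices become
  opposite, as the cosine series of \<open>theta2\<close> requires, and 0 is not counted
  twice.\<close>

lemma int_UNIV_split: "(UNIV :: int set) = range int \<union> range (\<lambda>n. - int n - 1)"
proof -
  have "k \<in> range int \<union> range (\<lambda>n. - int n - 1)" for k
  proof (cases "k \<ge> 0")
    case True
    then show ?thesis by (metis UnI1 nonneg_int_cases rangeI)
  next
    case False
    then have "k = - int (nat (- k - 1)) - 1" by simp
    then show ?thesis by blast
  qed
  then show ?thesis by blast
qed

lemma abs_summable_on_int:
  fixes f :: "int \<Rightarrow> complex"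
  assumes "summable (\<lambda>n. norm (f (int n)))" "summable (\<lambda>n. norm (f (- int n - 1)))"
  shows "(\<lambda>n. norm (f n)) summable_on UNIV"
proof -
  have "(\<lambda>k. norm (f k)) summable_on (range int)"
    using assms(1) by (subst summable_on_reindex) (auto simp: o_def summable_on_UNIV_nonneg_real_iff)
  moreover have "(\<lambda>k. norm (f k)) summable_on (range (\<lambda>n. - int n - 1))"
    using assms(2)
    by (subst summable_on_reindex) (auto simp: o_def summable_on_UNIV_nonneg_real_iff inj_on_def)
  ultimately show ?thesis
    unfolding int_UNIV_split by (intro summable_on_Un_disjoint) auto
qed

lemma sums_infsum_int:
  fixes f :: "int \<Rightarrow> complex"
  assumes "(\<lambda>n. norm (f n)) summable_on UNIV"
  shows "(\<lambda>n. f (int n) + f (- int n - 1)) sums (\<Sum>\<^sub>\<infinity>n\<in>UNIV. f n)"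
proof -
  have s: "f summable_on A" for A
    using assms abs_summable_summable summable_on_subset_banach by blast
  have "(f has_sum infsum f (range int)) (range int)"
    using s by (rule has_sum_infsum)
  then have 1: "(\<lambda>n. f (int n)) sums infsum f (range int)"
    by (subst (asm) has_sum_reindex) (auto simp: o_def intro: has_sum_imp_sums)
  have "(f has_sum infsum f (range (\<lambda>n. - int n - 1))) (range (\<lambda>n. - int n - 1))"
    using s by (rule has_sum_infsum)
  then have 2: "(\<lambda>n. f (- int n - 1)) sums infsum f (range (\<lambda>n. - int n - 1))"
    by (subst (asm) has_sum_reindex) (auto simp: o_def inj_on_def intro: has_sum_imp_sums)
  have "infsum f UNIV = infsum f (range int) + infsum f (range (\<lambda>n. - int n - 1))"
    unfolding int_UNIV_split using s by (intro infsum_Un_disjoint) auto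
  then show ?thesis using sums_add[OF 1 2] by simp
qed

lemma summable_theta_majorant:
  assumes "Im \<tau> > 0"
  shows "summable (\<lambda>n::nat. exp (- pi * Im \<tau> * (real n + c)\<^sup>2 + 2 * R * (real n + c)))"
proof -
  have eq: "exp (- pi * Im \<tau> * (real n + c)\<^sup>2 + 2 * R * (real n + c)) =
      exp (- pi * Im \<tau> * c\<^sup>2 + 2 * R * c) *
      exp (- (pi * Im \<tau>) * (real n)\<^sup>2 + (2 * R - 2 * pi * Im \<tau> * c) * real n)" for n
    unfolding exp_add[symmetric] by (simp add: power2_eq_square algebra_simps)
  show ?thesis unfolding eq
    by (intro summable_mult summable_gaussian) (use assms in auto)
qed

lemma summable_norm_theta_term:
  assumes "Im \<tau> > 0" "c \<ge> 0" "\<bar>Im z\<bar> \<le> R"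
  shows "summable (\<lambda>n::nat. norm (theta_term \<tau> (real n + c) z))"
    and "summable (\<lambda>n::nat. norm (theta_term \<tau> (- (real n + c)) z))"
proof -
  have "norm (theta_term \<tau> (real n + c) z)
        \<le> exp (- pi * Im \<tau> * (real n + c)\<^sup>2 + 2 * R * (real n + c))" for n
    using norm_theta_term_le[OF assms(3), of \<tau> "real n + c"] assms(2) by simp
  then show "summable (\<lambda>n::nat. norm (theta_term \<tau> (real n + c) z))"
    by (intro summable_comparison_test'[OF summable_theta_majorant[OF assms(1), of c R]]) auto
  have "norm (theta_term \<tau> (- (real n + c)) z)
        \<le> exp (- pi * Im \<tau> * (real n + c)\<^sup>2 + 2 * R * (real n + c))" for n
    using norm_theta_term_le[OF assms(3), of \<tau> "- (real n + c)"] assms(2)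
    unfolding abs_minus_cancel power2_minus by simp
  then show "summable (\<lambda>n::nat. norm (theta_term \<tau> (- (real n + c)) z))"
    by (intro summable_comparison_test'[OF summable_theta_majorant[OF assms(1), of c R]]) auto
qed

lemma of_int_neg_index: "real_of_int (- int n - 1) = - (real n + 1)"
  by simp

lemma abs_summable_theta_term:
  assumes "Im \<tau> > 0"
  shows "(\<lambda>n::int. norm (theta_term \<tau> (of_int n) z)) summable_on UNIV"
  using summable_norm_theta_term(1)[OF assms, of 0 z "\<bar>Im z\<bar>"]
    summable_norm_theta_term(2)[OF assms, of 1 z "\<bar>Im z\<bar>"]
  by (intro abs_summable_on_int) (simp_all only: of_int_neg_index of_int_of_nat_eq add_0_right)

lemma theta3_sums:
  assumes "Im \<tau> > 0"
  shows "(\<lambda>n. theta_term \<tau> (real n) z + theta_term \<tau> (- (real n + 1)) z) sums theta3 \<tau> z"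
  using sums_infsum_int[OF abs_summable_theta_term[OF assms, of z]]
  by (simp only: theta3_def of_int_neg_index of_int_of_nat_eq)

lemma theta3_holomorphic:
  assumes "Im \<tau> > 0"
  shows "theta3 \<tau> holomorphic_on UNIV"
proof (rule holomorphic_uniform_sequence[where f = "\<lambda>N z. \<Sum>n<N. theta_term \<tau> (real n) z + theta_term \<tau> (- (real n + 1)) z"])
  show "(\<lambda>z. \<Sum>n<N. theta_term \<tau> (real n) z + theta_term \<tau> (- (real n + 1)) z) holomorphic_on UNIV" for N
    unfolding theta_term_def by (intro holomorphic_intros)
  fix x :: complex
  \<comment> \<open>R bounds |Im z| on the closed unit disc around x, so one Gaussian majorant
    serves the whole disc.\<close>
  define R where "R = norm x + 1"
  define M where "M = (\<lambda>n::nat. exp (- pi * Im \<tau> * (real n + 0)\<^sup>2 + 2 * R * (real n + 0))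
     + exp (- pi * Im \<tau> * (real n + 1)\<^sup>2 + 2 * R * (real n + 1)))"
  have "uniform_limit (cball x 1) (\<lambda>N z. \<Sum>n<N. theta_term \<tau> (real n) z + theta_term \<tau> (- (real n + 1)) z)
       (\<lambda>z. suminf (\<lambda>n. theta_term \<tau> (real n) z + theta_term \<tau> (- (real n + 1)) z)) sequentially"
  proof (rule Weierstrass_m_test)
    show "summable M" unfolding M_def
      by (intro summable_add summable_theta_majorant assms)
    fix n z assume z: "z \<in> cball x 1"
    have "\<bar>Im z\<bar> \<le> norm z" by (rule abs_Im_le_cmod)
    also have "\<dots> \<le> R" using z norm_triangle_ineq2[of z x]
      by (simp add: R_def dist_norm norm_minus_commute)
    finally have R: "\<bar>Im z\<bar> \<le> R" .
    have "norm (theta_term \<tau> (real n) z) \<le> exp (- pi * Im \<tau> * (real n + 0)\<^sup>2 + 2 * R * (real n + 0))"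
      using norm_theta_term_le[OF R, of \<tau> "real n"] by simp
    moreover have "norm (theta_term \<tau> (- (real n + 1)) z)
        \<le> exp (- pi * Im \<tau> * (real n + 1)\<^sup>2 + 2 * R * (real n + 1))"
      using norm_theta_term_le[OF R, of \<tau> "- (real n + 1)"]
      unfolding abs_minus_cancel power2_minus by simp
    ultimately show "norm (theta_term \<tau> (real n) z + theta_term \<tau> (- (real n + 1)) z) \<le> M n"
      unfolding M_def by (rule order.trans[OF norm_triangle_ineq add_mono])
  qed
  moreover have "suminf (\<lambda>n. theta_term \<tau> (real n) z + theta_term \<tau> (- (real n + 1)) z) = theta3 \<tau> z" for z
    using theta3_sums[OF assms] by (rule sums_unique[symmetric])
  ultimately show "\<exists>d>0. cball x d \<subseteq> UNIV \<and> uniform_limit (cball x d)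
      (\<lambda>N z. \<Sum>n<N. theta_term \<tau> (real n) z + theta_term \<tau> (- (real n + 1)) z) (theta3 \<tau>) sequentially"
    by (intro exI[of _ 1]) auto
qed auto

section \<open>The theta functions of the statement as shifts of \<open>theta3\<close>\<close>

lemma theta_term_half:
  "theta_term \<tau> (r + 1/2) z = exp (\<i> * of_real pi * \<tau> / 4 + \<i> * z) * theta_term \<tau> r (z + of_real pi * \<tau> / 2)"
  \<comment> \<open>(r + 1/2)^2 = r^2 + r + 1/4, and the linear term r is absorbed by moving z by
    half the quasi-period.\<close>
  unfolding theta_term_def exp_add[symmetric]
  by (simp add: power2_eq_square field_simps)

lemma abs_summable_theta_term_half:
  assumes "Im \<tau> > 0"
  shows "(\<lambda>n::int. norm (theta_term \<tau> (of_int n + 1/2) z)) summable_on UNIV"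
  unfolding theta_term_half norm_mult
  by (intro summable_on_cmult_right abs_summable_theta_term assms)

text \<open>The terms at n and - n - 1 have the opposite frequencies n + 1/2 and - (n + 1/2) and add
  up to one cosine.\<close>

lemma theta2_eq_infsum:
  assumes "Im \<tau> > 0"
  shows "theta2 \<tau> z = (\<Sum>\<^sub>\<infinity>n\<in>UNIV. theta_term \<tau> (of_int n + 1/2) z)"
proof -
  have eq: "theta_term \<tau> (of_int (int n) + 1/2) z + theta_term \<tau> (of_int (- int n - 1) + 1/2) z
      = 2 * (nome_power \<tau> ((real n + 1/2)\<^sup>2) * cos (of_nat (2 * n + 1) * z))" for n
  proof -
    have 1: "theta_term \<tau> (of_int (int n) + 1/2) z =
        nome_power \<tau> ((real n + 1/2)\<^sup>2) * exp (\<i> * (of_nat (2 * n + 1) * z))"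
      unfolding theta_term_def nome_power_def exp_add[symmetric]
      by (simp add: algebra_simps)
    have 2: "theta_term \<tau> (of_int (- int n - 1) + 1/2) z =
        nome_power \<tau> ((real n + 1/2)\<^sup>2) * exp (- \<i> * (of_nat (2 * n + 1) * z))"
      unfolding theta_term_def nome_power_def exp_add[symmetric]
      by (rule arg_cong[of _ _ exp]) (simp add: power2_eq_square algebra_simps)
    show ?thesis unfolding 1 2 cos_exp_eq by (simp add: algebra_simps)
  qed
  have "(\<lambda>n. 2 * (nome_power \<tau> ((real n + 1/2)\<^sup>2) * cos (of_nat (2 * n + 1) * z)))
      sums (\<Sum>\<^sub>\<infinity>n\<in>UNIV. theta_term \<tau> (of_int n + 1/2) z)"
    using sums_infsum_int[OF abs_summable_theta_term_half[OF assms, of z]] unfolding eq .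
  from sums_mult[OF this, of "1/2"] show ?thesis
    unfolding theta2_def by (simp add: sums_iff mult.commute)
qed

lemma theta2_eq_theta3:
  assumes "Im \<tau> > 0"
  shows "theta2 \<tau> z = exp (\<i> * of_real pi * \<tau> / 4 + \<i> * z) * theta3 \<tau> (z + of_real pi * \<tau> / 2)"
  unfolding theta2_eq_infsum[OF assms] theta3_def theta_term_half
  by (rule infsum_cmult_right) (rule abs_summable_summable[OF abs_summable_theta_term[OF assms]])

lemma theta1_eq_theta2: "theta1 \<tau> z = theta2 \<tau> (z - of_real pi / 2)"
proof -
  have "cos (of_nat (2 * n + 1) * (z - of_real pi / 2)) = (-1) ^ n * sin (of_nat (2 * n + 1) * z)" for n
  proof -
    have c: "of_nat (2 * n + 1) * (z - of_real pi / 2)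
        = of_nat (2 * n + 1) * z - of_real pi / 2 - of_nat n * of_real pi"
      by (simp add: algebra_simps)
    have "cos (x - of_real pi / 2 - of_nat n * of_real pi) = (-1) ^ n * sin x" for x :: complex
    proof -
      have s: "sin (of_nat n * of_real pi :: complex) = 0"
        using sin_of_real[of "real n * pi", where 'a = complex] by simp
      have t: "cos (of_nat n * of_real pi :: complex) = (-1) ^ n"
        using cos_of_real[of "real n * pi", where 'a = complex] by simp
      have u: "cos (x - of_real pi / 2) = sin x"
        by (simp add: cos_diff cos_of_real_pi_half sin_of_real_pi_half)
      show ?thesis by (subst cos_diff) (simp add: s t u)
    qed
    then show ?thesis unfolding c .
  qed
  then show ?thesis unfolding theta1_def theta2_def
    by (simp only: mult_ac)
qed

text \<open>The shift by pi/2 produces the signs (-1)^n. Here n must be paired with - n, unlike in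
  \<open>theta3_sums\<close>; the two one-sided sums are therefore separated, the term at 0 is split
  off, and the rest is added again with the index moved by one.\<close>

lemma theta4_eq_theta3:
  assumes "Im \<tau> > 0"
  shows "theta4 \<tau> z = theta3 \<tau> (z + of_real pi / 2)"
proof -
  have s: "(\<lambda>n. theta_term \<tau> (real n) w + theta_term \<tau> (- (real n + 1)) w) sums theta3 \<tau> w" for w
    by (rule theta3_sums[OF assms])
  define w where "w = z + of_real pi / 2"
  have a: "summable (\<lambda>n. theta_term \<tau> (real n) w)"
    using summable_norm_theta_term(1)[OF assms, of 0 w "\<bar>Im w\<bar>"] by (simp add: summable_norm_cancel)
  have b: "summable (\<lambda>n. theta_term \<tau> (- (real n + 1)) w)"
    using summable_norm_theta_term(2)[OF assms, of 1 w "\<bar>Im w\<bar>"]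
    by (intro summable_norm_cancel[of "\<lambda>n. theta_term \<tau> (- (real n + 1)) w"]) (rule summable_norm_theta_term(2)[OF assms, of 1 w "\<bar>Im w\<bar>"], simp_all)
  have eq: "(\<lambda>n. theta_term \<tau> (real (Suc n)) w + theta_term \<tau> (- (real n + 1)) w) =
      (\<lambda>n. 2 * ((-1) ^ Suc n * nome_power \<tau> ((real (Suc n))\<^sup>2) * cos (2 * of_nat (Suc n) * z)))"
  proof
    fix n
    have p: "exp (\<i> * of_real pi * of_nat m) = (-1) ^ m" for m
      using exp_of_nat_mult[of m "\<i> * of_real pi"] by (simp add: mult_ac)
    have q: "exp (- (\<i> * of_real pi * of_nat m)) = (-1) ^ m" for m
      using p[of m] by (simp add: exp_minus flip: power_inverse)
    have 1: "theta_term \<tau> (real (Suc n)) w = nome_power \<tau> ((real (Suc n))\<^sup>2) *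
        exp (\<i> * (2 * of_nat (Suc n) * z)) * exp (\<i> * of_real pi * of_nat (Suc n))"
      unfolding theta_term_def nome_power_def w_def exp_add[symmetric]
      by (rule arg_cong[of _ _ exp]) (simp add: field_simps)
    have 2: "theta_term \<tau> (- (real n + 1)) w = nome_power \<tau> ((real (Suc n))\<^sup>2) *
        exp (- \<i> * (2 * of_nat (Suc n) * z)) * exp (- (\<i> * of_real pi * of_nat (Suc n)))"
      unfolding theta_term_def nome_power_def w_def exp_add[symmetric]
      by (rule arg_cong[of _ _ exp]) (simp add: field_simps power2_eq_square)
    show "theta_term \<tau> (real (Suc n)) w + theta_term \<tau> (- (real n + 1)) w =
        2 * ((-1) ^ Suc n * nome_power \<tau> ((real (Suc n))\<^sup>2) * cos (2 * of_nat (Suc n) * z))"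
      unfolding 1 2 p q cos_exp_eq by (simp add: algebra_simps)
  qed
  have "summable (\<lambda>n. theta_term \<tau> (real (Suc n)) w + theta_term \<tau> (- (real n + 1)) w)"
    by (rule summable_add[OF iffD2[OF summable_Suc_iff a] b])
  then have sm: "summable (\<lambda>n. (-1) ^ Suc n * nome_power \<tau> ((real (Suc n))\<^sup>2) * cos (2 * of_nat (Suc n) * z))"
    unfolding eq by (subst (asm) summable_cmult_iff) simp
  have "theta3 \<tau> w = (\<Sum>n. theta_term \<tau> (real n) w) + (\<Sum>n. theta_term \<tau> (- (real n + 1)) w)"
    using s[of w] suminf_add[OF a b] by (simp add: sums_iff)
  also have "(\<Sum>n. theta_term \<tau> (real n) w) = 1 + (\<Sum>n. theta_term \<tau> (real (Suc n)) w)"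
    using suminf_split_head[OF a] by (simp add: theta_term_def)
  also have "1 + (\<Sum>n. theta_term \<tau> (real (Suc n)) w) + (\<Sum>n. theta_term \<tau> (- (real n + 1)) w)
     = 1 + (\<Sum>n. theta_term \<tau> (real (Suc n)) w + theta_term \<tau> (- (real n + 1)) w)"
    using suminf_add[OF iffD2[OF summable_Suc_iff a] b] by simp
  also note eq
  also have "(\<Sum>n. 2 * ((-1) ^ Suc n * nome_power \<tau> ((real (Suc n))\<^sup>2) * cos (2 * of_nat (Suc n) * z)))
     = 2 * (\<Sum>n. (-1) ^ Suc n * nome_power \<tau> ((real (Suc n))\<^sup>2) * cos (2 * of_nat (Suc n) * z))"
    by (rule suminf_mult[OF sm])
  finally show ?thesis unfolding theta4_def w_def by simp
qed

section \<open>Conjugation, parity and periods\<close>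

lemma theta_term_cnj: "cnj (theta_term \<tau> r z) = theta_term (- cnj \<tau>) r (- cnj z)"
  by (simp add: theta_term_def exp_cnj)

text \<open>Conjugation reflects \<tau> in the imaginary axis. The image is \<tau> itself if Re
  \<tau> = 0 and \<tau> - 1 if Re \<tau> = 1/2, which is where the two cases part.\<close>

lemma theta3_cnj: "cnj (theta3 \<tau> z) = theta3 (- cnj \<tau>) (- cnj z)"
  by (simp add: theta3_def theta_term_cnj flip: infsum_cnj)

lemma exp_2pi_int: "exp (2 * \<i> * of_real (real_of_int n) * of_real pi) = 1"
  using exp_integer_2pi[of "of_int n"] by (simp add: mult_ac)

lemma theta3_plus_pi: "theta3 \<tau> (z + of_real pi) = theta3 \<tau> z"
proof -
  have "theta_term \<tau> (of_int n) (z + of_real pi) = theta_term \<tau> (of_int n) z" for n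
    unfolding theta_term_def distrib_left exp_add exp_2pi_int by simp
  then show ?thesis by (simp add: theta3_def)
qed

lemma theta2_minus: "theta2 \<tau> (- z) = theta2 \<tau> z"
  by (simp add: theta2_def)

lemma theta4_minus: "theta4 \<tau> (- z) = theta4 \<tau> z"
  by (simp add: theta4_def)

lemma theta2_plus_pi:
  assumes "Im \<tau> > 0"
  shows "theta2 \<tau> (z + of_real pi) = - theta2 \<tau> z"
proof -
  have "z + of_real pi + of_real pi * \<tau> / 2 = z + of_real pi * \<tau> / 2 + of_real pi"
    by simp
  then have "theta3 \<tau> (z + of_real pi + of_real pi * \<tau> / 2) = theta3 \<tau> (z + of_real pi * \<tau> / 2)"
    using theta3_plus_pi by metis
  then show ?thesis
    unfolding theta2_eq_theta3[OF assms] by (simp add: distrib_left exp_add)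
qed

lemma theta1_plus_pi:
  assumes "Im \<tau> > 0"
  shows "theta1 \<tau> (z + of_real pi) = - theta1 \<tau> z"
  using theta2_plus_pi[OF assms, of "z - of_real pi / 2"] unfolding theta1_eq_theta2
  by (simp add: algebra_simps)

lemma theta1_minus:
  assumes "Im \<tau> > 0"
  shows "theta1 \<tau> (- z) = - theta1 \<tau> z"
proof -
  have "theta1 \<tau> (- z) = theta2 \<tau> (z + of_real pi / 2)"
    unfolding theta1_eq_theta2 using theta2_minus[of \<tau> "z + of_real pi / 2"] by simp
  also have "\<dots> = theta2 \<tau> (z - of_real pi / 2 + of_real pi)"
    by (rule arg_cong[of _ _ "theta2 \<tau>"]) (simp add: field_simps)
  finally show ?thesis
    unfolding theta2_plus_pi[OF assms] theta1_eq_theta2 .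
qed

lemma theta2_cnj:
  assumes "Im \<tau> > 0"
  shows "cnj (theta2 \<tau> z) = theta2 (- cnj \<tau>) (cnj z)"
proof -
  have "cnj (theta2 \<tau> z) = theta2 (- cnj \<tau>) (- cnj z)"
    using assms by (simp add: theta2_eq_infsum theta_term_cnj flip: infsum_cnj)
  then show ?thesis by (simp add: theta2_minus)
qed

lemma theta4_cnj:
  assumes "Im \<tau> > 0"
  shows "cnj (theta4 \<tau> z) = theta4 (- cnj \<tau>) (cnj z)"
proof -
  have "cnj (theta4 \<tau> z) = theta3 (- cnj \<tau>) (- cnj z - of_real pi / 2)"
    using assms by (simp add: theta4_eq_theta3 theta3_cnj)
  also have "\<dots> = theta3 (- cnj \<tau>) (- cnj z - of_real pi / 2 + of_real pi)"
    by (rule theta3_plus_pi[symmetric])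
  also have "\<dots> = theta4 (- cnj \<tau>) (- cnj z)"
    using assms by (subst theta4_eq_theta3) (simp_all add: field_simps)
  finally show ?thesis by (simp add: theta4_minus)
qed

text \<open>(n + 1/2)^2 = n (n + 1) + 1/4 with n (n + 1) even, so every term acquires the same
  phase. This brings \<tau> - 1 back to \<tau> after a conjugation in the rhombic case.\<close>

lemma theta2_minus_one:
  assumes "Im \<tau> > 0"
  shows "theta2 (\<tau> - 1) z = exp (- \<i> * of_real pi / 4) * theta2 \<tau> z"
proof -
  have "theta_term (\<tau> - 1) (of_int n + 1/2) z = exp (- \<i> * of_real pi / 4) * theta_term \<tau> (of_int n + 1/2) z"
    for n :: int
  proof -
    obtain k :: int where "n * (n + 1) = 2 * k" by (metis dvd_def even_mult_iff odd_even_add odd_one)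
    then have k: "of_int n * (of_int n + 1) = (2 * of_int k :: complex)"
      by (metis of_int_1 of_int_add of_int_mult of_int_numeral)
    have "theta_term (\<tau> - 1) (of_int n + 1/2) z = exp (- \<i> * of_real pi / 4) * theta_term \<tau> (of_int n + 1/2) z
        * exp (- \<i> * of_real pi * (of_int n * (of_int n + 1)))"
      unfolding theta_term_def exp_add[symmetric]
      by (rule arg_cong[of _ _ exp]) (simp add: power2_eq_square field_simps)
    also have "exp (- \<i> * of_real pi * (of_int n * (of_int n + 1))) = 1"
      unfolding k using exp_2pi_int[of "- k"] by (simp add: mult_ac)
    finally show ?thesis by simp
  qed
  then show ?thesis
    using assms by (simp add: theta2_eq_infsum infsum_cmult_right')
qed

lemma theta_holomorphic:
  assumes "Im \<tau> > 0"
  shows "theta2 \<tau> holomorphic_on UNIV" "theta1 \<tau> holomorphic_on UNIV" "theta4 \<tau> holomorphic_on UNIV"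
proof -
  have 3: "(\<lambda>z. theta3 \<tau> (z + b)) holomorphic_on UNIV" for b
    by (rule holomorphic_on_compose_gen[OF _ theta3_holomorphic[OF assms], unfolded o_def])
      (auto intro!: holomorphic_intros)
  show 2: "theta2 \<tau> holomorphic_on UNIV"
    unfolding theta2_eq_theta3[OF assms, abs_def] by (intro holomorphic_intros 3)
  show "theta1 \<tau> holomorphic_on UNIV"
    unfolding theta1_eq_theta2[abs_def]
    by (rule holomorphic_on_compose_gen[OF _ 2, unfolded o_def]) (auto intro!: holomorphic_intros)
  show "theta4 \<tau> holomorphic_on UNIV"
    unfolding theta4_eq_theta3[OF assms, abs_def] by (rule 3)
qed

section \<open>The three term identity\<close>

text \<open>In classical terms \<open>theta_even\<close> is theta3 at argument 2 z and parameter 2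
  \<tau>, and \<open>theta_odd\<close> is theta2 there. Keeping the parameter \<tau>/2 and splitting
  by parity fits the change of indices in \<open>theta1_mult_theta1\<close>.\<close>

definition theta_even :: "complex \<Rightarrow> complex \<Rightarrow> complex" where
  "theta_even \<tau> z = (\<Sum>\<^sub>\<infinity>n\<in>{n. even n}. theta_term (\<tau> / 2) (of_int n) z)"

definition theta_odd :: "complex \<Rightarrow> complex \<Rightarrow> complex" where
  "theta_odd \<tau> z = (\<Sum>\<^sub>\<infinity>n\<in>{n. odd n}. theta_term (\<tau> / 2) (of_int n) z)"

text \<open>A finite set of pairs lies in the product of its two projections, so its sum of norms is
  at most the product of the two total sums.\<close>

lemma abs_summable_times:
  fixes f :: "'a \<Rightarrow> complex" and g :: "'b \<Rightarrow> complex"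
  assumes "(\<lambda>x. norm (f x)) summable_on A" "(\<lambda>x. norm (g x)) summable_on B"
  shows "(\<lambda>(x, y). f x * g y) summable_on A \<times> B"
proof -
  have "(\<lambda>(x, y). norm (f x) * norm (g y)) summable_on A \<times> B"
  proof (rule nonneg_bdd_above_summable_on)
    show "bdd_above (sum (\<lambda>(x, y). norm (f x) * norm (g y)) ` {F. F \<subseteq> A \<times> B \<and> finite F})"
    proof (rule bdd_aboveI2[where M = "infsum (\<lambda>x. norm (f x)) A * infsum (\<lambda>x. norm (g x)) B"])
      fix F assume F: "F \<in> {F. F \<subseteq> A \<times> B \<and> finite F}"
      have "sum (\<lambda>(x, y). norm (f x) * norm (g y)) F
          \<le> sum (\<lambda>(x, y). norm (f x) * norm (g y)) (fst ` F \<times> snd ` F)"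
        using F by (intro sum_mono2) (force simp: image_iff)+
      also have "\<dots> = sum (\<lambda>x. norm (f x)) (fst ` F) * sum (\<lambda>y. norm (g y)) (snd ` F)"
        by (simp add: sum_product sum.cartesian_product)
      also have "\<dots> \<le> infsum (\<lambda>x. norm (f x)) A * infsum (\<lambda>x. norm (g x)) B"
        using F assms
        by (intro mult_mono finite_sum_le_infsum infsum_nonneg sum_nonneg) auto
      finally show "sum (\<lambda>(x, y). norm (f x) * norm (g y)) F
          \<le> infsum (\<lambda>x. norm (f x)) A * infsum (\<lambda>x. norm (g x)) B" .
    qed
  qed auto
  then have "(\<lambda>p. norm (case p of (x, y) \<Rightarrow> f x * g y)) summable_on A \<times> B"
    by (simp add: case_prod_unfold norm_mult)
  then show ?thesis by (rule abs_summable_summable)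
qed

lemma infsum_times:
  fixes f :: "'a \<Rightarrow> complex" and g :: "'b \<Rightarrow> complex"
  assumes "(\<lambda>x. norm (f x)) summable_on A" "(\<lambda>x. norm (g x)) summable_on B"
  shows "(\<Sum>\<^sub>\<infinity>(x, y)\<in>A \<times> B. f x * g y) = infsum f A * infsum g B"
proof -
  have "infsum (\<lambda>x. infsum (\<lambda>y. f x * g y) B) A = infsum (\<lambda>(x, y). f x * g y) (A \<times> B)"
    using abs_summable_times[OF assms] by (rule infsum_Sigma'_banach)
  then show ?thesis
    by (simp add: infsum_cmult_right' infsum_cmult_left')
qed

text \<open>The parallelogram law r^2 + r'^2 = ((r + r')^2 + (r - r')^2) / 2 separates x from y at
  the price of halving \<tau>; the shifts by pi/2 leave the exponential in front, a sign when r + r'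
  is an integer.\<close>

lemma theta_term_product:
  "theta_term \<tau> r (x + y - of_real pi / 2) * theta_term \<tau> r' (x - y - of_real pi / 2)
   = exp (- \<i> * of_real pi * of_real (r + r')) *
     (theta_term (\<tau> / 2) (r + r') x * theta_term (\<tau> / 2) (r - r') y)"
  unfolding theta_term_def exp_add[symmetric]
  by (rule arg_cong[of _ _ exp]) (simp add: power2_eq_square field_simps)

lemma exp_pi_int: "exp (- \<i> * of_real pi * of_real (of_int s)) = (if even s then 1 else -1)"
proof -
  have "exp (- \<i> * of_real pi * of_real (of_int s)) = cis (- pi * of_int s)"
    by (simp add: cis_conv_exp mult_ac)
  also have "\<dots> = of_real (cos (pi * of_int s)) - \<i> * of_real (sin (pi * of_int s))"
    by (simp add: complex_eq_iff)
  finally show ?thesis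
    by (simp add: cos_npi_int sin_npi_int)
qed

text \<open>Substitute \<open>s = m + n + 1\<close>, \<open>d = m - n\<close> in the double series over \<open>(m, n)\<close>: it becomes the
  sum over all \<open>(s, d)\<close> of opposite parity, with sign \<open>(-1)^s\<close>.\<close>

lemma theta1_mult_theta1:
  assumes "Im \<tau> > 0"
  shows "theta1 \<tau> (x + y) * theta1 \<tau> (x - y) =
         theta_even \<tau> x * theta_odd \<tau> y - theta_odd \<tau> x * theta_even \<tau> y"
proof -
  define E O' :: "int set" where "E = {n. even n}" and "O' = {n. odd n}"
  define F where "F = (\<lambda>(s::int, d::int). (if even s then 1 else -1) *
      (theta_term (\<tau> / 2) (of_int s) x * theta_term (\<tau> / 2) (of_int d) y))"
  have S: "(\<lambda>n::int. norm (theta_term (\<tau> / 2) (of_int n) z)) summable_on A" for A z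
    by (rule summable_on_subset_banach[OF abs_summable_theta_term]) (use assms in auto)
  have F1: "(\<Sum>\<^sub>\<infinity>p\<in>E \<times> O'. F p) = theta_even \<tau> x * theta_odd \<tau> y"
    and s1: "F summable_on E \<times> O'"
  proof -
    have eq: "F p = (\<lambda>(s, d). theta_term (\<tau> / 2) (of_int s) x * theta_term (\<tau> / 2) (of_int d) y) p"
      if "p \<in> E \<times> O'" for p
      using that by (auto simp: F_def E_def)
    show "(\<Sum>\<^sub>\<infinity>p\<in>E \<times> O'. F p) = theta_even \<tau> x * theta_odd \<tau> y"
      using infsum_times[OF S[of x E] S[of y O']] infsum_cong[of "E \<times> O'" F, OF eq]
      by (simp add: theta_even_def theta_odd_def E_def O'_def)
    show "F summable_on E \<times> O'"
      using abs_summable_times[OF S[of x E] S[of y O']] summable_on_cong[of "E \<times> O'" F, OF eq] by simp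
  qed
  have F2: "(\<Sum>\<^sub>\<infinity>p\<in>O' \<times> E. F p) = - (theta_odd \<tau> x * theta_even \<tau> y)"
    and s2: "F summable_on O' \<times> E"
  proof -
    have eq: "F p = - (\<lambda>(s, d). theta_term (\<tau> / 2) (of_int s) x * theta_term (\<tau> / 2) (of_int d) y) p"
      if "p \<in> O' \<times> E" for p
      using that by (auto simp: F_def O'_def)
    show "(\<Sum>\<^sub>\<infinity>p\<in>O' \<times> E. F p) = - (theta_odd \<tau> x * theta_even \<tau> y)"
      using infsum_times[OF S[of x O'] S[of y E]] infsum_cong[of "O' \<times> E" F, OF eq]
      by (simp add: theta_even_def theta_odd_def E_def O'_def infsum_uminus)
    show "F summable_on O' \<times> E"
      using abs_summable_times[OF S[of x O'] S[of y E]] summable_on_cong[of "O' \<times> E" F, OF eq]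
      by (simp add: summable_on_uminus)
  qed
  have bij: "bij_betw (\<lambda>(m, n). (m + n + 1, m - n)) (UNIV \<times> UNIV) (E \<times> O' \<union> O' \<times> E)"
  \<comment> \<open>s + d = 2 m + 1 and s - d = 2 n + 1, so both divisions are exact on pairs of
    opposite parity.\<close>
  proof (rule bij_betwI[where g = "\<lambda>(s, d). ((s + d - 1) div 2, (s - d - 1) div 2)"])
    show "(\<lambda>(m, n). (m + n + 1, m - n)) \<in> UNIV \<times> UNIV \<rightarrow> E \<times> O' \<union> O' \<times> E"
      by (auto simp: E_def O'_def)
  qed (auto simp: E_def O'_def elim!: evenE oddE)
  have "theta1 \<tau> (x + y) * theta1 \<tau> (x - y) =
     (\<Sum>\<^sub>\<infinity>(m, n)\<in>UNIV \<times> UNIV. theta_term \<tau> (of_int m + 1/2) (x + y - of_real pi / 2)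
        * theta_term \<tau> (of_int n + 1/2) (x - y - of_real pi / 2))"
    unfolding theta1_eq_theta2 theta2_eq_infsum[OF assms]
    by (rule infsum_times[OF abs_summable_theta_term_half[OF assms]
          abs_summable_theta_term_half[OF assms], symmetric])
  also have "\<dots> = (\<Sum>\<^sub>\<infinity>p\<in>UNIV \<times> UNIV. F ((\<lambda>(m, n). (m + n + 1, m - n)) p))"
  proof (rule infsum_cong, clarify)
    fix m n :: int
    have r: "of_int m + 1/2 + (of_int n + 1/2) = real_of_int (m + n + 1)"
      "of_int m + 1/2 - (of_int n + 1/2) = real_of_int (m - n)"
      by simp_all
    show "theta_term \<tau> (of_int m + 1/2) (x + y - of_real pi / 2)
        * theta_term \<tau> (of_int n + 1/2) (x - y - of_real pi / 2) = F (m + n + 1, m - n)"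
      unfolding theta_term_product r exp_pi_int F_def by simp
  qed
  also have "\<dots> = (\<Sum>\<^sub>\<infinity>p\<in>E \<times> O' \<union> O' \<times> E. F p)"
    by (rule infsum_reindex_bij_betw[OF bij])
  also have "\<dots> = (\<Sum>\<^sub>\<infinity>p\<in>E \<times> O'. F p) + (\<Sum>\<^sub>\<infinity>p\<in>O' \<times> E. F p)"
    using s1 s2 by (intro infsum_Un_disjoint) (auto simp: E_def O'_def)
  finally show ?thesis unfolding F1 F2 by simp
qed

text \<open>\<open>theta1 (x + y) * theta1 (x - y)\<close> is the determinant of the vectors \<open>(theta_even, theta_odd)\<close> at \<open>x\<close>
  and \<open>y\<close>, so this is the Pluecker relation for four vectors in the plane.\<close>

lemma theta1_weierstrass:
  assumes "Im \<tau> > 0"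
  shows "theta1 \<tau> (a + b) * theta1 \<tau> (a - b) * (theta1 \<tau> (c + d) * theta1 \<tau> (c - d))
       - theta1 \<tau> (a + c) * theta1 \<tau> (a - c) * (theta1 \<tau> (b + d) * theta1 \<tau> (b - d))
       + theta1 \<tau> (a + d) * theta1 \<tau> (a - d) * (theta1 \<tau> (b + c) * theta1 \<tau> (b - c)) = 0"
  unfolding theta1_mult_theta1[OF assms] by (simp add: algebra_simps)

section \<open>Zeros of theta functions\<close>

text \<open>Gaussian binomial coefficients with base Q. The q-Pascal recursion avoids the quotient
  formula, whose denominators vanish at roots of unity.\<close>

fun gauss_binomial :: "complex \<Rightarrow> nat \<Rightarrow> nat \<Rightarrow> complex" where
  "gauss_binomial Q n 0 = 1"
| "gauss_binomial Q 0 (Suc k) = 0"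
| "gauss_binomial Q (Suc n) (Suc k) = gauss_binomial Q n (Suc k) + Q ^ (n - k) * gauss_binomial Q n k"

lemma gauss_binomial_eq_0: "k > n \<Longrightarrow> gauss_binomial Q n k = 0"
  by (induction Q n k rule: gauss_binomial.induct) auto

text \<open>The q-binomial theorem. A further factor 1 + x Q^n adds a copy of the sum with k raised
  by one; Q^n = Q^(n-k) Q^k, where Q^k turns \<open>k choose 2\<close> into
  \<open>Suc k choose 2\<close> and Q^(n-k) is the weight in the recursion.\<close>

lemma gauss_binomial_theorem:
  "(\<Prod>k<n. 1 + x * Q ^ k) = (\<Sum>k\<le>n. gauss_binomial Q n k * Q ^ (k choose 2) * x ^ k)"
proof (induction n)
  case (Suc n)
  define g where "g = gauss_binomial Q"
  have t: "Q ^ n * (g n k * Q ^ (k choose 2) * x ^ k) * x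
      = Q ^ (n - k) * g n k * Q ^ (Suc k choose 2) * x ^ Suc k" if "k \<le> n" for k
  proof -
    have "Suc k choose 2 = k + (k choose 2)" by (simp add: numeral_2_eq_2)
    then show ?thesis using that by (simp add: power_add[symmetric] mult_ac)
  qed
  have z: "g n (Suc n) = 0" by (simp add: g_def gauss_binomial_eq_0)
  have "(\<Sum>k\<le>Suc n. g (Suc n) k * Q ^ (k choose 2) * x ^ k)
      = 1 + (\<Sum>k\<le>n. g (Suc n) (Suc k) * Q ^ (Suc k choose 2) * x ^ Suc k)"
    by (subst sum.atMost_Suc_shift) (simp add: g_def numeral_2_eq_2)
  also have "\<dots> = 1 + (\<Sum>k\<le>n. g n (Suc k) * Q ^ (Suc k choose 2) * x ^ Suc k)
       + (\<Sum>k\<le>n. Q ^ (n - k) * g n k * Q ^ (Suc k choose 2) * x ^ Suc k)"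
    by (simp add: g_def algebra_simps sum.distrib)
  also have "1 + (\<Sum>k\<le>n. g n (Suc k) * Q ^ (Suc k choose 2) * x ^ Suc k)
      = (\<Sum>k\<le>Suc n. g n k * Q ^ (k choose 2) * x ^ k)"
    by (subst sum.atMost_Suc_shift) (simp add: g_def numeral_2_eq_2)
  also have "\<dots> = (\<Sum>k\<le>n. g n k * Q ^ (k choose 2) * x ^ k)"
    by (simp add: z)
  also have "(\<Sum>k\<le>n. Q ^ (n - k) * g n k * Q ^ (Suc k choose 2) * x ^ Suc k)
     = Q ^ n * (\<Sum>k\<le>n. g n k * Q ^ (k choose 2) * x ^ k) * x"
    unfolding sum_distrib_left sum_distrib_right by (intro sum.cong refl t[symmetric]) auto
  finally show ?case using Suc by (simp add: g_def algebra_simps)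
qed (simp add: binomial_eq_0)

text \<open>The quotient formula with cleared denominators; the products are the q-Pochhammer
  symbols (Q; Q)_k. It gives the limit of the coefficients when n, k and n - k all grow.\<close>

lemma gauss_binomial_pochhammer:
  assumes "k \<le> n"
  shows "gauss_binomial Q n k * (\<Prod>i<k. 1 - Q ^ Suc i) * (\<Prod>i<n-k. 1 - Q ^ Suc i) = (\<Prod>i<n. 1 - Q ^ Suc i)"
  using assms
proof (induction Q n k rule: gauss_binomial.induct)
  case (3 Q n k)
  define P where "P = (\<lambda>m. \<Prod>i<m. 1 - Q ^ Suc i)"
  have P: "P (Suc m) = P m * (1 - Q ^ Suc m)" for m by (simp add: P_def)
  have k: "k \<le> n" using 3 by simp
  have A: "gauss_binomial Q n (Suc k) * P (Suc k) * P (n - k) = P n * (1 - Q ^ (n - k))"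
  proof (cases "k = n")
    case True
    then show ?thesis by (simp add: gauss_binomial_eq_0)
  next
    case False
    then have "gauss_binomial Q n (Suc k) * P (Suc k) * P (n - Suc k) = P n"
      using 3 by (simp add: P_def)
    moreover have "P (n - k) = P (n - Suc k) * (1 - Q ^ (n - k))"
      using P[of "n - Suc k"] False k by (simp add: Suc_diff_Suc)
    ultimately show ?thesis by (simp add: mult_ac)
  qed
  have B: "gauss_binomial Q n k * P k * P (n - k) = P n"
    using 3(2)[OF k] by (simp add: P_def)
  have C: "Q ^ (n - k) * Q ^ Suc k = Q ^ Suc n"
    using k by (simp flip: power_add)
  \<comment> \<open>The two branches of the recursion combine through (1 - Q^(n-k)) + Q^(n-k) (1 -
    Q^(k+1)) = 1 - Q^(n+1).\<close>
  have "gauss_binomial Q (Suc n) (Suc k) * P (Suc k) * P (n - k)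
      = P n * (1 - Q ^ (n - k)) + Q ^ (n - k) * (1 - Q ^ Suc k) * (gauss_binomial Q n k * P k * P (n - k))"
    using A by (simp add: P algebra_simps)
  also have "\<dots> = P n * (1 - Q ^ (n - k) * Q ^ Suc k)"
    unfolding B by (simp add: algebra_simps)
  also have "\<dots> = P (Suc n)" unfolding C P ..
  finally show ?case by (simp add: P_def)
qed simp_all

text \<open>The first N odd numbers add up to N^2.\<close>

lemma prod_exp_odd:
  "(\<Prod>j<N. exp (2 * \<i> * z - \<i> * of_real pi * \<tau> * of_nat (2 * j + 1))) =
   exp (2 * \<i> * z * of_nat N - \<i> * of_real pi * \<tau> * (of_nat N)\<^sup>2)"
  by (induction N) (auto simp: exp_add[symmetric] power2_eq_square algebra_simps)

text \<open>A finite Jacobi triple product: the q-binomial theorem with 2 N factors, centred so that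
  the upper half gives the factors in z and the lower half, read backwards, those in - z. Centring
  also turns the powers of x into terms of the theta series with index k - N.\<close>

lemma finite_triple_product:
  fixes \<tau> z :: complex
  defines "e \<equiv> (\<lambda>j z. exp (\<i> * of_real pi * \<tau> * of_nat (2 * j + 1) + 2 * \<i> * z))"
  shows "(\<Prod>j<N. (1 + e j z) * (1 + e j (- z))) =
    (\<Sum>k\<le>2 * N. gauss_binomial (exp (2 * \<i> * of_real pi * \<tau>)) (2 * N) k * theta_term \<tau> (real k - real N) z)"
proof -
  define Q where "Q = exp (2 * \<i> * of_real pi * \<tau>)"
  \<comment> \<open>Chosen so that x Q^k carries the odd multiple 2 (k - N) + 1 of \<tau>, symmetric
    about the middle of the product.\<close>
  define x where "x = exp (2 * \<i> * z + \<i> * of_real pi * \<tau> * (1 - 2 * of_nat N))"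
  \<comment> \<open>The product of the exponentials that are pulled out of the lower half.\<close>
  define C where "C = exp (2 * \<i> * z * of_nat N - \<i> * of_real pi * \<tau> * (of_nat N)\<^sup>2)"
  have xQ: "x * Q ^ k = exp (2 * \<i> * z + \<i> * of_real pi * \<tau> * (2 * of_nat k + 1 - 2 * of_nat N))" for k
    unfolding x_def Q_def exp_of_nat_mult[symmetric] exp_add[symmetric]
    by (rule arg_cong[of _ _ exp]) (simp add: algebra_simps)
  have "(\<Prod>k<2 * N. 1 + x * Q ^ k) = (\<Prod>k<N. 1 + x * Q ^ k) * (\<Prod>k<N. 1 + x * Q ^ (k + N))"
  proof -
    have "(\<Prod>k<2 * N. 1 + x * Q ^ k) = (\<Prod>k\<in>{0..<N}. 1 + x * Q ^ k) * (\<Prod>k\<in>{0+N..<N+N}. 1 + x * Q ^ k)"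
      using prod.atLeastLessThan_concat[of 0 N "N + N" "\<lambda>k. 1 + x * Q ^ k"]
      by (simp add: mult_2 lessThan_atLeast0)
    also have "(\<Prod>k\<in>{0+N..<N+N}. 1 + x * Q ^ k) = (\<Prod>k\<in>{0..<N}. 1 + x * Q ^ (k + N))"
      by (rule prod.shift_bounds_nat_ivl)
    finally show ?thesis by (simp add: lessThan_atLeast0)
  qed
  also have "(\<Prod>k<N. 1 + x * Q ^ (k + N)) = (\<Prod>j<N. 1 + e j z)"
    unfolding xQ e_def by (intro prod.cong refl arg_cong[of _ _ "\<lambda>t. 1 + exp t"]) (simp add: algebra_simps)
  also have "(\<Prod>k<N. 1 + x * Q ^ k) = (\<Prod>j<N. 1 + x * Q ^ (N - Suc j))"
    by (rule prod.nat_diff_reindex[symmetric])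
  \<comment> \<open>Each factor is 1 + y with y the inverse of \<open>e j (- z)\<close>; it is
    rewritten as (1 + 1/y) y.\<close>
  also have "\<dots> = (\<Prod>j<N. (1 + e j (- z)) * exp (2 * \<i> * z - \<i> * of_real pi * \<tau> * of_nat (2 * j + 1)))"
  proof (rule prod.cong, rule refl)
    fix j assume "j \<in> {..<N}"
    then have r: "of_nat (N - Suc j) = (of_nat N - of_nat j - 1 :: complex)"
      by (simp add: of_nat_diff)
    have "e j (- z) * exp (2 * \<i> * z - \<i> * of_real pi * \<tau> * of_nat (2 * j + 1)) = 1"
      unfolding e_def exp_add[symmetric] by (simp add: algebra_simps)
    moreover have "x * Q ^ (N - Suc j) = exp (2 * \<i> * z - \<i> * of_real pi * \<tau> * of_nat (2 * j + 1))"
      unfolding xQ r by (rule arg_cong[of _ _ exp]) (simp add: algebra_simps)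
    ultimately show "1 + x * Q ^ (N - Suc j) = (1 + e j (- z)) * exp (2 * \<i> * z - \<i> * of_real pi * \<tau> * of_nat (2 * j + 1))"
      by (simp add: distrib_right)
  qed
  also have "\<dots> = (\<Prod>j<N. 1 + e j (- z)) * C"
    unfolding prod.distrib prod_exp_odd C_def ..
  finally have "(\<Prod>k<2 * N. 1 + x * Q ^ k) = C * (\<Prod>j<N. (1 + e j z) * (1 + e j (- z)))"
    by (simp add: prod.distrib mult_ac)
  moreover have "(\<Prod>k<2 * N. 1 + x * Q ^ k) = C * (\<Sum>k\<le>2 * N. gauss_binomial Q (2 * N) k * theta_term \<tau> (real k - real N) z)"
    unfolding gauss_binomial_theorem sum_distrib_left
  proof (rule sum.cong, rule refl)
    fix k
    have c: "of_nat (k choose 2) = (of_nat k * (of_nat k - 1) / 2 :: complex)"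
    proof -
      have "even (k * (k - 1))" by (cases k) auto
      then have "2 * (k choose 2) = k * (k - 1)" by (simp add: choose_two)
      then have "of_nat (2 * (k choose 2)) = (of_nat (k * (k - 1)) :: complex)" by simp
      then show ?thesis by (cases k) (auto simp: field_simps)
    qed
    have "Q ^ (k choose 2) * x ^ k = C * theta_term \<tau> (real k - real N) z"
      unfolding Q_def x_def C_def theta_term_def exp_of_nat_mult[symmetric] exp_add[symmetric] c
      by (rule arg_cong[of _ _ exp]) (simp add: power2_eq_square field_simps)
    then show "gauss_binomial Q (2 * N) k * Q ^ (k choose 2) * x ^ k
        = C * (gauss_binomial Q (2 * N) k * theta_term \<tau> (real k - real N) z)"
      by (simp add: mult_ac)
  qed
  moreover have "C \<noteq> 0" by (simp add: C_def)
  ultimately show ?thesis by (simp add: Q_def)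
qed

section \<open>Passage to the limit in the triple product\<close>

lemma convergent_prod_one_plus_geometric:
  assumes "norm (r :: complex) < 1"
  shows "convergent_prod (\<lambda>n. 1 + c * r ^ n)"
proof -
  have "summable (\<lambda>n. norm c * norm r ^ n)"
    using assms by (intro summable_mult summable_geometric) auto
  then have "abs_convergent_prod (\<lambda>n. 1 + c * r ^ n)"
    by (intro summable_imp_abs_convergent_prod) (simp add: norm_mult norm_power)
  then show ?thesis by (rule abs_convergent_prod_imp_convergent_prod)
qed

lemma LIMSEQ_prod_nonzero:
  fixes f :: "nat \<Rightarrow> complex"
  assumes "convergent_prod f" "\<And>n. f n \<noteq> 0"
  obtains L where "(\<lambda>n. \<Prod>i<n. f i) \<longlonglongrightarrow> L" "L \<noteq> 0"
  using assms convergent_prod_iff_nz_lim[of f] LIMSEQ_lessThan_iff_atMost[of "\<lambda>A. prod f A"] by metis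

lemma sum_split_middle:
  fixes f :: "nat \<Rightarrow> complex"
  shows "(\<Sum>k\<le>2 * N. f k) = (\<Sum>n\<le>N. f (N + n)) + (\<Sum>n<N. f (N - Suc n))"
proof -
  have "{..2 * N} = {..<N} \<union> {N..2*N}" by auto
  then have "(\<Sum>k\<le>2 * N. f k) = (\<Sum>k<N. f k) + (\<Sum>k\<in>{N..2*N}. f k)"
    using sum.union_disjoint[of "{..<N}" "{N..2 * N}" f] by force
  also have "(\<Sum>k\<in>{N..2*N}. f k) = (\<Sum>n\<le>N. f (N + n))"
    using sum.shift_bounds_cl_nat_ivl[of f 0 N N] by (simp add: mult_2 atMost_atLeast0 add.commute)
  also have "(\<Sum>k<N. f k) = (\<Sum>n<N. f (N - Suc n))"
    by (rule sum.nat_diff_reindex[symmetric])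
  finally show ?thesis by simp
qed


text \<open>If no factor of the triple product vanishes, then by Tannery's theorem the finite triple products
  converge both to a nonzero infinite product and to a nonzero multiple of \<open>theta3 \<tau> z\<close>.\<close>

lemma theta3_eq_0D:
  assumes \<tau>: "Im \<tau> > 0" and zero: "theta3 \<tau> z = 0"
  shows "\<exists>j::nat. \<exists>s\<in>{1, -1}. exp (\<i> * of_real pi * \<tau> * of_nat (2 * j + 1) + 2 * \<i> * (s * z)) = -1"
proof (rule ccontr)
  define e where "e = (\<lambda>j z. exp (\<i> * of_real pi * \<tau> * of_nat (2 * j + 1) + 2 * \<i> * z))"
  assume "\<not> ?thesis"
  then have nz: "1 + e j z \<noteq> 0" "1 + e j (- z) \<noteq> 0" for j
    by (auto simp: e_def add_eq_0_iff)
  define Q where "Q = exp (2 * \<i> * of_real pi * \<tau>)"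
  have Q1: "norm Q < 1" using \<tau> by (simp add: Q_def)
  define P where "P = (\<lambda>n. \<Prod>i<n. 1 - Q ^ Suc i)"
  have Qnz: "1 - Q ^ Suc i \<noteq> 0" for i
  proof
    assume "1 - Q ^ Suc i = 0"
    then have "norm (Q ^ Suc i) = 1" by (metis eq_iff_diff_eq_0 norm_one)
    moreover have "norm (Q ^ Suc i) < 1"
      using Q1 by (metis norm_ge_zero norm_power power_Suc_less_one zero_less_Suc power_less_one_iff)
    ultimately show False by simp
  qed
  then have Pnz: "P n \<noteq> 0" for n by (simp add: P_def)
  have "convergent_prod (\<lambda>i. 1 - Q ^ Suc i)"
    using convergent_prod_one_plus_geometric[OF Q1, of "- Q"] by simp
  then obtain L where L: "P \<longlonglongrightarrow> L" "L \<noteq> 0"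
    using LIMSEQ_prod_nonzero[of "\<lambda>i. 1 - Q ^ Suc i", OF _ Qnz] unfolding P_def by blast
  obtain B where B: "\<And>n. norm (P n) \<le> B"
    using L(1) by (meson Bseq_def BseqE convergentI convergent_imp_Bseq)
  obtain B' where B': "\<And>n. norm (inverse (P n)) \<le> B'"
    using tendsto_inverse[OF L] by (meson Bseq_def BseqE convergentI convergent_imp_Bseq)
  have B0: "B \<ge> 0" "B' \<ge> 0" using B[of 0] B'[of 0] norm_ge_zero order_trans by blast+
  \<comment> \<open>P converges to a nonzero limit, so P and 1/P are bounded; this bounds all
    Gaussian binomials uniformly and provides the majorant for Tannery's theorem.\<close>
  define M where "M = B * (B' * B')"
  have gb: "gauss_binomial Q n k = P n * (inverse (P k) * inverse (P (n - k)))" if "k \<le> n" for n k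
  proof -
    have "gauss_binomial Q n k * P k * P (n - k) = P n"
      using gauss_binomial_pochhammer[OF that, of Q] by (simp add: P_def)
    then show ?thesis using Pnz[of k] Pnz[of "n - k"] by (simp add: field_simps)
  qed
  have gbM: "norm (gauss_binomial Q n k) \<le> M" for n k
  proof (cases "k \<le> n")
    case True
    show ?thesis unfolding gb[OF True] norm_mult M_def
      by (intro mult_mono B B' B0 mult_nonneg_nonneg norm_ge_zero)
  next
    case False
    then show ?thesis using B0 by (simp add: gauss_binomial_eq_0 M_def)
  qed
  have M0: "M \<ge> 0" using B0 by (simp add: M_def)
  have lim2: "(\<lambda>N. P (2 * N)) \<longlonglongrightarrow> L"
    using LIMSEQ_subseq_LIMSEQ[OF L(1), of "\<lambda>N. 2 * N"] by (simp add: strict_mono_def o_def)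
  \<comment> \<open>When k and 2 N - k both tend to infinity, the quotient formula tends to L / (L
    L), whatever the distance of k from the centre.\<close>
  have lim_gb: "(\<lambda>N. gauss_binomial Q (2 * N) (f N)) \<longlonglongrightarrow> L * (inverse L * inverse L)"
    if f: "\<And>N. N \<ge> c \<Longrightarrow> f N \<le> 2 * N" "filterlim f at_top sequentially"
      "filterlim (\<lambda>N. 2 * N - f N) at_top sequentially" for f c
  proof (rule Lim_transform_eventually)
    show "(\<lambda>N. P (2 * N) * (inverse (P (f N)) * inverse (P (2 * N - f N)))) \<longlonglongrightarrow> L * (inverse L * inverse L)"
      using filterlim_compose[OF L(1) f(2)] filterlim_compose[OF L(1) f(3)]
      by (intro tendsto_mult tendsto_inverse lim2 L(2))
    show "\<forall>\<^sub>F N in sequentially. P (2 * N) * (inverse (P (f N)) * inverse (P (2 * N - f N)))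
        = gauss_binomial Q (2 * N) (f N)"
      using eventually_ge_at_top[of c] by eventually_elim (simp add: gb f(1))
  qed
  define t where "t = (\<lambda>r. theta_term \<tau> r z)"
  \<comment> \<open>The n-th pair of terms of the N-th finite sum. The first part vanishes by itself
    for n > N; the second needs the explicit condition, because \<open>N - Suc n\<close> is
    truncated to 0 for n >= N and the coefficient at 0 is 1.\<close>
  define a where "a = (\<lambda>n N. gauss_binomial Q (2 * N) (N + n) * t (real n)
      + (if n < N then gauss_binomial Q (2 * N) (N - Suc n) * t (- (real n + 1)) else 0))"
  have sm: "summable (\<lambda>n. M * norm (t (real n)) + M * norm (t (- (real n + 1))))"
    using summable_norm_theta_term(1)[OF \<tau>, of 0 z "\<bar>Im z\<bar>"]
      summable_norm_theta_term(2)[OF \<tau>, of 1 z "\<bar>Im z\<bar>"]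
    unfolding t_def by (intro summable_add summable_mult) simp_all
  have "(\<lambda>N. \<Sum>n. a n N) \<longlonglongrightarrow> (\<Sum>n. L * (inverse L * inverse L) * (t (real n) + t (- (real n + 1))))"
  proof (rule conjunct2[OF conjunct2[OF tannerys_theorem]])
    fix n
    have add: "filterlim (\<lambda>N. N + n) at_top sequentially"
      by (rule filterlim_at_top_mono[OF filterlim_ident]) simp
    have sub: "filterlim (\<lambda>N. N - m) at_top sequentially" for m :: nat
      by (rule filterlim_minus_const_nat_at_top)
    have 1: "(\<lambda>N. gauss_binomial Q (2 * N) (N + n)) \<longlonglongrightarrow> L * (inverse L * inverse L)"
      by (rule lim_gb[of n]) (use add sub[of n] in \<open>auto simp: mult_2\<close>)
    have 2: "(\<lambda>N. gauss_binomial Q (2 * N) (N - Suc n)) \<longlonglongrightarrow> L * (inverse L * inverse L)"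
    proof (rule lim_gb[of 0])
      show "filterlim (\<lambda>N. 2 * N - (N - Suc n)) at_top sequentially"
        by (rule filterlim_at_top_mono[OF filterlim_ident]) (auto intro!: always_eventually)
    qed (use sub in auto)
    have "(\<lambda>N. gauss_binomial Q (2 * N) (N + n) * t (real n)
        + gauss_binomial Q (2 * N) (N - Suc n) * t (- (real n + 1)))
       \<longlonglongrightarrow> L * (inverse L * inverse L) * t (real n) + L * (inverse L * inverse L) * t (- (real n + 1))"
      by (intro tendsto_add tendsto_mult_right 1 2)
    moreover have "\<forall>\<^sub>F N in sequentially. gauss_binomial Q (2 * N) (N + n) * t (real n)
        + gauss_binomial Q (2 * N) (N - Suc n) * t (- (real n + 1)) = a n N"
      using eventually_gt_at_top[of n] by eventually_elim (simp add: a_def)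
    ultimately show "(\<lambda>N. a n N) \<longlonglongrightarrow> L * (inverse L * inverse L) * (t (real n) + t (- (real n + 1)))"
      by (simp add: Lim_transform_eventually distrib_left)
  next
    have "norm (a n N) \<le> M * norm (t (real n)) + M * norm (t (- (real n + 1)))" for n N
    proof -
      have "norm (gauss_binomial Q (2 * N) (N + n) * t (real n)) \<le> M * norm (t (real n))"
        unfolding norm_mult by (intro mult_right_mono gbM) auto
      moreover have "norm (if n < N then gauss_binomial Q (2 * N) (N - Suc n) * t (- (real n + 1)) else 0)
          \<le> M * norm (t (- (real n + 1)))"
        using M0 by (auto simp: norm_mult intro!: mult_right_mono gbM)
      ultimately show ?thesis unfolding a_def by (rule order.trans[OF norm_triangle_ineq add_mono])
    qed
    then show "\<forall>\<^sub>F (n, N) in sequentially \<times>\<^sub>F sequentially.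
        norm (a n N) \<le> M * norm (t (real n)) + M * norm (t (- (real n + 1)))"
      by (auto intro!: always_eventually)
  qed (use sm in auto)
  also have "(\<Sum>n. L * (inverse L * inverse L) * (t (real n) + t (- (real n + 1)))) = L * (inverse L * inverse L) * theta3 \<tau> z"
    using sums_mult[OF theta3_sums[OF \<tau>, of z]] unfolding t_def by (rule sums_unique[symmetric])
  also have "\<dots> = 0" using zero by simp
  finally have lim0: "(\<lambda>N. \<Sum>n. a n N) \<longlonglongrightarrow> 0" .
  have aN: "(\<Sum>n. a n N) = (\<Prod>j<N. 1 + e j z) * (\<Prod>j<N. 1 + e j (- z))" for N
  proof -
    have "(\<Sum>n. a n N) = (\<Sum>n\<le>N. a n N)"
      by (rule suminf_finite) (auto simp: a_def gauss_binomial_eq_0)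
    also have "\<dots> = (\<Sum>n\<le>N. gauss_binomial Q (2 * N) (N + n) * t (real n))
        + (\<Sum>n\<le>N. if n < N then gauss_binomial Q (2 * N) (N - Suc n) * t (- (real n + 1)) else 0)"
      unfolding a_def by (rule sum.distrib)
    also have "(\<Sum>n\<le>N. if n < N then gauss_binomial Q (2 * N) (N - Suc n) * t (- (real n + 1)) else 0)
        = (\<Sum>n<N. gauss_binomial Q (2 * N) (N - Suc n) * t (- (real n + 1)))"
      by (rule sum.mono_neutral_cong_right) auto
    also have "\<dots> = (\<Sum>n<N. gauss_binomial Q (2 * N) (N - Suc n) * t (real (N - Suc n) - real N))"
      by (rule sum.cong) (auto simp: of_nat_diff algebra_simps intro!: arg_cong[of _ _ t])
    also have "(\<Sum>n\<le>N. gauss_binomial Q (2 * N) (N + n) * t (real n)) =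
        (\<Sum>n\<le>N. gauss_binomial Q (2 * N) (N + n) * t (real (N + n) - real N))" by simp
    also have "\<dots> + (\<Sum>n<N. gauss_binomial Q (2 * N) (N - Suc n) * t (real (N - Suc n) - real N))
        = (\<Sum>k\<le>2 * N. gauss_binomial Q (2 * N) k * t (real k - real N))"
      by (rule sum_split_middle[symmetric])
    also have "\<dots> = (\<Prod>j<N. (1 + e j z) * (1 + e j (- z)))"
      unfolding t_def Q_def e_def by (rule finite_triple_product[symmetric])
    finally show ?thesis by (simp add: prod.distrib)
  qed
  have "convergent_prod (\<lambda>j. 1 + e j u)" for u
  proof -
    have "(\<lambda>j. 1 + e j u) = (\<lambda>j. 1 + e 0 u * Q ^ j)"
      unfolding e_def Q_def exp_of_nat_mult[symmetric] exp_add[symmetric]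
      by (rule ext, rule arg_cong[of _ _ "\<lambda>t. 1 + exp t"]) (simp add: algebra_simps)
    then show ?thesis using convergent_prod_one_plus_geometric[OF Q1, of "e 0 u"] by metis
  qed
  note conv = this
  obtain L1 where L1: "(\<lambda>N. \<Prod>j<N. 1 + e j z) \<longlonglongrightarrow> L1" "L1 \<noteq> 0"
    using LIMSEQ_prod_nonzero[OF conv nz(1)] .
  obtain L2 where L2: "(\<lambda>N. \<Prod>j<N. 1 + e j (- z)) \<longlonglongrightarrow> L2" "L2 \<noteq> 0"
    using LIMSEQ_prod_nonzero[OF conv nz(2)] .
  from L1 L2 have "(\<lambda>N. \<Sum>n. a n N) \<longlonglongrightarrow> L1 * L2" "L1 * L2 \<noteq> 0"
    unfolding aN by (auto intro: tendsto_mult)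
  then show False using lim0 LIMSEQ_unique by blast
qed

section \<open>Zero sets inside shifted period lattices\<close>

lemma theta3_zero_lattice:
  assumes "Im \<tau> > 0" "theta3 \<tau> z = 0"
  obtains m n :: int where "z = of_real pi * (of_int m + 1/2) + of_real pi * \<tau> * (of_int n + 1/2)"
proof -
  obtain j :: nat and s :: complex where s: "s \<in> {1, -1}"
    and "exp (\<i> * of_real pi * \<tau> * of_nat (2 * j + 1) + 2 * \<i> * (s * z)) = -1"
    using theta3_eq_0D[OF assms] by blast
  then have "exp (\<i> * of_real pi * \<tau> * of_nat (2 * j + 1) + 2 * \<i> * (s * z)) = exp (\<i> * of_real pi)"
    by simp
  then obtain k :: int where "\<i> * of_real pi * \<tau> * of_nat (2 * j + 1) + 2 * \<i> * (s * z)
      = \<i> * of_real pi + of_int (2 * k) * of_real pi * \<i>"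
    unfolding exp_eq by auto
  then have "\<i> * (of_real pi * \<tau> * of_nat (2 * j + 1) + 2 * (s * z)) = \<i> * (of_real pi + of_int (2 * k) * of_real pi)"
    by (simp add: algebra_simps)
  then have k: "of_real pi * \<tau> * of_nat (2 * j + 1) + 2 * (s * z) = of_real pi + of_int (2 * k) * of_real pi"
    by (metis complex_i_not_zero mult_cancel_left)
  have ss: "s * s = 1" using s by auto
  have "z = s * (s * z)" by (simp add: ss flip: mult.assoc)
  also have "s * z = (of_real pi * of_int (2 * k + 1) - of_real pi * \<tau> * of_nat (2 * j + 1)) / 2"
    using k by (simp add: algebra_simps)
  finally have z: "z = s * ((of_real pi * of_int (2 * k + 1) - of_real pi * \<tau> * of_nat (2 * j + 1)) / 2)" .
  show ?thesis
  proof (cases "s = 1")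
    case True
    \<comment> \<open>Here - (2 j + 1) / 2 = (- j - 1) + 1/2. For s = -1 the same rewriting applies
      to 2 k + 1.\<close>
    show ?thesis by (rule that[of k "- int j - 1"]) (simp add: z True field_simps)
  next
    case False
    then have "s = -1" using s by auto
    then show ?thesis by (intro that[of "- k - 1" "int j"]) (simp add: z field_simps)
  qed
qed

lemma theta2_zero_lattice:
  assumes "Im \<tau> > 0" "theta2 \<tau> z = 0"
  obtains m n :: int where "z = of_real pi * (of_int m + 1/2) + of_real pi * \<tau> * of_int n"
proof -
  have "theta3 \<tau> (z + of_real pi * \<tau> / 2) = 0" using assms by (simp add: theta2_eq_theta3)
  then obtain m n :: int where
    "z + of_real pi * \<tau> / 2 = of_real pi * (of_int m + 1/2) + of_real pi * \<tau> * (of_int n + 1/2)"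
    using theta3_zero_lattice[OF assms(1)] by blast
  then show ?thesis by (intro that[of m n]) (simp add: algebra_simps)
qed

lemma theta1_zero_lattice:
  assumes "Im \<tau> > 0" "theta1 \<tau> z = 0"
  obtains m n :: int where "z = of_real pi * of_int m + of_real pi * \<tau> * of_int n"
proof -
  obtain m n :: int where "z - of_real pi / 2 = of_real pi * (of_int m + 1/2) + of_real pi * \<tau> * of_int n"
    using assms theta2_zero_lattice[of \<tau> "z - of_real pi / 2"] by (auto simp: theta1_eq_theta2)
  then show ?thesis by (intro that[of "m + 1" n]) (simp add: algebra_simps)
qed

lemma theta4_zero_lattice:
  assumes "Im \<tau> > 0" "theta4 \<tau> z = 0"
  obtains m n :: int where "z = of_real pi * of_int m + of_real pi * \<tau> * (of_int n + 1/2)"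
proof -
  obtain m n :: int where "z + of_real pi / 2 = of_real pi * (of_int m + 1/2) + of_real pi * \<tau> * (of_int n + 1/2)"
    using assms theta3_zero_lattice[of \<tau> "z + of_real pi / 2"] by (auto simp: theta4_eq_theta3)
  then show ?thesis by (intro that[of m n]) (simp add: algebra_simps)
qed

text \<open>\<open>theta4\<close> and \<open>theta1\<close> differ by half a quasi-period. The right
  side has the form constant, exponential of a linear function, shifted \<open>theta1\<close> that
  the assumption \<open>shift\<close> of \<open>theta_pair\<close> prescribes.\<close>

lemma theta4_shift:
  assumes "Im \<tau> > 0"
  shows "theta4 \<tau> z = exp (- (\<i> * of_real pi * \<tau> / 4 + \<i> * (- of_real pi * \<tau> / 2 - of_real pi / 2))) * exp (- \<i> * z)
      * theta1 \<tau> (z + - of_real pi * \<tau> / 2)"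
proof -
  have "theta1 \<tau> (z + - of_real pi * \<tau> / 2) =
      exp (\<i> * of_real pi * \<tau> / 4 + \<i> * (z + - of_real pi * \<tau> / 2 - of_real pi / 2)) * theta3 \<tau> (z - of_real pi / 2)"
    unfolding theta1_eq_theta2 theta2_eq_theta3[OF assms] by (simp add: algebra_simps)
  also have "theta3 \<tau> (z - of_real pi / 2) = theta4 \<tau> z"
    using theta3_plus_pi[of \<tau> "z - of_real pi / 2"] by (simp add: theta4_eq_theta3[OF assms] field_simps)
  finally have "theta1 \<tau> (z + - of_real pi * \<tau> / 2) =
      exp (\<i> * of_real pi * \<tau> / 4 + \<i> * (z + - of_real pi * \<tau> / 2 - of_real pi / 2)) * theta4 \<tau> z" .
  then show ?thesis
    by (simp add: exp_add[symmetric] mult.assoc[symmetric]) (simp add: algebra_simps)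
qed


section \<open>A criterion for elastica\<close>

lemma has_vector_derivative_divide_real:
  fixes P :: "real \<Rightarrow> complex" and Y :: "real \<Rightarrow> real"
  assumes "(P has_vector_derivative P') (at s within S)"
    "(Y has_real_derivative Y') (at s within S)" "Y s \<noteq> 0"
  shows "((\<lambda>s. P s / of_real (Y s)) has_vector_derivative
      (P' / of_real (Y s) - P s * of_real Y' / (of_real (Y s))\<^sup>2)) (at s within S)"
proof -
  have "((\<lambda>s. inverse (Y s)) has_real_derivative - (inverse (Y s) * Y' * inverse (Y s))) (at s within S)"
    using DERIV_inverse'[OF assms(2,3)] .
  from has_vector_derivative_scaleR[OF this assms(1)]
  show ?thesis
    using assms(3)
    by (simp add: scaleR_conv_of_real divide_inverse mult_ac power2_eq_square)
qed

lemma has_real_derivative_Im: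
  assumes "(f has_vector_derivative f') F"
  shows "((\<lambda>x. Im (f x)) has_real_derivative Im f') F"
  using bounded_linear.has_vector_derivative[OF bounded_linear_Im assms]
  by (simp add: has_real_derivative_iff_has_vector_derivative)

lemma has_real_derivative_Re:
  assumes "(f has_vector_derivative f') F"
  shows "((\<lambda>x. Re (f x)) has_real_derivative Re f') F"
  using bounded_linear.has_vector_derivative[OF bounded_linear_Re assms]
  by (simp add: has_real_derivative_iff_has_vector_derivative)

lemma has_vector_derivative_cnj':
  assumes "(f has_vector_derivative f') F"
  shows "((\<lambda>x. cnj (f x)) has_vector_derivative cnj f') F"
  using bounded_linear.has_vector_derivative[OF bounded_linear_cnj assms] .

text \<open>Differentiating cnj T T = 1 shows that cnj T T' is purely imaginary. It is applied both
  along the curve and in the variation parameter.\<close>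

lemma unit_derivative_parallel:
  fixes T :: "real \<Rightarrow> complex"
  assumes T': "(T has_vector_derivative T') (at t within S)"
    and unit: "\<And>x. x \<in> S \<Longrightarrow> norm (T x) = 1" and S: "t \<in> S" "at t within S \<noteq> bot"
  shows "T' = \<i> * of_real (Im (cnj (T t) * T')) * T t"
proof -
  have TT: "cnj (T x) * T x = 1" if "x \<in> S" for x
    using unit[OF that] by (simp add: complex_norm_square[symmetric] mult.commute)
  have "((\<lambda>s. cnj (T s) * T s) has_vector_derivative cnj (T t) * T' + cnj T' * T t) (at t within S)"
    by (rule has_vector_derivative_mult[OF has_vector_derivative_cnj'[OF T'] T'])
  moreover have "((\<lambda>s. cnj (T s) * T s) has_vector_derivative 0) (at t within S)"
    by (rule has_vector_derivative_transform[OF S(1) TT]) simp_all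
  ultimately have "cnj (T t) * T' + cnj T' * T t = 0"
    by (rule vector_derivative_unique_within[OF S(2)])
  then have "Re (cnj (T t) * T') = 0"
    by (simp add: complex_eq_iff algebra_simps)
  then have "cnj (T t) * T' = \<i> * of_real (Im (cnj (T t) * T'))"
    by (simp add: complex_eq_iff)
  then have "cnj (T t) * T t * T' = \<i> * of_real (Im (cnj (T t) * T')) * T t"
    by (metis mult.assoc mult.commute)
  then show ?thesis by (simp add: TT[OF S(1)])
qed

text \<open>In hyperbolic arclength the Euclidean speed equals the height, so \<open>sgn\<close> of
  the velocity can be replaced by its quotient with Im c, which is easy to differentiate.\<close>

lemma curve_tangent_angle:
  fixes c P P2 :: "real \<Rightarrow> complex"
  assumes "L > 0"
    and c: "\<And>s. s \<in> {0..L} \<Longrightarrow> (c has_vector_derivative P s) (at s within {0..L})"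
    and P: "\<And>s. s \<in> {0..L} \<Longrightarrow> (P has_vector_derivative P2 s) (at s within {0..L})"
    and Y: "\<And>s. s \<in> {0..L} \<Longrightarrow> Im (c s) > 0 \<and> norm (P s) = Im (c s)"
    and s: "s \<in> {0..L}"
  defines "T \<equiv> (\<lambda>s. P s / of_real (Im (c s)))"
  defines "Ts \<equiv> (\<lambda>s. P2 s / of_real (Im (c s)) - P s * of_real (Im (P s)) / (of_real (Im (c s)))\<^sup>2)"
  shows "unit_tangent {0..L} c s = T s"
    and "(T has_vector_derivative Ts s) (at s within {0..L})"
    and "angle_deriv L c s = Im (cnj (T s) * Ts s)"
    and "Ts s = \<i> * of_real (Im (cnj (T s) * Ts s)) * T s"
    and "norm (T s) = 1"
proof -
  have T: "unit_tangent {0..L} c s = T s" if "s \<in> {0..L}" for s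
    using vector_derivative_within_closed_interval[OF \<open>L > 0\<close> that c[OF that]] Y[OF that]
    by (simp add: unit_tangent_def T_def sgn_div_norm scaleR_conv_of_real divide_inverse mult.commute)
  then show "unit_tangent {0..L} c s = T s" using s .
  have Ts: "(T has_vector_derivative Ts s) (at s within {0..L})" if "s \<in> {0..L}" for s
    unfolding T_def Ts_def
    by (rule has_vector_derivative_divide_real[OF P[OF that] has_real_derivative_Im[OF c[OF that]]])
      (use Y[OF that] in simp)
  then show "(T has_vector_derivative Ts s) (at s within {0..L})" using s .
  have "(unit_tangent {0..L} c has_vector_derivative Ts s) (at s within {0..L})"
    using has_vector_derivative_transform[OF s _ Ts[OF s]] T by metis
  then show "angle_deriv L c s = Im (cnj (T s) * Ts s)"
    unfolding angle_deriv_def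
    using vector_derivative_within_closed_interval[OF \<open>L > 0\<close> s] T[OF s] by metis
  have nT: "norm (T s) = 1" if "s \<in> {0..L}" for s
    using Y[OF that] by (simp add: T_def norm_divide)
  then show "norm (T s) = 1" using s .
  have "at s within {0..L} \<noteq> bot"
    using s \<open>L > 0\<close> by (simp add: trivial_limit_within)
  then show "Ts s = \<i> * of_real (Im (cnj (T s) * Ts s)) * T s"
    using unit_derivative_parallel[OF Ts[OF s] nT s] by simp
qed

text \<open>Let \<sigma> be the tangent angle and \<eta> its variation. Since the parameter stays
  arclength, the curvature \<sigma>' + cos \<sigma> varies by \<eta>' - \<eta> sin \<sigma>. With
  \<open>curv\<close>, the varied energy plus 2 \<beta> times the varied area has an integrand with
  a primitive built from \<eta>, the variation of log y and x/y. Each of these agrees at the two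
  ends: the first by equal end tangents, the second by the fixed period, the third by
  \<open>per\<close>.\<close>

lemma elastica_criterion:
  fixes c :: "real \<Rightarrow> complex" and \<alpha> \<beta> L :: real
  assumes arc: "arclength_curve L c" and ends: "equal_end_tangents L c"
    and curv: "\<And>s. s \<in> {0..L} \<Longrightarrow> hyp_curvature L c s = \<alpha> * (Re (c s) / Im (c s)) - \<beta>"
    and per: "Re (c L) / Im (c L) = Re (c 0) / Im (c 0)"
  shows "area_constrained_quasiperiodic_elastica L c"
  unfolding area_constrained_quasiperiodic_elastica_def
proof (intro conjI allI impI arc ends)
  fix \<epsilon> \<Gamma> assume adm: "admissible_variation L c \<epsilon> \<Gamma>"
  define I J where "I = {-\<epsilon><..<\<epsilon>}" and "J = {0..L}"
  have L: "L > 0" using arc by (simp add: arclength_curve_def)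
  have \<epsilon>: "\<epsilon> > 0" and \<Gamma>0: "\<And>s. s \<in> J \<Longrightarrow> \<Gamma> 0 s = c s"
    and arc\<Gamma>: "\<And>t. t \<in> I \<Longrightarrow> arclength_curve L (\<Gamma> t)"
    and ends\<Gamma>: "\<And>t. t \<in> I \<Longrightarrow> equal_end_tangents L (\<Gamma> t)"
    and area\<Gamma>: "\<And>t. t \<in> I \<Longrightarrow> hyp_area L (\<Gamma> t) = hyp_area L c"
    and per\<Gamma>: "\<And>t. t \<in> I \<Longrightarrow> translational_period L (\<Gamma> t) = translational_period L c"
    using adm by (auto simp: admissible_variation_def I_def J_def)
  have I0: "0 \<in> I" "open I" "convex I" using \<epsilon> by (auto simp: I_def)
  have J0: "0 \<in> J" "L \<in> J" using L by (auto simp: J_def)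
  from adm obtain D where D00: "D 0 0 = \<Gamma>"
    and cD: "\<And>i j. continuous_on (I \<times> J) (\<lambda>(t, s). D i j t s)"
    and Dt: "\<And>i j t s. t \<in> I \<Longrightarrow> s \<in> J \<Longrightarrow>
        ((\<lambda>t. D i j t s) has_vector_derivative D (Suc i) j t s) (at t)"
    and Ds: "\<And>i j t s. t \<in> I \<Longrightarrow> s \<in> J \<Longrightarrow>
        ((\<lambda>s. D i j t s) has_vector_derivative D i (Suc j) t s) (at s within J)"
    unfolding admissible_variation_def smooth_family_def I_def J_def by blast
  note Dt_Im = has_real_derivative_Im[OF Dt] and Ds_Im = has_real_derivative_Im[OF Ds]
  define Y where "Y = (\<lambda>t s. Im (D 0 0 t s))"
  define T where "T = (\<lambda>t s. D 0 1 t s / of_real (Y t s))"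
  define Ts where "Ts = (\<lambda>t s. D 0 2 t s / of_real (Y t s)
     - D 0 1 t s * of_real (Im (D 0 1 t s)) / (of_real (Y t s))\<^sup>2)"
  define Tt where "Tt = (\<lambda>t s. D 1 1 t s / of_real (Y t s)
     - D 0 1 t s * of_real (Im (D 1 0 t s)) / (of_real (Y t s))\<^sup>2)"
  \<comment> \<open>This one expression is verified to be both the t-derivative of \<open>Ts\<close>
    and the s-derivative of \<open>Tt\<close>, so the mixed derivatives of the tangent
    agree.\<close>
  define Tts where "Tts = (\<lambda>t s. D 1 2 t s / of_real (Y t s)
     - (D 0 2 t s * of_real (Im (D 1 0 t s)) + D 1 1 t s * of_real (Im (D 0 1 t s))
         + D 0 1 t s * of_real (Im (D 1 1 t s))) / (of_real (Y t s))\<^sup>2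
     + 2 * D 0 1 t s * of_real (Im (D 0 1 t s) * Im (D 1 0 t s)) / (of_real (Y t s))^3)"
  have Y: "Y t s > 0" "norm (D 0 1 t s) = Y t s" if "t \<in> I" "s \<in> J" for t s
  proof -
    have "vector_derivative (\<Gamma> t) (at s within {0..L}) = D 0 1 t s"
      using Ds[OF that, of 0 0] that
      by (intro vector_derivative_within_closed_interval[OF L]) (simp_all add: D00 J_def)
    moreover have "Im (\<Gamma> t s) > 0" "cmod (vector_derivative (\<Gamma> t) (at s within {0..L})) / Im (\<Gamma> t s) = 1"
      using arc\<Gamma>[OF that(1), unfolded arclength_curve_def] that(2)[unfolded J_def] by blast+
    ultimately show "Y t s > 0" "norm (D 0 1 t s) = Y t s"
      by (simp_all add: D00 Y_def)
  qed
  have dT_t: "((\<lambda>t. T t s) has_vector_derivative Tt t s) (at t)" if "t \<in> I" "s \<in> J" for t s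
    unfolding T_def Tt_def Y_def
    using has_vector_derivative_divide_real[OF Dt[OF that, of 0 1] Dt_Im[OF that, of 0 0]] Y(1)[OF that]
    by (simp add: Y_def)
  have sq: "((\<lambda>x. (f x)\<^sup>2) has_real_derivative 2 * f x * f') (at x within S)"
    if "(f has_real_derivative f') (at x within S)" for f f' x S
    using DERIV_power[OF that, of 2] by (simp add: mult_ac)
  have dTs_t: "((\<lambda>t. Ts t s) has_vector_derivative Tts t s) (at t)" if "t \<in> I" "s \<in> J" for t s
  proof -
    have 1: "((\<lambda>t. D 0 1 t s * of_real (Im (D 0 1 t s))) has_vector_derivative
        D 0 1 t s * of_real (Im (D 1 1 t s)) + D 1 1 t s * of_real (Im (D 0 1 t s))) (at t)"
      by (rule has_vector_derivative_mult[OF Dt[OF that, of 0 1, unfolded One_nat_def[symmetric]]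
            has_vector_derivative_of_real[OF Dt_Im[OF that, of 0 1, unfolded One_nat_def[symmetric]]]])
    have 2: "((\<lambda>t. D 0 2 t s / of_real (Y t s)) has_vector_derivative
        (D 1 2 t s / of_real (Y t s) - D 0 2 t s * of_real (Im (D 1 0 t s)) / (of_real (Y t s))\<^sup>2)) (at t)"
      using has_vector_derivative_divide_real[OF Dt[OF that, of 0 2] Dt_Im[OF that, of 0 0]] Y(1)[OF that]
      by (simp add: Y_def)
    have 3: "((\<lambda>t. D 0 1 t s * of_real (Im (D 0 1 t s)) / of_real ((Y t s)\<^sup>2)) has_vector_derivative
        ((D 0 1 t s * of_real (Im (D 1 1 t s)) + D 1 1 t s * of_real (Im (D 0 1 t s))) / of_real ((Y t s)\<^sup>2)
         - D 0 1 t s * of_real (Im (D 0 1 t s)) * of_real (2 * Y t s * Im (D 1 0 t s)) / (of_real ((Y t s)\<^sup>2))\<^sup>2)) (at t)"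
      using has_vector_derivative_divide_real[OF 1 sq[OF Dt_Im[OF that, of 0 0]]] Y(1)[OF that]
      by (simp add: Y_def)
    have "((\<lambda>t. D 0 2 t s / of_real (Y t s) - D 0 1 t s * of_real (Im (D 0 1 t s)) / of_real ((Y t s)\<^sup>2))
        has_vector_derivative Tts t s) (at t)"
      by (rule has_vector_derivative_eq_rhs[OF has_vector_derivative_diff[OF 2 3]])
        (use Y(1)[OF that] in \<open>simp add: Tts_def field_simps power2_eq_square power3_eq_cube\<close>)
    then show ?thesis by (simp add: Ts_def)
  qed
  have dTt_s: "((\<lambda>s. Tt t s) has_vector_derivative Tts t s) (at s within J)" if "t \<in> I" "s \<in> J" for t s
  proof -
    have 1: "((\<lambda>s. D 0 1 t s * of_real (Im (D 1 0 t s))) has_vector_derivative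
        D 0 1 t s * of_real (Im (D 1 1 t s)) + D 0 2 t s * of_real (Im (D 1 0 t s))) (at s within J)"
      using has_vector_derivative_mult[OF Ds[OF that, of 0 1] has_vector_derivative_of_real[OF Ds_Im[OF that, of 1 0]]]
      by (simp add: numeral_2_eq_2)
    have 2: "((\<lambda>s. D 1 1 t s / of_real (Y t s)) has_vector_derivative
        (D 1 2 t s / of_real (Y t s) - D 1 1 t s * of_real (Im (D 0 1 t s)) / (of_real (Y t s))\<^sup>2)) (at s within J)"
      using has_vector_derivative_divide_real[OF Ds[OF that, of 1 1] Ds_Im[OF that, of 0 0]] Y(1)[OF that]
      by (simp add: Y_def numeral_2_eq_2)
    have 3: "((\<lambda>s. D 0 1 t s * of_real (Im (D 1 0 t s)) / of_real ((Y t s)\<^sup>2)) has_vector_derivative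
        ((D 0 1 t s * of_real (Im (D 1 1 t s)) + D 0 2 t s * of_real (Im (D 1 0 t s))) / of_real ((Y t s)\<^sup>2)
         - D 0 1 t s * of_real (Im (D 1 0 t s)) * of_real (2 * Y t s * Im (D 0 1 t s)) / (of_real ((Y t s)\<^sup>2))\<^sup>2)) (at s within J)"
      using has_vector_derivative_divide_real[OF 1 sq[OF Ds_Im[OF that, of 0 0]]] Y(1)[OF that]
      by (simp add: Y_def)
    have "((\<lambda>s. D 1 1 t s / of_real (Y t s) - D 0 1 t s * of_real (Im (D 1 0 t s)) / of_real ((Y t s)\<^sup>2))
        has_vector_derivative Tts t s) (at s within J)"
      by (rule has_vector_derivative_eq_rhs[OF has_vector_derivative_diff[OF 2 3]])
        (use Y(1)[OF that] in \<open>simp add: Tts_def field_simps power2_eq_square power3_eq_cube\<close>)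
    then show ?thesis by (simp add: Tt_def)
  qed
  have geo: "unit_tangent {0..L} g s = T t s" "angle_deriv L g s = Im (cnj (T t s) * Ts t s)"
    "((\<lambda>s. T t s) has_vector_derivative Ts t s) (at s within J)"
    "Ts t s = \<i> * of_real (Im (cnj (T t s) * Ts t s)) * T t s" "norm (T t s) = 1"
    if t: "t \<in> I" and s: "s \<in> J" and g: "\<And>s. s \<in> J \<Longrightarrow> g s = \<Gamma> t s" for g t s
  proof -
    have 1: "(g has_vector_derivative D 0 1 t s) (at s within {0..L})" if "s \<in> {0..L}" for s
      by (rule has_vector_derivative_transform[OF that, of _ "\<Gamma> t"])
        (use g that Ds[OF t, of s 0 0] in \<open>simp_all add: J_def D00\<close>)
    have 2: "(D 0 1 t has_vector_derivative D 0 2 t s) (at s within {0..L})" if "s \<in> {0..L}" for s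
      using Ds[OF t, of s 0 1] that by (simp add: J_def numeral_2_eq_2)
    have 3: "Im (g s) > 0 \<and> norm (D 0 1 t s) = Im (g s)" if "s \<in> {0..L}" for s
      using Y[OF t, of s] g[of s] that by (simp add: J_def Y_def D00)
    have Yg: "Y t s = Im (g s)" if "s \<in> J" for s using g[OF that] by (simp add: Y_def D00)
    note * = curve_tangent_angle[OF L 1 2 3 s[unfolded J_def]]
    show "unit_tangent {0..L} g s = T t s"
      unfolding T_def Yg[OF s] by (rule *(1))
    show "angle_deriv L g s = Im (cnj (T t s) * Ts t s)"
      unfolding T_def Ts_def Yg[OF s] by (rule *(3))
    show "Ts t s = \<i> * of_real (Im (cnj (T t s) * Ts t s)) * T t s"
      unfolding T_def Ts_def Yg[OF s] by (rule *(4))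
    show "norm (T t s) = 1"
      unfolding T_def Yg[OF s] by (rule *(5))
    have "((\<lambda>s. D 0 1 t s / of_real (Im (g s))) has_vector_derivative Ts t s) (at s within J)"
      unfolding Ts_def J_def Yg[OF s] by (rule *(2))
    then show "((\<lambda>s. T t s) has_vector_derivative Ts t s) (at s within J)"
      by (rule has_vector_derivative_transform[OF s, rotated]) (simp add: T_def Yg)
  qed
  define \<kappa> where "\<kappa> = (\<lambda>t s. Im (cnj (T t s) * Ts t s) + Re (T t s))"
  define \<kappa>t where "\<kappa>t = (\<lambda>t s. Im (cnj (T t s) * Tts t s + cnj (Tt t s) * Ts t s) + Re (Tt t s))"
  have curv\<Gamma>: "hyp_curvature L (\<Gamma> t) s = \<kappa> t s" "angle_deriv L (\<Gamma> t) s = \<kappa> t s - Re (T t s)"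
    if "t \<in> I" "s \<in> J" for t s
    using geo[OF that refl] by (simp_all add: hyp_curvature_def \<kappa>_def)
  have \<kappa>0: "\<kappa> 0 s = \<alpha> * (Re (D 0 0 0 s) / Y 0 s) - \<beta>" if "s \<in> J" for s
    using curv[of s] geo(1,2)[OF I0(1) that, of c] \<Gamma>0 that
    by (simp add: hyp_curvature_def \<kappa>_def J_def Y_def D00)
  have d\<kappa>: "((\<lambda>t. \<kappa> t s) has_real_derivative \<kappa>t t s) (at t)" if "t \<in> I" "s \<in> J" for t s
    unfolding \<kappa>_def \<kappa>t_def
    by (intro DERIV_add has_real_derivative_Im has_real_derivative_Re has_vector_derivative_mult
        has_vector_derivative_cnj' dT_t dTs_t that)
  have cD': "continuous_on (I \<times> J) (\<lambda>p. D i j (fst p) (snd p))" for i j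
    using cD[of i j] by (simp add: case_prod_unfold)
  have Ynz: "\<forall>p\<in>I \<times> J. complex_of_real (Im (D 0 0 (fst p) (snd p))) \<noteq> 0"
    using Y(1) by (force simp: Y_def)
  have cont: "continuous_on (I \<times> J) (\<lambda>p. T (fst p) (snd p))"
    "continuous_on (I \<times> J) (\<lambda>p. Ts (fst p) (snd p))"
    "continuous_on (I \<times> J) (\<lambda>p. Tt (fst p) (snd p))"
    "continuous_on (I \<times> J) (\<lambda>p. Tts (fst p) (snd p))"
    unfolding T_def Ts_def Tt_def Tts_def Y_def
    using Ynz by (auto intro!: continuous_intros cD')
  have cont\<kappa>: "continuous_on (I \<times> J) (\<lambda>p. \<kappa> (fst p) (snd p))"
    "continuous_on (I \<times> J) (\<lambda>p. \<kappa>t (fst p) (snd p))"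
    unfolding \<kappa>_def \<kappa>t_def by (intro continuous_intros cont)+
  have slice: "continuous_on J (f t)" if "continuous_on (I \<times> J) (\<lambda>p. f (fst p) (snd p))" "t \<in> I"
    for f :: "real \<Rightarrow> real \<Rightarrow> real" and t
  proof -
    have "continuous_on J (\<lambda>s. (t, s))" by (intro continuous_intros)
    moreover have "(\<lambda>s. (t, s)) ` J \<subseteq> I \<times> J" using that(2) by auto
    ultimately show ?thesis using continuous_on_compose2[OF that(1)] by fastforce
  qed
  have leibniz: "((\<lambda>t. integral J (f t)) has_real_derivative integral J (f' 0)) (at 0)"
    if "\<And>t s. t \<in> I \<Longrightarrow> s \<in> J \<Longrightarrow> ((\<lambda>t. f t s) has_real_derivative f' t s) (at t)"
      "continuous_on (I \<times> J) (\<lambda>p. f (fst p) (snd p))"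
      "continuous_on (I \<times> J) (\<lambda>p. f' (fst p) (snd p))"
    for f f' :: "real \<Rightarrow> real \<Rightarrow> real"
  proof -
    have "((\<lambda>t. integral (cbox 0 L) (f t)) has_real_derivative integral (cbox 0 L) (f' 0)) (at 0 within I)"
      by (rule leibniz_rule_field_derivative[OF _ _ _ I0(1,3)])
        (use that slice[OF that(2)] in \<open>auto simp: J_def case_prod_unfold
           intro!: DERIV_subset[OF that(1)] integrable_continuous_interval\<close>)
    then show ?thesis by (simp add: J_def at_within_open[OF I0(1,2)])
  qed
  have "((\<lambda>t. integral J (\<lambda>s. (\<kappa> t s)\<^sup>2)) has_real_derivative
      integral J (\<lambda>s. 2 * \<kappa> 0 s * \<kappa>t 0 s)) (at 0)"
    by (rule leibniz) (auto intro!: sq d\<kappa> continuous_intros cont\<kappa>)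
  then have energy: "((\<lambda>t. bending_energy L (\<Gamma> t)) has_real_derivative
      integral J (\<lambda>s. 2 * \<kappa> 0 s * \<kappa>t 0 s)) (at 0)"
    by (rule has_field_derivative_transform_within_open[OF _ I0(2,1)])
      (auto simp: bending_energy_def J_def curv\<Gamma> intro!: integral_cong)
  \<comment> \<open>The angle derivative is \<kappa> - Re T, so the area integrand equals 2 \<kappa>
    - Re T.\<close>
  have "((\<lambda>t. integral J (\<lambda>s. 2 * \<kappa> t s - Re (T t s))) has_real_derivative
      integral J (\<lambda>s. 2 * \<kappa>t 0 s - Re (Tt 0 s))) (at 0)"
    by (rule leibniz) (auto intro!: DERIV_diff DERIV_cmult d\<kappa> has_real_derivative_Re dT_t continuous_intros cont\<kappa> cont)
  then have "((\<lambda>t. hyp_area L (\<Gamma> t)) has_real_derivative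
      integral J (\<lambda>s. 2 * \<kappa>t 0 s - Re (Tt 0 s))) (at 0)"
    by (rule has_field_derivative_transform_within_open[OF _ I0(2,1)])
      (auto simp: hyp_area_def J_def curv\<Gamma> intro!: integral_cong)
  moreover have "((\<lambda>t. hyp_area L (\<Gamma> t)) has_real_derivative 0) (at 0)"
    by (rule has_field_derivative_transform_within_open[OF DERIV_const I0(2,1)])
      (simp add: area\<Gamma>)
  ultimately have area0: "integral J (\<lambda>s. 2 * \<kappa>t 0 s - Re (Tt 0 s)) = 0"
    by (rule DERIV_unique)
  \<comment> \<open>The variation of log y. Its s-derivative is the variation of sin \<sigma>, the
    integrand of log p, so a fixed period gives equal end values.\<close>
  define \<phi> where "\<phi> = (\<lambda>s. Im (D 1 0 0 s) / Y 0 s)"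
  have d\<phi>: "(\<phi> has_real_derivative Im (Tt 0 s)) (at s within J)" if "s \<in> J" for s
  proof -
    have "(\<phi> has_real_derivative
        (Im (D 1 1 0 s) * Im (D 0 0 0 s) - Im (D 1 0 0 s) * Im (D 0 1 0 s)) / (Im (D 0 0 0 s) * Im (D 0 0 0 s)))
        (at s within J)"
      unfolding \<phi>_def Y_def
      using DERIV_divide[OF Ds_Im[OF I0(1) that, of 1 0] Ds_Im[OF I0(1) that, of 0 0]] Y(1)[OF I0(1) that]
      by (simp add: Y_def)
    moreover have "Im (Tt 0 s) = (Im (D 1 1 0 s) * Im (D 0 0 0 s) - Im (D 1 0 0 s) * Im (D 0 1 0 s)) / (Im (D 0 0 0 s) * Im (D 0 0 0 s))"
      using Y(1)[OF I0(1) that]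
      by (simp add: Tt_def Y_def field_simps power2_eq_square flip: of_real_mult)
    ultimately show ?thesis by simp
  qed
  have \<phi>_ends: "\<phi> L = \<phi> 0"
  proof -
    have "((\<lambda>t. Y t L / Y t 0) has_real_derivative
        (Im (D 1 0 0 L) * Y 0 0 - Y 0 L * Im (D 1 0 0 0)) / (Y 0 0 * Y 0 0)) (at 0)"
      using DERIV_divide[OF Dt_Im[OF I0(1) J0(2), of 0 0] Dt_Im[OF I0(1) J0(1), of 0 0]] Y(1)[OF I0(1) J0(1)]
      by (simp add: Y_def)
    moreover have "((\<lambda>t. Y t L / Y t 0) has_real_derivative 0) (at 0)"
      by (rule has_field_derivative_transform_within_open[OF DERIV_const I0(2,1), of "translational_period L c"])
        (use per\<Gamma> in \<open>simp add: translational_period_def Y_def D00\<close>)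
    ultimately have "(Im (D 1 0 0 L) * Y 0 0 - Y 0 L * Im (D 1 0 0 0)) / (Y 0 0 * Y 0 0) = 0"
      by (rule DERIV_unique)
    then show ?thesis using Y(1)[OF I0(1) J0(1)] Y(1)[OF I0(1) J0(2)]
      by (simp add: \<phi>_def field_simps)
  qed
  \<comment> \<open>The variation of the tangent angle, obtained without choosing a lift of the
    angle.\<close>
  define \<eta> where "\<eta> = (\<lambda>s. Im (cnj (T 0 s) * Tt 0 s))"
  define \<eta>' where "\<eta>' = (\<lambda>s. Im (cnj (T 0 s) * Tts 0 s + cnj (Ts 0 s) * Tt 0 s))"
  have d\<eta>: "(\<eta> has_real_derivative \<eta>' s) (at s within J)" if "s \<in> J" for s
    unfolding \<eta>_def \<eta>'_def
    by (intro has_real_derivative_Im has_vector_derivative_mult has_vector_derivative_cnj'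
        geo(3)[OF I0(1) that refl] dTt_s I0(1) that)
  have \<eta>_ends: "\<eta> L = \<eta> 0"
  proof -
    have TL: "T t L = T t 0" if "t \<in> I" for t
      using ends\<Gamma>[OF that] geo(1)[OF that J0(1) refl] geo(1)[OF that J0(2) refl]
      by (simp add: equal_end_tangents_def)
    have "((\<lambda>t. T t L) has_vector_derivative Tt 0 0) (at 0)"
      by (rule has_vector_derivative_transform_within_open[OF dT_t[OF I0(1) J0(1)] I0(2,1)])
        (simp add: TL)
    then have "Tt 0 L = Tt 0 0"
      using dT_t[OF I0(1) J0(2)] vector_derivative_unique_at by blast
    then show ?thesis by (simp add: \<eta>_def TL[OF I0(1)])
  qed
  have Tt: "Tt 0 s = \<i> * of_real (\<eta> s) * T 0 s" if "s \<in> J" for s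
    unfolding \<eta>_def
    by (rule unit_derivative_parallel[where S = I])
      (use I0 that geo(5)[OF _ that refl] dT_t[OF I0(1) that] in
        \<open>auto simp: at_within_open[OF I0(1,2)]\<close>)
  define h where "h = (\<lambda>s. Re (D 0 0 0 s) / Y 0 s)"
  \<comment> \<open>The first term integrates 2 \<kappa> \<eta>' by parts and 4 \<beta> \<eta> comes
    from the varied area. Differentiating h in the first term leaves 2 \<alpha> \<eta> cos \<sigma>,
    which - 2 \<alpha> \<phi> removes; this is the multiplier term of the period constraint.\<close>
  define G where "G = (\<lambda>s. 2 * (\<alpha> * h s - \<beta>) * \<eta> s + 4 * \<beta> * \<eta> s - 2 * \<alpha> * \<phi> s)"
  have "(G has_real_derivative 2 * \<kappa> 0 s * \<kappa>t 0 s + 2 * \<beta> * (2 * \<kappa>t 0 s - Re (Tt 0 s))) (at s within J)"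
    if s: "s \<in> J" for s
  proof -
    define x y where "x = Re (D 0 0 0 s)" and "y = Y 0 s"
    have y: "y > 0" using Y(1)[OF I0(1) s] by (simp add: y_def)
    have "((\<lambda>s. Re (D 0 0 0 s) / Y 0 s) has_real_derivative
        (Re (D 0 1 0 s) * y - x * Im (D 0 1 0 s)) / (y * y)) (at s within J)"
      unfolding Y_def x_def y_def
      using DERIV_divide[OF has_real_derivative_Re[OF Ds[OF I0(1) s, of 0 0]] Ds_Im[OF I0(1) s, of 0 0]]
        Y(1)[OF I0(1) s] by (simp add: Y_def)
    moreover have "Re (D 0 1 0 s) = y * Re (T 0 s)" "Im (D 0 1 0 s) = y * Im (T 0 s)"
      using y by (simp_all add: T_def y_def)
    ultimately have dh: "(h has_real_derivative
        Re (T 0 s) - x / y * Im (T 0 s)) (at s within J)"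
    proof -
      assume d: "((\<lambda>s. Re (D 0 0 0 s) / Y 0 s) has_real_derivative
          (Re (D 0 1 0 s) * y - x * Im (D 0 1 0 s)) / (y * y)) (at s within J)"
      assume e: "Re (D 0 1 0 s) = y * Re (T 0 s)" "Im (D 0 1 0 s) = y * Im (T 0 s)"
      have "(Re (D 0 1 0 s) * y - x * Im (D 0 1 0 s)) / (y * y) = Re (T 0 s) - x / y * Im (T 0 s)"
        unfolding e using y by (simp add: divide_simps) (simp add: algebra_simps)
      with d show ?thesis unfolding h_def by simp
    qed
    have \<kappa>s: "\<kappa> 0 s = \<alpha> * (x / y) - \<beta>" using \<kappa>0[OF s] by (simp add: x_def y_def)
    have ReT: "Re (Tt 0 s) = - \<eta> s * Im (T 0 s)" and ImT: "Im (Tt 0 s) = \<eta> s * Re (T 0 s)"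
      unfolding Tt[OF s] by simp_all
    \<comment> \<open>T_t and T_s are both real multiples of i T, so their mixed product is real and
      drops out of the imaginary parts in \<kappa>t and \<eta>'.\<close>
    have "cnj (Tt 0 s) * Ts 0 s = of_real (\<eta> s * Im (cnj (T 0 s) * Ts 0 s)) * (cnj (T 0 s) * T 0 s)"
      by (subst Tt[OF s], subst geo(4)[OF I0(1) s refl]) (simp add: algebra_simps)
    also have "cnj (T 0 s) * T 0 s = 1"
      using geo(5)[OF I0(1) s refl] by (simp add: complex_norm_square[symmetric] mult.commute)
    finally have par: "cnj (Tt 0 s) * Ts 0 s = of_real (\<eta> s * Im (cnj (T 0 s) * Ts 0 s))" by simp
    then have "cnj (Ts 0 s) * Tt 0 s = of_real (\<eta> s * Im (cnj (T 0 s) * Ts 0 s))"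
      by (metis complex_cnj_cnj complex_cnj_complex_of_real complex_cnj_mult mult.commute)
    with par have \<kappa>t: "\<kappa>t 0 s = \<eta>' s - \<eta> s * Im (T 0 s)"
      unfolding \<kappa>t_def \<eta>'_def by (simp add: ReT)
    have hxy: "x / y = h s" by (simp add: h_def x_def y_def)
    have "(G has_real_derivative 2 * (\<alpha> * h s - \<beta>) * \<eta>' s
        + 2 * (\<alpha> * (Re (T 0 s) - h s * Im (T 0 s))) * \<eta> s + 4 * \<beta> * \<eta>' s - 2 * \<alpha> * Im (Tt 0 s)) (at s within J)"
      unfolding G_def
      by (rule derivative_eq_intros dh[unfolded hxy] d\<eta>[OF s] d\<phi>[OF s] refl)+ (simp add: algebra_simps)
    then show ?thesis
      unfolding \<kappa>s hxy \<kappa>t ReT ImT by (simp add: algebra_simps)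
  qed
  then have "((\<lambda>s. 2 * \<kappa> 0 s * \<kappa>t 0 s + 2 * \<beta> * (2 * \<kappa>t 0 s - Re (Tt 0 s))) has_integral G L - G 0) J"
    unfolding J_def using L
    by (intro fundamental_theorem_of_calculus)
      (simp_all add: J_def has_real_derivative_iff_has_vector_derivative[symmetric])
  moreover have "h L = h 0"
    using per \<Gamma>0[OF J0(1)] \<Gamma>0[OF J0(2)] by (simp add: h_def Y_def D00)
  then have "G L = G 0" by (simp add: G_def \<eta>_ends \<phi>_ends)
  ultimately have int0: "((\<lambda>s. 2 * \<kappa> 0 s * \<kappa>t 0 s + 2 * \<beta> * (2 * \<kappa>t 0 s - Re (Tt 0 s))) has_integral 0) J"
    by simp
  have "(\<lambda>s. 2 * \<kappa> 0 s * \<kappa>t 0 s) integrable_on J"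
    unfolding J_def
    by (rule integrable_continuous_interval, fold J_def,
        rule slice[where f = "\<lambda>t s. 2 * \<kappa> t s * \<kappa>t t s"])
      (intro continuous_intros cont\<kappa> I0(1))+
  moreover have "(\<lambda>s. 2 * \<kappa>t 0 s - Re (Tt 0 s)) integrable_on J"
    unfolding J_def
    by (rule integrable_continuous_interval, fold J_def,
        rule slice[where f = "\<lambda>t s. 2 * \<kappa>t t s - Re (Tt t s)"])
      (intro continuous_intros cont\<kappa> cont I0(1))+
  ultimately have "((\<lambda>s. 2 * \<kappa> 0 s * \<kappa>t 0 s + 2 * \<beta> * (2 * \<kappa>t 0 s - Re (Tt 0 s))) has_integral
      integral J (\<lambda>s. 2 * \<kappa> 0 s * \<kappa>t 0 s) + 2 * \<beta> * 0) J"
    by (intro has_integral_add has_integral_mult_right) (metis area0 integrable_integral)+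
  from has_integral_unique[OF int0 this]
  have "integral J (\<lambda>s. 2 * \<kappa> 0 s * \<kappa>t 0 s) = 0" by simp
  with energy show "((\<lambda>t. bending_energy L (\<Gamma> t)) has_real_derivative 0) (at 0)" by simp
qed

text \<open>The derivative of x/y is cos \<sigma> - (x/y) sin \<sigma>. Eliminating x/y with
  \<open>curv\<close> leaves a pendulum-like equation in \<sigma> alone, whose conserved energy is
  H. Dividing the quartic by T^2 and using that 1/T is cnj T turns it into the statement that this
  energy is constant.\<close>

lemma tangent_quartic_ode:
  fixes c P T Ts :: "real \<Rightarrow> complex" and \<alpha> \<beta> :: real
  assumes c: "\<And>s. (c has_vector_derivative P s) (at s)"
    and Y: "\<And>s. Im (c s) > 0 \<and> norm (P s) = Im (c s)"
    and T: "\<And>s. T s = P s / of_real (Im (c s))"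
    and Ts: "\<And>s. (T has_vector_derivative Ts s) (at s)"
    and curv: "\<And>s. Im (cnj (T s) * Ts s) + Re (T s) = \<alpha> * (Re (c s) / Im (c s)) - \<beta>"
  obtains \<mu> :: real where "\<And>s. (Ts s)\<^sup>2 + 1/4 * T s ^ 4 + cnj (Complex \<beta> \<alpha>) * T s ^ 3
      + of_real \<mu> * (T s)\<^sup>2 + Complex \<beta> \<alpha> * T s + 1/4 = 0"
proof -
  define k where "k = (\<lambda>s. \<alpha> * (Re (c s) / Im (c s)) - \<beta> - Re (T s))"
  have nT: "norm (T s) = 1" for s using Y[of s] by (simp add: T norm_divide)
  have Ts_eq: "Ts s = \<i> * of_real (k s) * T s" for s
  proof -
    have "Im (cnj (T s) * Ts s) = k s" using curv[of s] by (simp add: k_def)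
    then show ?thesis using unit_derivative_parallel[OF Ts[of s] nT] by simp
  qed
  have P: "P s = of_real (Im (c s)) * T s" for s using Y[of s] by (simp add: T)
  have dx: "((\<lambda>s. Re (c s)) has_real_derivative Im (c s) * Re (T s)) (at s)"
    and dy: "((\<lambda>s. Im (c s)) has_real_derivative Im (c s) * Im (T s)) (at s)" for s
    using has_real_derivative_Re[OF c[of s]] has_real_derivative_Im[OF c[of s]] by (simp_all add: P)
  have dR: "((\<lambda>s. Re (T s)) has_real_derivative - k s * Im (T s)) (at s)"
    and dI: "((\<lambda>s. Im (T s)) has_real_derivative k s * Re (T s)) (at s)" for s
    using has_real_derivative_Re[OF Ts[of s]] has_real_derivative_Im[OF Ts[of s]] by (simp_all add: Ts_eq)
  have dk: "(k has_real_derivative \<alpha> * Re (T s) - \<beta> * Im (T s) - Re (T s) * Im (T s)) (at s)" for s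
  proof -
    have "Im (c s) \<noteq> 0" using Y[of s] by simp
    have "(k has_real_derivative \<alpha> * ((Im (c s) * Re (T s) * Im (c s) - Re (c s) * (Im (c s) * Im (T s))) / (Im (c s) * Im (c s)))
        - 0 - (- k s * Im (T s))) (at s)"
      unfolding k_def[abs_def]
      by (rule DERIV_diff DERIV_cmult DERIV_divide dx dy dR[unfolded k_def] DERIV_const \<open>Im (c s) \<noteq> 0\<close>)+
    moreover have "\<alpha> * ((Im (c s) * Re (T s) * Im (c s) - Re (c s) * (Im (c s) * Im (T s))) / (Im (c s) * Im (c s)))
        - 0 - (- k s * Im (T s)) = \<alpha> * Re (T s) - \<beta> * Im (T s) - Re (T s) * Im (T s)"
      using \<open>Im (c s) \<noteq> 0\<close> by (simp add: k_def divide_simps) (simp add: algebra_simps)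
    ultimately show ?thesis by simp
  qed
  \<comment> \<open>Here k is \<sigma>'; multiplying k' by 2 k and integrating in \<sigma> gives
    this first integral.\<close>
  define H where "H = (\<lambda>s. (k s)\<^sup>2 + (Im (T s))\<^sup>2 - 2 * \<beta> * Re (T s) - 2 * \<alpha> * Im (T s))"
  have dH: "(H has_real_derivative 0) (at s)" for s
  proof -
    have "(H has_real_derivative
        of_nat 2 * ((\<alpha> * Re (T s) - \<beta> * Im (T s) - Re (T s) * Im (T s)) * k s ^ (2 - Suc 0))
        + of_nat 2 * (k s * Re (T s) * Im (T s) ^ (2 - Suc 0))
        - 2 * \<beta> * (- k s * Im (T s)) - 2 * \<alpha> * (k s * Re (T s))) (at s)"
      unfolding H_def
      by (rule DERIV_diff DERIV_add DERIV_cmult DERIV_power dk dR dI)+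
    moreover have "of_nat 2 * ((\<alpha> * Re (T s) - \<beta> * Im (T s) - Re (T s) * Im (T s)) * k s ^ (2 - Suc 0))
        + of_nat 2 * (k s * Re (T s) * Im (T s) ^ (2 - Suc 0))
        - 2 * \<beta> * (- k s * Im (T s)) - 2 * \<alpha> * (k s * Re (T s)) = 0"
      by (simp add: algebra_simps)
    ultimately show ?thesis by simp
  qed
  have H: "H s = H 0" for s
    by (rule DERIV_isconst_all) (use dH in blast)
  show ?thesis
  \<comment> \<open>The two outer terms, divided by T^2, contribute (cos 2\<sigma>) / 2 = 1/2 -
    sin^2 \<sigma>, which accounts for the 1/2.\<close>
  proof (rule that[of "H 0 - 1/2"])
    fix s
    define x y where "x = Re (T s)" and "y = Im (T s)"
    have xy: "x\<^sup>2 + y\<^sup>2 = 1"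
      using nT[of s] by (simp add: x_def y_def cmod_def)
    have \<mu>: "H 0 - 1/2 = (k s)\<^sup>2 + y\<^sup>2 - 2 * \<beta> * x - 2 * \<alpha> * y - (x\<^sup>2 + y\<^sup>2) / 2"
      using H[of s] xy by (simp add: H_def x_def y_def)
    define X Z A B K M :: complex where "X = of_real x" and "Z = of_real y" and "A = of_real \<alpha>"
      and "B = of_real \<beta>" and "K = of_real (k s)" and "M = of_real (H 0 - 1/2)"
    have T': "T s = X + \<i> * Z" "Ts s = \<i> * K * (X + \<i> * Z)" "Complex \<beta> \<alpha> = B + \<i> * A"
      "cnj (Complex \<beta> \<alpha>) = B - \<i> * A"
      unfolding Ts_eq by (simp_all add: X_def Z_def A_def B_def K_def x_def y_def complex_eq_iff)
    have one: "(X + \<i> * Z) * (X - \<i> * Z) = 1"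
    proof -
      have "(X + \<i> * Z) * (X - \<i> * Z) = of_real (x\<^sup>2 + y\<^sup>2)"
        by (simp add: X_def Z_def algebra_simps power2_eq_square)
      then show ?thesis by (simp add: xy)
    qed
    have M: "M = K\<^sup>2 + Z\<^sup>2 - 2 * B * X - 2 * A * Z - (X\<^sup>2 + Z\<^sup>2) / 2"
      unfolding M_def \<mu> by (simp add: X_def Z_def A_def B_def K_def)
    \<comment> \<open>t' is both the conjugate and the inverse of t. Inserting factors t t' = 1 into
      the low order terms lets t^2 be factored out.\<close>
    define t t' where "t = X + \<i> * Z" and "t' = X - \<i> * Z"
    have "(\<i> * K * t)\<^sup>2 + 1/4 * t ^ 4 + (B - \<i> * A) * t ^ 3 + M * t\<^sup>2 + (B + \<i> * A) * t + 1/4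
       = (\<i> * K * t)\<^sup>2 + 1/4 * t ^ 4 + (B - \<i> * A) * t ^ 3 + M * t\<^sup>2 + (B + \<i> * A) * t * (t * t')
          + 1/4 * (t * t')\<^sup>2"
      using one by (simp add: t_def t'_def)
    also have "\<dots> = t\<^sup>2 * (M - K\<^sup>2 + (t\<^sup>2 + t'\<^sup>2) / 4 + (B - \<i> * A) * t + (B + \<i> * A) * t')"
      by (simp add: power_mult_distrib power2_eq_square power3_eq_cube power4_eq_xxxx algebra_simps)
    also have "M - K\<^sup>2 + (t\<^sup>2 + t'\<^sup>2) / 4 + (B - \<i> * A) * t + (B + \<i> * A) * t' = 0"
      unfolding M t_def t'_def by (simp add: power2_eq_square field_simps)
    finally show "(Ts s)\<^sup>2 + 1/4 * T s ^ 4 + cnj (Complex \<beta> \<alpha>) * T s ^ 3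
      + of_real (H 0 - 1/2) * (T s)\<^sup>2 + Complex \<beta> \<alpha> * T s + 1/4 = 0"
      unfolding T'(4) unfolding T'(1-3) M_def[symmetric] t_def by simp
  qed
qed

section \<open>Holomorphic families of curves\<close>

lemma holomorphic_horizontal_line:
  fixes a :: real
  assumes "(h has_field_derivative D) (at (of_real (s / a) + b))"
  shows "((\<lambda>s. h (of_real (s / a) + b)) has_vector_derivative D / of_real a) (at s within X)"
proof -
  have "((\<lambda>\<zeta>. h (\<zeta> / of_real a + b)) has_field_derivative D * (1 / of_real a)) (at (of_real s))"
    by (rule DERIV_chain2[where g = "\<lambda>\<zeta>. \<zeta> / of_real a + b"])
      (use assms in \<open>auto intro!: derivative_eq_intros simp: divide_inverse\<close>)
  from has_vector_derivative_real_field[OF this, of X] show ?thesis by simp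
qed

lemma holomorphic_vertical_line:
  assumes "(h has_field_derivative D) (at (b + \<i> * of_real x))"
  shows "((\<lambda>x. h (b + \<i> * of_real x)) has_vector_derivative \<i> * D) (at x within X)"
proof -
  have "((\<lambda>\<zeta>. h (b + \<i> * \<zeta>)) has_field_derivative D * \<i>) (at (of_real x))"
    by (rule DERIV_chain2[where g = "\<lambda>\<zeta>. b + \<i> * \<zeta>"])
      (use assms in \<open>auto intro!: derivative_eq_intros\<close>)
  from has_vector_derivative_real_field[OF this, of X] show ?thesis by (simp add: mult.commute)
qed

text \<open>The speed relation is differentiated in w, that is, across the curve. As F is
  holomorphic, the transverse derivative of its speed contains F'' and thereby the curvature along
  the curve.\<close>

lemma deriv_speed_transverse:
  fixes F :: "complex \<Rightarrow> complex" and W :: "real \<Rightarrow> complex" and u w :: real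
  defines "z \<equiv> of_real u + \<i> * of_real w"
  assumes F: "(F has_field_derivative F') (at z)" "(deriv F has_field_derivative F'') (at z)"
    and W: "(W has_vector_derivative W') (at w)"
    and speed: "\<forall>\<^sub>F x in nhds w. 2 * Re (F (of_real u + \<i> * of_real x) * cnj (W x))
        = norm (deriv F (of_real u + \<i> * of_real x))"
  shows "norm F' * (2 * Re (\<i> * F' * cnj (W w) + F z * cnj W')) = - Im (cnj F' * F'')"
proof -
  have F': "deriv F z = F'" using F(1) by (rule DERIV_imp_deriv)
  have dF: "((\<lambda>x. F (of_real u + \<i> * of_real x)) has_vector_derivative \<i> * F') (at w)"
    and dF': "((\<lambda>x. deriv F (of_real u + \<i> * of_real x)) has_vector_derivative \<i> * F'') (at w)"
    using F by (simp_all add: z_def holomorphic_vertical_line)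
  define L where "L = (\<lambda>x. 2 * Re (F (of_real u + \<i> * of_real x) * cnj (W x)))"
  define L' where "L' = 2 * Re (F z * cnj W' + \<i> * F' * cnj (W w))"
  have dL: "(L has_real_derivative L') (at w)"
    unfolding L_def L'_def z_def
    by (intro DERIV_cmult has_real_derivative_Re has_vector_derivative_mult dF has_vector_derivative_cnj' W)
  have Lw: "L w = norm F'"
    using eventually_nhds_x_imp_x[OF speed] by (simp add: L_def F' flip: z_def)
  \<comment> \<open>Squaring both sides replaces the norm by a product with the conjugate, which is
    smooth.\<close>
  have "((\<lambda>x. (L x)\<^sup>2) has_real_derivative of_nat 2 * (L' * L w ^ (2 - Suc 0))) (at w)"
    by (rule DERIV_power[OF dL])
  moreover have "((\<lambda>x. (L x)\<^sup>2) has_real_derivative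
      Re (deriv F z * cnj (\<i> * F'') + \<i> * F'' * cnj (deriv F z))) (at w)"
  proof (subst DERIV_cong_ev[OF refl _ refl])
    show "\<forall>\<^sub>F x in nhds w. (L x)\<^sup>2 = Re (deriv F (of_real u + \<i> * of_real x) * cnj (deriv F (of_real u + \<i> * of_real x)))"
      using speed by eventually_elim (simp add: L_def flip: complex_norm_square)
    show "((\<lambda>x. Re (deriv F (of_real u + \<i> * of_real x) * cnj (deriv F (of_real u + \<i> * of_real x))))
        has_real_derivative Re (deriv F z * cnj (\<i> * F'') + \<i> * F'' * cnj (deriv F z))) (at w)"
      unfolding z_def
      by (intro has_real_derivative_Re has_vector_derivative_mult dF' has_vector_derivative_cnj')
  qed
  ultimately have "of_nat 2 * (L' * L w ^ (2 - Suc 0)) = Re (deriv F z * cnj (\<i> * F'') + \<i> * F'' * cnj (deriv F z))"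
    by (rule DERIV_unique)
  then have "L' * norm F' = - Im (cnj F' * F'')"
    by (simp add: Lw F' algebra_simps)
  then show ?thesis by (simp add: L'_def mult.commute add.commute)
qed

text \<open>Up to a rotation, Re (F cnj W) is |W| times the height over the boundary of a half
  plane; the factor in g performs this rotation, and \<open>speed\<close> then states that the
  hyperbolic speed is 2 |W|. A positive real multiplier m makes one period a dilation about 0, so
  end tangents and the values of x/y match.\<close>

lemma holomorphic_family_elastica:
  fixes F :: "complex \<Rightarrow> complex" and W :: "real \<Rightarrow> complex" and w m :: real and W' :: complex
  defines "a \<equiv> 2 * cmod (W w)"
    and "g \<equiv> (\<lambda>u::real. - (of_real (cmod (W w)) / (\<i> * W w)) * F (of_real u + \<i> * of_real w))"
  defines "Q \<equiv> unit_tangent UNIV g" and "\<Lambda> \<equiv> 1 / of_real a * (W' / W w)"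
  assumes S: "open S" "F holomorphic_on S" "\<And>u::real. of_real u + \<i> * of_real w \<in> S"
    and nz: "\<And>u::real. deriv F (of_real u + \<i> * of_real w) \<noteq> 0"
    and W: "(W has_vector_derivative W') (at w)" "W w \<noteq> 0"
    and speed: "\<And>u::real. \<forall>\<^sub>F x in nhds w. 2 * Re (F (of_real u + \<i> * of_real x) * cnj (W x))
        = norm (deriv F (of_real u + \<i> * of_real x))"
    and per: "m > 0" "\<And>u::real. F (of_real (u + 2 * pi) + \<i> * of_real w) = of_real m * F (of_real u + \<i> * of_real w)"
  shows "area_constrained_quasiperiodic_elastica (a * (2 * pi)) (\<lambda>s. g (s / a))"
    and "g differentiable (at u) \<and> 0 < Im (g u) \<and> cmod (vector_derivative g (at u)) / Im (g u) = a"
    and "\<exists>\<mu>::real. \<forall>s. \<exists>Qs.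
               ((\<lambda>s. Q (s / a)) has_vector_derivative Qs) (at s) \<and>
               Qs\<^sup>2 + 1/4 * Q (s / a) ^ 4 + cnj \<Lambda> * Q (s / a) ^ 3
                 + of_real \<mu> * (Q (s / a))\<^sup>2 + \<Lambda> * Q (s / a) + 1/4 = 0"
proof -
  define W0 where "W0 = W w"
  define r where "r = cmod W0"
  have r: "r > 0" using W by (simp add: r_def W0_def)
  have a: "a = 2 * r" "a > 0" using r by (simp_all add: a_def r_def W0_def)
  \<comment> \<open>This is the standardizing factor -|W|/(iW), a number of modulus one.\<close>
  define k where "k = \<i> * of_real r / W0"
  have k: "cmod k = 1" using r by (simp add: k_def norm_divide norm_mult r_def)
  have kW: "W0 = \<i> * of_real r / k" "k \<noteq> 0" using r W by (auto simp: k_def W0_def)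
  have g: "g u = k * F (of_real u + \<i> * of_real w)" for u
    using W by (simp add: g_def k_def r_def W0_def field_simps)
  define Z where "Z = (\<lambda>s. of_real (s / a) + \<i> * of_real w)"
  define c where "c = (\<lambda>s. g (s / a))"
  define P where "P = (\<lambda>s. k * deriv F (Z s) / of_real a)"
  define P2 where "P2 = (\<lambda>s. k * deriv (deriv F) (Z s) / (of_real a)\<^sup>2)"
  have dF: "(F has_field_derivative deriv F z) (at z)"
    "(deriv F has_field_derivative deriv (deriv F) z) (at z)" if "z \<in> S" for z
    using S(1,2) that by (auto intro!: holomorphic_derivI holomorphic_deriv)
  have ZS: "Z s \<in> S" for s unfolding Z_def by (rule S(3))
  have dc: "(c has_vector_derivative P s) (at s within X)" for s X
    unfolding c_def g P_def Z_def
    using has_vector_derivative_mult_right[OF holomorphic_horizontal_line[OF dF(1)[OF ZS[unfolded Z_def]]], of k]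
    by simp
  have dP: "(P has_vector_derivative P2 s) (at s within X)" for s X
    unfolding P_def P2_def Z_def
    using has_vector_derivative_mult_right[OF holomorphic_horizontal_line[OF dF(2)[OF ZS[unfolded Z_def]]], of "k / of_real a"]
    by (simp add: power2_eq_square)
  have normP: "norm (P s) = norm (deriv F (Z s)) / a" for s
    using a k by (simp add: P_def norm_mult norm_divide)
  have Y: "Im (c s) = norm (P s)" for s
  proof -
    have "2 * Re (F (Z s) * cnj W0) = norm (deriv F (Z s))"
      using eventually_nhds_x_imp_x[OF speed[of "s / a"]] by (simp add: Z_def W0_def)
    moreover have "F (Z s) * cnj W0 = - \<i> * of_real r * c s"
    proof -
      have "cnj k * k = 1" using k by (simp add: complex_norm_square[symmetric] mult.commute)
      then have "1 / cnj k = k" using kW by (simp add: field_simps)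
      then have "cnj W0 = - \<i> * of_real r * k" by (subst kW(1)) (simp add: divide_inverse)
      then show ?thesis by (simp add: c_def g Z_def)
    qed
    ultimately have "2 * r * Im (c s) = norm (deriv F (Z s))" by simp
    then show ?thesis using a by (simp add: normP field_simps)
  qed
  have Pnz: "norm (P s) > 0" for s
  proof -
    have "norm (deriv F (Z s)) > 0" using nz[of "s / a"] by (simp add: Z_def)
    then show ?thesis unfolding normP using a(2) by simp
  qed
  have Ypos: "Im (c s) > 0" for s unfolding Y by (rule Pnz)
  define T where "T = (\<lambda>s. P s / of_real (Im (c s)))"
  define Ts where "Ts = (\<lambda>s. P2 s / of_real (Im (c s)) - P s * of_real (Im (P s)) / (of_real (Im (c s)))\<^sup>2)"
  have dT: "(T has_vector_derivative Ts s) (at s)" for s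
    unfolding T_def Ts_def
    by (rule has_vector_derivative_divide_real[OF dP has_real_derivative_Im[OF dc]]) (use Ypos[of s] in simp)
  \<comment> \<open>The hypothesis \<open>curv\<close> of \<open>elastica_criterion\<close> with
    \<alpha> = Im \<Lambda> and \<beta> = Re \<Lambda>.\<close>
  have key: "Im (cnj (T s) * Ts s) + Re (T s) = Im \<Lambda> * (Re (c s) / Im (c s)) - Re \<Lambda>" for s
  proof -
    define y n where "y = Im (c s)" and "n = norm (deriv F (Z s))"
    have y: "y > 0" and ny: "n = a * y" using Ypos[of s] a by (simp_all add: y_def n_def Y normP)
    have PP: "cnj (P s) * P s = of_real (y\<^sup>2)"
      unfolding y_def Y by (metis complex_norm_square mult.commute of_real_power)
    have "cnj (T s) * Ts s = cnj (P s) * P2 s / of_real (y\<^sup>2) - (cnj (P s) * P s) * of_real (Im (P s)) / of_real (y ^ 3)"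
      using y by (simp add: T_def Ts_def y_def[symmetric] field_simps power2_eq_square power3_eq_cube)
    then have "Im (cnj (T s) * Ts s) = Im (cnj (P s) * P2 s) / y\<^sup>2"
      unfolding PP by (simp flip: of_real_mult of_real_divide of_real_power)
    moreover have "cnj (P s) * P2 s = cnj (deriv F (Z s)) * deriv (deriv F) (Z s) / of_real (a ^ 3)"
    proof -
      have "cnj (P s) * P2 s = (cnj k * k) * (cnj (deriv F (Z s)) * deriv (deriv F) (Z s)) / of_real (a ^ 3)"
        by (simp add: P_def P2_def power2_eq_square power3_eq_cube mult_ac)
      moreover have "cnj k * k = 1" using k by (simp add: complex_norm_square[symmetric] mult.commute)
      ultimately show ?thesis by simp
    qed
    ultimately have ang: "Im (cnj (T s) * Ts s) = Im (cnj (deriv F (Z s)) * deriv (deriv F) (Z s)) / (a ^ 3 * y\<^sup>2)"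
      by simp
    have E: "n * (2 * Re (\<i> * deriv F (Z s) * cnj W0 + F (Z s) * cnj W'))
        = - Im (cnj (deriv F (Z s)) * deriv (deriv F) (Z s))"
      unfolding n_def W0_def Z_def
      by (rule deriv_speed_transverse[OF dF(1)[OF S(3)] dF(2)[OF S(3)] W(1) speed])
    have kc: "cnj k * k = 1" using k by (simp add: complex_norm_square[symmetric] mult.commute)
    have Wk: "W0 = \<i> * of_real r * cnj k"
    proof -
      have "inverse k = cnj k" by (rule inverse_unique) (subst mult.commute, rule kc)
      then show ?thesis using kW(1) by (simp add: divide_inverse)
    qed
    have i2: "\<i> * \<i> = -1" by simp
    have cW0: "cnj W0 = - \<i> * of_real r * k" by (simp add: Wk)
    have kP: "k * deriv F (Z s) = of_real a * P s" using a(2) by (simp add: P_def)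
    have "\<i> * deriv F (Z s) * cnj W0 = of_real r * (k * deriv F (Z s))"
      unfolding cW0 using i2 by algebra
    then have 1: "\<i> * deriv F (Z s) * cnj W0 = of_real (a * r) * P s"
      unfolding kP by simp
    have kF: "k * F (Z s) = c s" by (simp add: c_def g Z_def)
    \<comment> \<open>Solving the definition of \<Lambda> for W' turns the transverse derivative
      into an expression in c, its velocity and \<Lambda>.\<close>
    have W': "W' = of_real a * \<Lambda> * W0" using a(2) W(2) by (simp add: \<Lambda>_def W0_def)
    have "F (Z s) * cnj W' = - \<i> * of_real a * of_real r * cnj \<Lambda> * (k * F (Z s))"
      unfolding W' complex_cnj_mult cW0 complex_cnj_complex_of_real by (simp only: mult_ac)
    then have 2: "F (Z s) * cnj W' = - \<i> * of_real (a * r) * (c s * cnj \<Lambda>)"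
      unfolding kF by simp
    have 7: "Re (\<i> * deriv F (Z s) * cnj W0 + F (Z s) * cnj W') = a * r * (Re (P s) + Im (c s * cnj \<Lambda>))"
      unfolding 1 2 by (simp add: algebra_simps)
    have 6: "Im (cnj (deriv F (Z s)) * deriv (deriv F) (Z s)) = - (a ^ 3 * y * (Re (P s) + Im (c s * cnj \<Lambda>)))"
    proof -
      have "n * (2 * (a * r * X)) = a ^ 3 * y * X" for X
        unfolding ny by (simp add: a(1) power3_eq_cube)
      then show ?thesis using E[unfolded 7] by (metis minus_equation_iff)
    qed
    have "- (a ^ 3 * y * X) / (a ^ 3 * y\<^sup>2) = - X / y" for X
      using a(2) y by (simp add: power2_eq_square)
    then have 3: "Im (cnj (T s) * Ts s) = - (Re (P s) + Im (c s * cnj \<Lambda>)) / y"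
      unfolding ang 6 .
    have 4: "Re (T s) = Re (P s) / y" by (simp add: T_def y_def)
    have 5: "Im (c s * cnj \<Lambda>) = y * Re \<Lambda> - Re (c s) * Im \<Lambda>" by (simp add: y_def)
    show ?thesis unfolding 3 4 5 using y by (simp add: y_def[symmetric] field_simps)
  qed
  have dg: "(g has_vector_derivative of_real a * P (a * u)) (at u)" for u
  proof -
    have "((\<lambda>u. c (a * u)) has_vector_derivative a *\<^sub>R P (a * u)) (at u)"
      using vector_diff_chain_at[of "\<lambda>u. a * u" a u c "P (a * u)"] dc[of "a * u" UNIV]
        DERIV_cmult_Id[of a u UNIV]
      by (simp add: o_def has_real_derivative_iff_has_vector_derivative)
    moreover have "(\<lambda>u. c (a * u)) = g" using a(2) by (simp add: c_def)
    ultimately show ?thesis by (simp add: scaleR_conv_of_real)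
  qed
  have cg: "g u = c (a * u)" for u using a(2) by (simp add: c_def)
  show "g differentiable (at u) \<and> 0 < Im (g u) \<and> cmod (vector_derivative g (at u)) / Im (g u) = a"
    using dg[of u] Ypos[of "a * u"] a(2)
    by (auto simp: vector_derivative_at[OF dg] differentiableI_vector cg Y norm_mult)
  have QT: "Q (s / a) = T s" for s
  proof -
    have "Q (s / a) = sgn (of_real a * P s)"
      using a(2) by (simp add: Q_def unit_tangent_def vector_derivative_at[OF dg])
    also have "\<dots> = sgn (P s)" using a(2) by (simp add: sgn_mult sgn_of_real)
    finally show ?thesis by (simp add: T_def Y sgn_eq)
  qed
  obtain \<mu> :: real where \<mu>: "\<And>s. (Ts s)\<^sup>2 + 1/4 * T s ^ 4 + cnj (Complex (Re \<Lambda>) (Im \<Lambda>)) * T s ^ 3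
      + of_real \<mu> * (T s)\<^sup>2 + Complex (Re \<Lambda>) (Im \<Lambda>) * T s + 1/4 = 0"
    by (rule tangent_quartic_ode[OF dc _ _ dT key]) (use Ypos in \<open>auto simp: Y T_def\<close>)
  show "\<exists>\<mu>::real. \<forall>s. \<exists>Qs. ((\<lambda>s. Q (s / a)) has_vector_derivative Qs) (at s) \<and>
               Qs\<^sup>2 + 1/4 * Q (s / a) ^ 4 + cnj \<Lambda> * Q (s / a) ^ 3
                 + of_real \<mu> * (Q (s / a))\<^sup>2 + \<Lambda> * Q (s / a) + 1/4 = 0"
    unfolding QT using dT \<mu> unfolding complex_surj by blast
  define L where "L = a * (2 * pi)"
  have L: "L > 0" using a(2) by (simp add: L_def)
  have cT: "unit_tangent {0..L} c s = T s" "angle_deriv L c s = Im (cnj (T s) * Ts s)" if "s \<in> {0..L}" for s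
    using curve_tangent_angle(1,3)[OF L dc dP _ that] Ypos Y unfolding T_def Ts_def by simp_all
  have cper: "c L = of_real m * c 0"
    using per(2)[of 0] a(2) by (simp add: c_def g L_def)
  have gper: "g (u + 2 * pi) = of_real m * g u" for u
    using per(2)[of u] by (simp add: g)
  have Pper: "P L = of_real m * P 0"
  proof -
    have "((\<lambda>u. u + 2 * pi) has_vector_derivative 1) (at 0)"
      by (auto intro!: derivative_eq_intros simp flip: has_real_derivative_iff_has_vector_derivative)
    then have "((\<lambda>u. g (u + 2 * pi)) has_vector_derivative of_real a * P (a * (0 + 2 * pi))) (at 0)"
      using vector_diff_chain_at[of "\<lambda>u. u + 2 * pi" 1 0 g] dg[of "0 + 2 * pi"]
      by (simp add: o_def)
    moreover have "((\<lambda>u. g (u + 2 * pi)) has_vector_derivative of_real m * (of_real a * P (a * 0))) (at 0)"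
      unfolding gper by (intro has_vector_derivative_mult_right dg)
    ultimately have "of_real a * P (a * (0 + 2 * pi)) = of_real m * (of_real a * P (a * 0))"
      by (rule vector_derivative_unique_at)
    then show ?thesis using a(2) by (simp add: L_def)
  qed
  have "area_constrained_quasiperiodic_elastica L c"
  proof (rule elastica_criterion)
    show "hyp_curvature L c s = Im \<Lambda> * (Re (c s) / Im (c s)) - Re \<Lambda>" if "s \<in> {0..L}" for s
      unfolding hyp_curvature_def cT[OF that] by (rule key)
    show "Re (c L) / Im (c L) = Re (c 0) / Im (c 0)"
      using per(1) by (simp add: cper)
    show "equal_end_tangents L c"
      unfolding equal_end_tangents_def using cT(1)[of 0] cT(1)[of L] L per(1)
      by (simp add: T_def cper Pper)
    \<comment> \<open>The curve with complex parameter. Its higher complex derivatives, restricted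
      to the reals, are the witnesses for \<open>smooth_curve\<close>.\<close>
    define h where "h = (\<lambda>\<zeta>. k * F (\<zeta> / of_real a + \<i> * of_real w))"
    define S' where "S' = (\<lambda>\<zeta>. \<zeta> / of_real a + \<i> * of_real w) -` S"
    have S': "open S'"
      unfolding S'_def using S(1) a(2) by (intro open_vimage continuous_intros) auto
    have sS': "of_real s \<in> S'" for s using S(3)[of "s / a"] by (simp add: S'_def)
    have h: "h holomorphic_on S'"
      unfolding h_def
      by (intro holomorphic_intros holomorphic_on_compose_gen[OF _ S(2), unfolded o_def]) (use a(2) in \<open>auto simp: S'_def\<close>)
    have "smooth_curve L c"
      unfolding smooth_curve_def
    proof (intro exI[of _ "\<lambda>n s. (deriv ^^ n) h (of_real s)"] conjI allI ballI)
      show "(\<lambda>s. (deriv ^^ 0) h (of_real s)) = c" by (simp add: h_def c_def g fun_eq_iff)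
      fix n s
      have "((deriv ^^ n) h has_field_derivative (deriv ^^ Suc n) h (of_real s)) (at (of_real s))"
        using holomorphic_derivI[OF holomorphic_higher_deriv[OF h S'] S' sS'] by simp
      then show "((\<lambda>s. (deriv ^^ n) h (of_real s)) has_vector_derivative (deriv ^^ Suc n) h (of_real s)) (at s within {0..L})"
        by (rule has_vector_derivative_real_field)
    qed
    then show "arclength_curve L c"
      unfolding arclength_curve_def
      using L Ypos Y vector_derivative_within_closed_interval[OF L _ dc] Pnz by (auto simp: less_imp_neq[symmetric])
  qed
  then show "area_constrained_quasiperiodic_elastica (a * (2 * pi)) (\<lambda>s. g (s / a))"
    by (simp add: L_def c_def)
qed

section \<open>The family of curves given by theta functions\<close>

text \<open>What the rectangular and the rhombic case share. The constant \<epsilon> is the phase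
  lost under conjugation: 1 in the first case and exp (- i pi / 4) in the second. It is the same for
  both functions. Here \<kappa>, l and \<delta> express \<open>ths\<close> as a shifted
  \<open>th1\<close>; \<kappa> is not a curvature.\<close>

locale theta_pair =
  fixes th1 ths :: "complex \<Rightarrow> complex" and \<omega> :: real and \<kappa> l \<delta> \<epsilon> :: complex
  assumes hol1: "th1 holomorphic_on UNIV" and hols: "ths holomorphic_on UNIV"
    and weierstrass: "\<And>a b c d.
      th1 (a + b) * th1 (a - b) * (th1 (c + d) * th1 (c - d))
       - th1 (a + c) * th1 (a - c) * (th1 (b + d) * th1 (b - d))
       + th1 (a + d) * th1 (a - d) * (th1 (b + c) * th1 (b - c)) = 0"
    and odd1: "\<And>z. th1 (- z) = - th1 z" and evens: "\<And>z. ths (- z) = ths z"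
    and shift: "\<And>z. ths z = \<kappa> * exp (l * z) * th1 (z + \<delta>)"
    and cnj1: "\<And>z. cnj (th1 z) = \<epsilon> * th1 (cnj z)" and cnjs: "\<And>z. cnj (ths z) = \<epsilon> * ths (cnj z)"
    and \<epsilon>: "\<epsilon> \<noteq> 0"
    and nz1: "th1 (2 * of_real \<omega>) \<noteq> 0" and nzs: "ths (of_real \<omega>) \<noteq> 0"
begin

text \<open>In each of the three products of two values of \<open>ths\<close>, evenness allows signs
  with which the arguments add up to v - v'. Hence \<open>shift\<close> attaches the same factor to
  all of them, and what remains is Weierstrass' identity for \<open>th1\<close>.\<close>

lemma three_term:
  fixes v v' :: complex
  shows "(th1 (v - \<omega>) * th1 (v' + \<omega>) * ths (\<omega> + v - v') - th1 (v' - \<omega>) * th1 (v + \<omega>) * ths (\<omega> - v + v')) * ths \<omega>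
   = th1 (v - v') * th1 (2 * \<omega>) * ths v * ths v'"
proof -
  define E where "E = \<kappa>\<^sup>2 * exp (l * (v - v'))"
  have e: "\<kappa> * exp (l * a) * (\<kappa> * exp (l * b)) = E" if "a + b = v - v'" for a b
    unfolding E_def that[symmetric] by (simp add: power2_eq_square distrib_left exp_add mult_ac)
  have p: "ths a * ths b = E * (th1 (a + \<delta>) * th1 (b + \<delta>))" if "a + b = v - v'" for a b
    unfolding shift[of a] shift[of b] e[OF that, symmetric] by (simp only: mult_ac)
  have 1: "ths (\<omega> + v - v') * ths \<omega> = E * (th1 (\<omega> + v - v' + \<delta>) * th1 (\<delta> - \<omega>))"
    using p[of "\<omega> + v - v'" "- \<omega>"] by (simp add: evens)
  have "ths (\<omega> - v + v') = ths (v - v' - \<omega>)"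
    using evens[of "v - v' - \<omega>"] by (simp add: algebra_simps)
  then have 2: "ths (\<omega> - v + v') * ths \<omega> = E * (th1 (v - v' - \<omega> + \<delta>) * th1 (\<omega> + \<delta>))"
    using p[of "v - v' - \<omega>" "\<omega>"] by simp
  have 3: "ths v * ths v' = E * (th1 (v + \<delta>) * th1 (\<delta> - v'))"
    using p[of v "- v'"] by (simp add: evens)
  \<comment> \<open>Solved from the arguments: the twelve sums and differences in \<open>s\<close>
    must be the arguments of \<open>th1\<close> that occur.\<close>
  define a b c d where "a = \<delta> + (v - v') / 2" and "b = \<omega> + (v - v') / 2"
    and "c = (v + v') / 2" and "d = (v' - v) / 2 + \<omega>"
  have s: "a + b = \<omega> + v - v' + \<delta>" "a - b = \<delta> - \<omega>" "c + d = v' + \<omega>" "c - d = v - \<omega>"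
    "a + c = v + \<delta>" "a - c = \<delta> - v'" "b + d = 2 * \<omega>" "b - d = v - v'"
    "a + d = \<omega> + \<delta>" "a - d = v - v' - \<omega> + \<delta>" "b + c = v + \<omega>" "b - c = - (v' - \<omega>)"
    by (simp_all add: a_def b_def c_def d_def field_simps)
  have "th1 (\<omega> + v - v' + \<delta>) * th1 (\<delta> - \<omega>) * (th1 (v' + \<omega>) * th1 (v - \<omega>))
     - th1 (v + \<delta>) * th1 (\<delta> - v') * (th1 (2 * \<omega>) * th1 (v - v'))
     + th1 (\<omega> + \<delta>) * th1 (v - v' - \<omega> + \<delta>) * (th1 (v + \<omega>) * - th1 (v' - \<omega>)) = 0"
    using weierstrass[of a b c d] unfolding s odd1[of "v' - \<omega>"] .
  then have "E * (th1 (\<omega> + v - v' + \<delta>) * th1 (\<delta> - \<omega>)) * (th1 (v' + \<omega>) * th1 (v - \<omega>))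
     - E * (th1 (v - v' - \<omega> + \<delta>) * th1 (\<omega> + \<delta>)) * (th1 (v + \<omega>) * th1 (v' - \<omega>))
     = E * (th1 (v + \<delta>) * th1 (\<delta> - v')) * (th1 (2 * \<omega>) * th1 (v - v'))"
    by algebra
  then have "ths (\<omega> + v - v') * ths \<omega> * (th1 (v' + \<omega>) * th1 (v - \<omega>))
     - ths (\<omega> - v + v') * ths \<omega> * (th1 (v + \<omega>) * th1 (v' - \<omega>))
     = ths v * ths v' * (th1 (2 * \<omega>) * th1 (v - v'))"
    unfolding 1 2 3 by (simp only: mult_ac)
  then show ?thesis by (simp add: algebra_simps)
qed

definition c :: complex where "c = deriv ths \<omega> / ths \<omega>"

lemma der1: "(th1 has_field_derivative deriv th1 z) (at z)"
  and ders: "(ths has_field_derivative deriv ths z) (at z)"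
  using hol1 hols by (auto intro!: holomorphic_derivI)

lemma der1_chain:
  "(g has_field_derivative D) (at z) \<Longrightarrow> ((\<lambda>z. th1 (g z)) has_field_derivative deriv th1 (g z) * D) (at z)"
  by (rule DERIV_chain2[OF der1])

text \<open>Both sides of \<open>three_term\<close> vanish for v = v'; this compares their first
  derivatives there. The logarithmic derivative c enters through the factors
  \<open>ths (\<omega> + x - v)\<close> and \<open>ths (\<omega> - x + v)\<close>.\<close>

lemma three_term_deriv:
  fixes v :: complex
  shows "(deriv th1 (v - \<omega>) * th1 (v + \<omega>) - th1 (v - \<omega>) * deriv th1 (v + \<omega>)
     + 2 * c * th1 (v - \<omega>) * th1 (v + \<omega>)) * (ths \<omega>)\<^sup>2
   = deriv th1 0 * th1 (2 * \<omega>) * (ths v)\<^sup>2"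
proof -
  note D1 = DERIV_chain2[OF der1] and Ds = DERIV_chain2[OF ders]
  have "((\<lambda>x. (th1 (x - \<omega>) * th1 (v + \<omega>) * ths (\<omega> + x - v) - th1 (v - \<omega>) * th1 (x + \<omega>) * ths (\<omega> - x + v)) * ths \<omega>)
     has_field_derivative (deriv th1 (v - \<omega>) * th1 (v + \<omega>) * ths \<omega> + th1 (v - \<omega>) * th1 (v + \<omega>) * deriv ths \<omega>
       - (th1 (v - \<omega>) * deriv th1 (v + \<omega>) * ths \<omega> - th1 (v - \<omega>) * th1 (v + \<omega>) * deriv ths \<omega>)) * ths \<omega>) (at v)"
    by (auto intro!: derivative_eq_intros D1 Ds)
  moreover have "((\<lambda>x. th1 (x - v) * th1 (2 * \<omega>) * ths x * ths v) has_field_derivative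
      (deriv th1 0 * th1 (2 * \<omega>) * ths v + th1 0 * th1 (2 * \<omega>) * deriv ths v) * ths v) (at v)"
    by (auto intro!: derivative_eq_intros D1 Ds)
  moreover have "th1 0 = 0" using odd1[of 0] by simp
  ultimately have "(deriv th1 (v - \<omega>) * th1 (v + \<omega>) * ths \<omega> + th1 (v - \<omega>) * th1 (v + \<omega>) * deriv ths \<omega>
       - (th1 (v - \<omega>) * deriv th1 (v + \<omega>) * ths \<omega> - th1 (v - \<omega>) * th1 (v + \<omega>) * deriv ths \<omega>)) * ths \<omega>
     = deriv th1 0 * th1 (2 * \<omega>) * ths v * ths v"
    unfolding three_term using DERIV_unique by fastforce
  moreover have "deriv ths \<omega> = c * ths \<omega>" using nzs by (simp add: c_def)
  ultimately show ?thesis by (simp add: power2_eq_square algebra_simps)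
qed

text \<open>Otherwise \<open>three_term_deriv\<close> would make th1 (v - \<omega>) / th1 (v +
  \<omega>) exp (2 c v) locally constant around \<omega>. Its value at \<omega> is 0, so
  \<open>th1\<close> would vanish near 0 and then everywhere, contrary to
  \<open>nz1\<close>.\<close>

lemma deriv1_nz: "deriv th1 0 \<noteq> 0"
proof
  assume "deriv th1 0 = 0"
  then have wr: "deriv th1 (v - \<omega>) * th1 (v + \<omega>) - th1 (v - \<omega>) * deriv th1 (v + \<omega>)
     + 2 * c * th1 (v - \<omega>) * th1 (v + \<omega>) = 0" for v :: complex
    using three_term_deriv[of v] nzs by simp
  have "continuous_on UNIV (\<lambda>v::complex. th1 (v + \<omega>))"
    by (intro continuous_on_compose2[OF holomorphic_on_imp_continuous_on[OF hol1]] continuous_intros) auto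
  then have "open {v::complex. th1 (v + \<omega>) \<noteq> 0}"
    using open_Collect_neq[OF _ continuous_on_const[of UNIV 0]] by blast
  moreover have "of_real \<omega> \<in> {v::complex. th1 (v + \<omega>) \<noteq> 0}" using nz1[unfolded mult_2] by (rule CollectI)
  ultimately obtain r where r: "r > 0" "ball (of_real \<omega>) r \<subseteq> {v::complex. th1 (v + \<omega>) \<noteq> 0}"
    by (meson openE)
  define G where "G = (\<lambda>v::complex. th1 (v - \<omega>) / th1 (v + \<omega>) * exp (2 * c * v))"
  have dG: "(G has_field_derivative 0) (at v)" if "v \<in> ball (of_real \<omega>) r" for v
  proof -
    have nz: "th1 (v + \<omega>) \<noteq> 0" using that r by auto
    have "(G has_field_derivative
        (deriv th1 (v - \<omega>) * th1 (v + \<omega>) - th1 (v - \<omega>) * deriv th1 (v + \<omega>)) / (th1 (v + \<omega>) * th1 (v + \<omega>)) * exp (2 * c * v)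
        + th1 (v - \<omega>) / th1 (v + \<omega>) * (exp (2 * c * v) * (2 * c))) (at v)"
    proof -
      have 1: "((\<lambda>v. th1 (v - \<omega>)) has_field_derivative deriv th1 (v - \<omega>) * 1) (at v)"
        and 2: "((\<lambda>v. th1 (v + \<omega>)) has_field_derivative deriv th1 (v + \<omega>) * 1) (at v)"
        by (rule der1_chain; force intro!: derivative_eq_intros)+
      have 3: "((\<lambda>v. exp (2 * c * v)) has_field_derivative exp (2 * c * v) * (2 * c)) (at v)"
        by (auto intro!: derivative_eq_intros)
      show ?thesis
        unfolding G_def by (rule DERIV_cong[OF DERIV_mult[OF DERIV_divide[OF 1 2 nz] 3]]) (simp add: mult.commute)
    qed
    moreover have "(deriv th1 (v - \<omega>) * th1 (v + \<omega>) - th1 (v - \<omega>) * deriv th1 (v + \<omega>)) / (th1 (v + \<omega>) * th1 (v + \<omega>)) * exp (2 * c * v)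
        + th1 (v - \<omega>) / th1 (v + \<omega>) * (exp (2 * c * v) * (2 * c))
      = (deriv th1 (v - \<omega>) * th1 (v + \<omega>) - th1 (v - \<omega>) * deriv th1 (v + \<omega>)
     + 2 * c * th1 (v - \<omega>) * th1 (v + \<omega>)) * exp (2 * c * v) / (th1 (v + \<omega>) * th1 (v + \<omega>))"
      using nz by (simp add: divide_simps) (simp add: algebra_simps)
    ultimately show ?thesis by (simp add: wr)
  qed
  have th0: "th1 0 = 0" using odd1[of 0] by simp
  have G0: "G v = 0" if v: "v \<in> ball (of_real \<omega>) r" for v
  proof -
    obtain k where k: "\<And>x. x \<in> ball (of_real \<omega>) r \<Longrightarrow> G x = k"
      using has_field_derivative_zero_constant[of "ball (of_real \<omega>) r" G] dG
      by (metis convex_ball has_field_derivative_at_within)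
    have "G (of_real \<omega>) = 0" by (simp add: G_def th0)
    then show ?thesis using k[OF v] k[of "of_real \<omega>"] r(1) by simp
  qed
  have "th1 z = 0" if "z \<in> ball 0 r" for z
  proof -
    have m: "z + \<omega> \<in> ball (of_real \<omega>) r" using that by (simp add: dist_norm norm_minus_commute)
    then have "th1 (z + \<omega> + \<omega>) \<noteq> 0" using r(2) by blast
    then show ?thesis using G0[OF m] by (simp add: G_def)
  qed
  then have "th1 (2 * of_real \<omega>) = 0"
    using analytic_continuation_open[of "ball 0 r" UNIV th1 "\<lambda>_. 0"] hol1 r(1) by auto
  then show False using nz1 by simp
qed

text \<open>The conjugation symmetry passes to derivatives at real points with the same \<epsilon>,
  which cancels in the quotient c.\<close>

lemma c_real: "cnj c = c" and deriv1_cnj: "cnj (deriv th1 0) = \<epsilon> * deriv th1 0"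
proof -
  have *: "cnj (deriv f (of_real x)) = \<epsilon> * deriv f (of_real x)"
    if f: "\<And>z. (f has_field_derivative deriv f z) (at z)" and cn: "\<And>z. cnj (f z) = \<epsilon> * f (cnj z)"
    for f :: "complex \<Rightarrow> complex" and x :: real
  proof -
    have "((cnj \<circ> f \<circ> cnj) has_field_derivative cnj (deriv f (of_real x))) (at (of_real x))"
      using has_field_derivative_cnj_cnj[of f _ "of_real x"] f[of "of_real x"] by simp
    moreover have "(cnj \<circ> f \<circ> cnj) = (\<lambda>z. \<epsilon> * f z)" by (simp add: fun_eq_iff cn)
    moreover have "((\<lambda>z. \<epsilon> * f z) has_field_derivative \<epsilon> * deriv f (of_real x)) (at (of_real x))"
      by (intro DERIV_cmult f)
    ultimately show ?thesis using DERIV_unique by metis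
  qed
  show "cnj (deriv th1 0) = \<epsilon> * deriv th1 0" using *[OF der1 cnj1, of 0] by simp
  show "cnj c = c" using *[OF ders cnjs, of \<omega>] cnjs[of \<omega>] \<epsilon> by (simp add: c_def)
qed

section \<open>The complexified curve and its hyperbolic speed\<close>

definition f :: "complex \<Rightarrow> complex" where "f z = - \<i> * (2 * (ths \<omega>)\<^sup>2 / (deriv th1 0 * th1 (2 * \<omega>)))
   * (th1 ((z - 3 * \<omega>) / 2) / th1 ((z + \<omega>) / 2)) * exp (z * c)"

definition f' :: "complex \<Rightarrow> complex" where "f' z = - \<i> * ((ths ((z - \<omega>) / 2))\<^sup>2 / (th1 ((z + \<omega>) / 2))\<^sup>2) * exp (z * c)"

text \<open>\<open>W1\<close> with a complex argument in place of the real w, so that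
  differentiability follows from holomorphy.\<close>

definition W :: "complex \<Rightarrow> complex" where "W z = \<i> * (deriv th1 0 / (2 * ths \<omega>)) * (ths (\<omega> - \<i> * z) / th1 (\<i> * z)) * exp (\<i> * z * c)"

text \<open>With v = (z - \<omega>) / 2, the quotient rule and the exponential factor together
  produce the left side of \<open>three_term_deriv\<close>. The exponent c is what makes the
  numerator a perfect square.\<close>

lemma f_deriv:
  fixes z :: complex
  assumes nz: "th1 ((z + \<omega>) / 2) \<noteq> 0"
  shows "(f has_field_derivative f' z) (at z)"
proof -
  define v where "v = (z - \<omega>) / 2"
  have v: "(z - 3 * \<omega>) / 2 = v - \<omega>" "(z + \<omega>) / 2 = v + \<omega>" by (simp_all add: v_def field_simps)
  define C where "C = - \<i> * (2 * (ths \<omega>)\<^sup>2 / (deriv th1 0 * th1 (2 * \<omega>)))"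
  have nz': "th1 (v + \<omega>) \<noteq> 0" using nz v by simp
  have "(f has_field_derivative
      C * ((deriv th1 ((z - 3 * \<omega>) / 2) * (1/2) * th1 ((z + \<omega>) / 2) - th1 ((z - 3 * \<omega>) / 2) * (deriv th1 ((z + \<omega>) / 2) * (1/2)))
         / (th1 ((z + \<omega>) / 2) * th1 ((z + \<omega>) / 2))) * exp (z * c)
      + C * (th1 ((z - 3 * \<omega>) / 2) / th1 ((z + \<omega>) / 2)) * (exp (z * c) * c)) (at z)"
  proof -
    have 1: "((\<lambda>z. th1 ((z - 3 * \<omega>) / 2)) has_field_derivative deriv th1 ((z - 3 * \<omega>) / 2) * (1/2)) (at z)"
      and 2: "((\<lambda>z. th1 ((z + \<omega>) / 2)) has_field_derivative deriv th1 ((z + \<omega>) / 2) * (1/2)) (at z)"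
      by (rule der1_chain; force intro!: derivative_eq_intros)+
    have 3: "((\<lambda>z. exp (z * c)) has_field_derivative exp (z * c) * c) (at z)"
      by (auto intro!: derivative_eq_intros)
    show ?thesis
      unfolding f_def[abs_def] C_def[symmetric]
      by (rule DERIV_cong[OF DERIV_mult[OF DERIV_cmult[OF DERIV_divide[OF 1 2 nz]] 3]]) (simp add: mult.commute)
  qed
  also have "C * ((deriv th1 ((z - 3 * \<omega>) / 2) * (1/2) * th1 ((z + \<omega>) / 2) - th1 ((z - 3 * \<omega>) / 2) * (deriv th1 ((z + \<omega>) / 2) * (1/2)))
         / (th1 ((z + \<omega>) / 2) * th1 ((z + \<omega>) / 2))) * exp (z * c)
      + C * (th1 ((z - 3 * \<omega>) / 2) / th1 ((z + \<omega>) / 2)) * (exp (z * c) * c)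
     = C / 2 * exp (z * c) / (th1 (v + \<omega>))\<^sup>2 *
        (deriv th1 (v - \<omega>) * th1 (v + \<omega>) - th1 (v - \<omega>) * deriv th1 (v + \<omega>) + 2 * c * th1 (v - \<omega>) * th1 (v + \<omega>))"
    unfolding v using nz' by (simp add: divide_simps power2_eq_square) (simp add: algebra_simps)
  also have "deriv th1 (v - \<omega>) * th1 (v + \<omega>) - th1 (v - \<omega>) * deriv th1 (v + \<omega>) + 2 * c * th1 (v - \<omega>) * th1 (v + \<omega>)
      = deriv th1 0 * th1 (2 * \<omega>) * (ths v)\<^sup>2 / (ths \<omega>)\<^sup>2"
    using three_term_deriv[of v] nzs by (simp add: field_simps)
  also have "C / 2 * exp (z * c) / (th1 (v + \<omega>))\<^sup>2 * (deriv th1 0 * th1 (2 * \<omega>) * (ths v)\<^sup>2 / (ths \<omega>)\<^sup>2) = f' z"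
    unfolding f'_def v C_def using nz1 nzs deriv1_nz
    by (simp add: v_def[symmetric] divide_simps)
  finally show ?thesis .
qed

text \<open>This is \<open>three_term\<close> at v = (z - \<omega>) / 2 and its conjugate. Their
  difference i w does not depend on u, which is why a factor W depending on w alone
  suffices.\<close>

lemma speed:
  fixes u w :: real
  defines "z \<equiv> of_real u + \<i> * of_real w"
  assumes nz: "th1 ((z + \<omega>) / 2) \<noteq> 0" and nzw: "th1 (\<i> * w) \<noteq> 0"
  shows "2 * Re (f z * cnj (W w)) = norm (f' z)"
proof -
  define v v' where "v = (z - \<omega>) / 2" and "v' = (cnj z - \<omega>) / 2"
  have v: "(z - 3 * \<omega>) / 2 = v - \<omega>" "(z + \<omega>) / 2 = v + \<omega>" by (simp_all add: v_def field_simps)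
  have cv: "cnj v = v'" by (simp add: v_def v'_def)
  have vv: "v - v' = \<i> * w" by (simp add: v_def v'_def z_def field_simps)
  define N where "N = 2 * (ths \<omega>)\<^sup>2 / (deriv th1 0 * th1 (2 * \<omega>))"
  define K where "K = deriv th1 0 / (2 * ths \<omega>)"
  define h where "h = \<i> * of_real w"
  have ch: "cnj h = - h" by (simp add: h_def)
  \<comment> \<open>The prefactors of f and W are matched so that all constants on the right of
    \<open>three_term\<close> cancel.\<close>
  have NK: "N * K * th1 (2 * \<omega>) = ths \<omega>"
    using nz1 nzs deriv1_nz by (simp add: N_def K_def field_simps power2_eq_square)
  have cN: "cnj N = N"
    unfolding N_def by (simp add: deriv1_cnj cnj1 cnjs \<epsilon> power2_eq_square)
  have cK: "cnj K = K" unfolding K_def using \<epsilon> by (simp add: deriv1_cnj cnjs)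
  have nzh: "th1 h \<noteq> 0" using nzw by (simp add: h_def)
  have nzv: "th1 (v + \<omega>) \<noteq> 0" using nz v by simp
  have nzv': "th1 (v' + \<omega>) \<noteq> 0"
    using nzv cnj1[of "v + \<omega>"] \<epsilon> by (auto simp: cv)
  have fz: "f z = - \<i> * N * (th1 (v - \<omega>) / th1 (v + \<omega>)) * exp (z * c)"
    unfolding f_def v N_def by simp
  have Ww: "W w = \<i> * K * (ths (\<omega> - h) / th1 h) * exp (h * c)"
    by (simp add: W_def K_def h_def)
  \<comment> \<open>The sign from conjugating i and the sign from \<open>th1\<close> being odd
    cancel; the phase \<epsilon> cancels in the quotient.\<close>
  have cW: "cnj (W w) = \<i> * K * (ths (\<omega> + h) / th1 h) * exp (- h * c)"
    unfolding Ww using \<epsilon> nzh by (simp add: cK cnj1 cnjs ch odd1 c_real exp_cnj)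
  have fc: "cnj (f z) = \<i> * N * (th1 (v' - \<omega>) / th1 (v' + \<omega>)) * exp (cnj z * c)"
    unfolding fz using \<epsilon> by (simp add: cN cnj1 cv c_real exp_cnj)
  \<comment> \<open>The parts depending on w cancel, leaving an exponential that is real because c
    is.\<close>
  have e: "exp (z * c) * exp (- h * c) = exp (u * c)" "exp (cnj z * c) * exp (h * c) = exp (u * c)"
    unfolding exp_add[symmetric] by (simp_all add: z_def h_def algebra_simps)
  have A: "f z * cnj (W w) = N * K * exp (u * c) / th1 h * (th1 (v - \<omega>) * ths (\<omega> + h) / th1 (v + \<omega>))"
  proof -
    have "f z * cnj (W w) = N * K / th1 h * (th1 (v - \<omega>) * ths (\<omega> + h) / th1 (v + \<omega>)) * (exp (z * c) * exp (- h * c))"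
      unfolding fz cW by (simp add: field_simps)
    then show ?thesis unfolding e by simp
  qed
  have B: "cnj (f z) * W w = - (N * K * exp (u * c) / th1 h * (th1 (v' - \<omega>) * ths (\<omega> - h) / th1 (v' + \<omega>)))"
  proof -
    have "cnj (f z) * W w = - (N * K / th1 h * (th1 (v' - \<omega>) * ths (\<omega> - h) / th1 (v' + \<omega>)) * (exp (cnj z * c) * exp (h * c)))"
      unfolding fc Ww by (simp add: field_simps)
    then show ?thesis unfolding e by simp
  qed
  have tt: "(th1 (v - \<omega>) * th1 (v' + \<omega>) * ths (\<omega> + h) - th1 (v' - \<omega>) * th1 (v + \<omega>) * ths (\<omega> - h)) * ths \<omega>
     = th1 h * th1 (2 * \<omega>) * ths v * ths v'"
    using three_term[of v v'] vv by (simp add: h_def algebra_simps)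
  have "of_real (2 * Re (f z * cnj (W w))) = f z * cnj (W w) + cnj (f z) * W w"
    by (subst complex_add_cnj[symmetric]) simp
  also have "\<dots> = N * K * exp (u * c) / (th1 h * th1 (v + \<omega>) * th1 (v' + \<omega>)) *
      (th1 (v - \<omega>) * th1 (v' + \<omega>) * ths (\<omega> + h) - th1 (v' - \<omega>) * th1 (v + \<omega>) * ths (\<omega> - h))"
    unfolding A B using nzh nzv nzv' by (simp add: divide_simps) (simp add: algebra_simps)
  also have "th1 (v - \<omega>) * th1 (v' + \<omega>) * ths (\<omega> + h) - th1 (v' - \<omega>) * th1 (v + \<omega>) * ths (\<omega> - h)
      = th1 h * th1 (2 * \<omega>) * ths v * ths v' / ths \<omega>"
    using tt nzs by (simp add: field_simps)
  also have "N * K * exp (u * c) / (th1 h * th1 (v + \<omega>) * th1 (v' + \<omega>)) * (th1 h * th1 (2 * \<omega>) * ths v * ths v' / ths \<omega>)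
      = (N * K * th1 (2 * \<omega>)) * exp (u * c) * ths v * ths v' / (th1 (v + \<omega>) * th1 (v' + \<omega>) * ths \<omega>)"
    using nzh by (simp add: divide_simps)
  also have "\<dots> = exp (u * c) * (ths v * ths v') / (th1 (v + \<omega>) * th1 (v' + \<omega>))"
    unfolding NK using nzs by (simp add: divide_simps)
  \<comment> \<open>Since f' is a square up to unit and exponential factors, its modulus is a value
    of ths/th1 times the conjugate value, without a square root.\<close>
  also have "\<dots> = of_real (norm (f' z))"
  proof -
    have "(complex_of_real (norm (ths v / th1 (v + \<omega>))))\<^sup>2 = ths v / th1 (v + \<omega>) * cnj (ths v / th1 (v + \<omega>))"
      by (metis complex_norm_square of_real_power)
    also have "\<dots> = ths v * ths v' / (th1 (v + \<omega>) * th1 (v' + \<omega>))"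
      using \<epsilon> by (simp add: cnj1 cnjs cv)
    finally have 1: "(complex_of_real (norm (ths v / th1 (v + \<omega>))))\<^sup>2 = ths v * ths v' / (th1 (v + \<omega>) * th1 (v' + \<omega>))" .
    have "Im c = 0" using c_real by (simp add: complex_eq_iff)
    then have cr: "c = of_real (Re c)" by (simp add: complex_eq_iff)
    have "Re (z * c) = u * Re c" using \<open>Im c = 0\<close> by (simp add: z_def)
    then have "complex_of_real (norm (exp (z * c))) = exp (of_real u * of_real (Re c))"
      by (simp add: norm_exp_eq_Re flip: exp_of_real of_real_mult)
    then have 2: "complex_of_real (norm (exp (z * c))) = exp (of_real u * c)"
      using cr by simp
    have "norm (f' z) = (norm (ths v / th1 (v + \<omega>)))\<^sup>2 * norm (exp (z * c))"
      by (simp add: f'_def v v_def[symmetric] norm_mult norm_divide norm_power power_divide)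
    then show ?thesis using 1 2 by (simp add: mult.commute)
  qed
  finally show ?thesis using of_real_eq_iff by blast
qed

lemma standardization_elastica:
  fixes w :: real
  defines "Wr \<equiv> (\<lambda>x::real. W (of_real x))"
  defines "a \<equiv> 2 * cmod (Wr w)"
  defines "g \<equiv> (\<lambda>u::real. - (of_real (cmod (Wr w)) / (\<i> * Wr w)) * f (of_real u + \<i> * of_real w))"
  defines "Q \<equiv> unit_tangent UNIV g"
  defines "\<Lambda> \<equiv> 1 / of_real a * log_derivative Wr w"
  assumes r1: "\<And>u::real. th1 ((of_real u + \<i> * of_real w + \<omega>) / 2) \<noteq> 0"
    and r2: "\<And>u::real. ths ((of_real u + \<i> * of_real w - \<omega>) / 2) \<noteq> 0"
    and r3: "th1 (\<i> * of_real w) \<noteq> 0" and r4: "ths (\<omega> - \<i> * of_real w) \<noteq> 0"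
    and per1: "\<And>z. th1 (z + of_real pi) = - th1 z"
  shows "area_constrained_quasiperiodic_elastica (a * (2 * pi)) (\<lambda>s. g (s / a)) \<and>
            (\<forall>u. g differentiable (at u) \<and> 0 < Im (g u) \<and>
                 cmod (vector_derivative g (at u)) / Im (g u) = a) \<and>
            Wr differentiable (at w) \<and>
            (\<exists>\<mu>::real. \<forall>s. \<exists>Qs.
               ((\<lambda>s. Q (s / a)) has_vector_derivative Qs) (at s) \<and>
               Qs\<^sup>2 + 1/4 * Q (s / a) ^ 4 + cnj \<Lambda> * Q (s / a) ^ 3
                 + of_real \<mu> * (Q (s / a))\<^sup>2 + \<Lambda> * Q (s / a) + 1/4 = 0)"
proof -
  define S where "S = {z::complex. th1 ((z + \<omega>) / 2) \<noteq> 0}"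
  have cont1: "continuous_on A (\<lambda>x. th1 (h x))" if "continuous_on A h" for A :: "'a::topological_space set" and h
    by (rule continuous_on_compose2[OF holomorphic_on_imp_continuous_on[OF hol1] that]) simp
  have S: "open S"
    unfolding S_def by (intro open_Collect_neq cont1 continuous_intros) auto
  have holf: "f holomorphic_on S"
    using f_deriv S by (auto simp: S_def holomorphic_on_open)
  have line: "of_real u + \<i> * of_real w \<in> S" for u :: real
    using r1[of u] by (simp add: S_def)
  have deriv_f: "deriv f z = f' z" if "z \<in> S" for z
    using f_deriv[of z] that by (intro DERIV_imp_deriv) (simp add: S_def)
  have f'_nz: "deriv f (of_real u + \<i> * of_real w) \<noteq> 0" for u :: real
    using r1[of u] r2[of u] by (simp add: deriv_f[OF line] f'_def)
  have hol1': "(\<lambda>x. th1 (h x)) holomorphic_on A" if "h holomorphic_on A" for h A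
    by (rule holomorphic_on_compose_gen[OF that hol1, unfolded o_def]) simp
  have hols': "(\<lambda>x. ths (h x)) holomorphic_on A" if "h holomorphic_on A" for h A
    by (rule holomorphic_on_compose_gen[OF that hols, unfolded o_def]) simp
  have "W holomorphic_on {z. th1 (\<i> * z) \<noteq> 0}"
    unfolding W_def[abs_def] by (intro holomorphic_intros hol1' hols') (use nzs in auto)
  moreover have "open {z. th1 (\<i> * z) \<noteq> 0}"
    by (intro open_Collect_neq cont1 continuous_intros)
  ultimately have "W field_differentiable (at (of_real w))"
    using r3 by (intro holomorphic_on_imp_differentiable_at) auto
  then obtain W' where W': "(Wr has_vector_derivative W') (at w)"
    unfolding Wr_def field_differentiable_def using has_vector_derivative_real_field by blast
  have Wnz: "Wr w \<noteq> 0"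
    using r3 r4 nzs deriv1_nz by (simp add: Wr_def W_def)
  \<comment> \<open>The nonvanishing conditions of \<open>speed\<close> are open in w, so the
    relation holds on a neighbourhood that may depend on u.\<close>
  have sp: "\<forall>\<^sub>F x in nhds w. 2 * Re (f (of_real u + \<i> * of_real x) * cnj (Wr x))
        = norm (deriv f (of_real u + \<i> * of_real x))" for u :: real
  proof -
    have "open ({x::real. th1 ((of_real u + \<i> * of_real x + \<omega>) / 2) \<noteq> 0} \<inter> {x::real. th1 (\<i> * of_real x) \<noteq> 0})"
      by (intro open_Int open_Collect_neq cont1 continuous_intros) auto
    then have "\<forall>\<^sub>F x in nhds w. x \<in> {x::real. th1 ((of_real u + \<i> * of_real x + \<omega>) / 2) \<noteq> 0} \<inter> {x::real. th1 (\<i> * of_real x) \<noteq> 0}"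
      by (rule eventually_nhds_in_open) (use r1 r3 in simp)
    then show ?thesis
    proof eventually_elim
      case (elim x)
      then have "of_real u + \<i> * of_real x \<in> S" by (simp add: S_def)
      then show ?case using speed[of u x] elim by (simp add: Wr_def deriv_f)
    qed
  qed
  have cr: "c = of_real (Re c)" using c_real by (simp add: complex_eq_iff)
  \<comment> \<open>Adding 2 pi to u adds pi to both arguments of \<open>th1\<close>; the sign
    changes cancel and the exponential contributes exp (2 pi c), positive as c is real.\<close>
  have per: "f (of_real (u + 2 * pi) + \<i> * of_real w) = of_real (exp (2 * pi * Re c)) * f (of_real u + \<i> * of_real w)"
    for u :: real
  proof -
    define z where "z = of_real u + \<i> * of_real w"
    have 1: "th1 ((z + 2 * of_real pi - 3 * \<omega>) / 2) = - th1 ((z - 3 * \<omega>) / 2)"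
      using per1[of "(z - 3 * \<omega>) / 2"] by (simp add: field_simps)
    have 2: "th1 ((z + 2 * of_real pi + \<omega>) / 2) = - th1 ((z + \<omega>) / 2)"
      using per1[of "(z + \<omega>) / 2"] by (simp add: field_simps)
    have "exp ((z + 2 * of_real pi) * c) = exp (of_real (2 * pi * Re c)) * exp (z * c)"
      by (subst (1) cr, subst (3) cr) (simp add: exp_add[symmetric] algebra_simps)
    then have "f (z + 2 * of_real pi) = of_real (exp (2 * pi * Re c)) * f z"
      unfolding f_def 1 2 by (simp flip: exp_of_real)
    then show ?thesis by (simp add: z_def algebra_simps)
  qed
  have \<Lambda>: "\<Lambda> = 1 / of_real a * (W' / Wr w)"
    by (simp add: \<Lambda>_def log_derivative_def vector_derivative_at[OF W'])
  note fam = holomorphic_family_elastica[of S f w Wr W' "exp (2 * pi * Re c)",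
      OF S holf line f'_nz W' Wnz sp exp_gt_zero per, folded a_def, folded g_def, folded Q_def \<Lambda>]
  show ?thesis
    using fam differentiableI_vector[OF W'] unfolding g_def by blast
qed

end

section \<open>The rectangular and the rhombic case\<close>

lemma theta_pair_elastica:
  assumes pair: "theta_pair (theta1 \<tau>) ths \<omega> \<kappa> l \<delta> \<epsilon>" and "Im \<tau> > 0"
    and "\<And>u::real. theta1 \<tau> ((of_real u + \<i> * of_real w + \<omega>) / 2) \<noteq> 0"
    and "\<And>u::real. ths ((of_real u + \<i> * of_real w - \<omega>) / 2) \<noteq> 0"
    and "theta1 \<tau> (\<i> * of_real w) \<noteq> 0" and "ths (\<omega> - \<i> * of_real w) \<noteq> 0"
  shows "let a = 2 * cmod (W1 \<tau> ths \<omega> w);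
             g = (\<lambda>u. hyp_standardization \<tau> ths \<omega> u w);
             Q = unit_tangent UNIV g;
             \<Lambda> = 1 / of_real a * log_derivative (W1 \<tau> ths \<omega>) w
         in area_constrained_quasiperiodic_elastica (a * (2 * pi)) (\<lambda>s. g (s / a)) \<and>
            (\<forall>u. g differentiable (at u) \<and> 0 < Im (g u) \<and>
                 cmod (vector_derivative g (at u)) / Im (g u) = a) \<and>
            W1 \<tau> ths \<omega> differentiable (at w) \<and>
            (\<exists>\<mu>::real. \<forall>s. \<exists>Qs.
               ((\<lambda>s. Q (s / a)) has_vector_derivative Qs) (at s) \<and>
               Qs\<^sup>2 + 1/4 * Q (s / a) ^ 4 + cnj \<Lambda> * Q (s / a) ^ 3
                 + of_real \<mu> * (Q (s / a))\<^sup>2 + \<Lambda> * Q (s / a) + 1/4 = 0)"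
proof -
  interpret theta_pair "theta1 \<tau>" ths \<omega> \<kappa> l \<delta> \<epsilon> by (rule pair)
  have W: "W1 \<tau> ths \<omega> = (\<lambda>x. W (of_real x))"
    unfolding W1_def[abs_def] W_def c_def ..
  have g: "(\<lambda>u. hyp_standardization \<tau> ths \<omega> u w) =
      (\<lambda>u. - (of_real (cmod (W (of_real w))) / (\<i> * W (of_real w))) * f (of_real u + \<i> * of_real w))"
    unfolding hyp_standardization_def W gamma_curve_def f_def c_def by simp
  show ?thesis
    unfolding Let_def g unfolding W
    by (rule standardization_elastica[OF assms(3-6) theta1_plus_pi[OF assms(2)]])
qed

theorem theorem4:
  fixes \<tau> :: complex and ths :: "complex \<Rightarrow> complex" and \<omega> w :: real
  assumes "Im \<tau> > 0"
    and "(Re \<tau> = 0 \<and> ths = theta4 \<tau> \<and> (\<forall>k::int. w \<noteq> pi * Im \<tau> * of_int k)) \<or>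
         (Re \<tau> = 1/2 \<and> ths = theta2 \<tau> \<and> (\<forall>k::int. w \<noteq> 2 * pi * Im \<tau> * of_int k))"
    and "\<forall>k::int. \<omega> \<noteq> of_int k * pi"
    and "\<forall>k::int. \<omega> \<noteq> pi / 2 + of_int k * pi"
  shows "let a = 2 * cmod (W1 \<tau> ths \<omega> w);
             g = (\<lambda>u. hyp_standardization \<tau> ths \<omega> u w);
             Q = unit_tangent UNIV g;
             \<Lambda> = 1 / of_real a * log_derivative (W1 \<tau> ths \<omega>) w
         in area_constrained_quasiperiodic_elastica (a * (2 * pi)) (\<lambda>s. g (s / a)) \<and>
            (\<forall>u. g differentiable (at u) \<and> 0 < Im (g u) \<and>
                 cmod (vector_derivative g (at u)) / Im (g u) = a) \<and>
            W1 \<tau> ths \<omega> differentiable (at w) \<and>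
            (\<exists>\<mu>::real. \<forall>s. \<exists>Qs.
               ((\<lambda>s. Q (s / a)) has_vector_derivative Qs) (at s) \<and>
               Qs\<^sup>2 + 1/4 * Q (s / a) ^ 4 + cnj \<Lambda> * Q (s / a) ^ 3
                 + of_real \<mu> * (Q (s / a))\<^sup>2 + \<Lambda> * Q (s / a) + 1/4 = 0)"
proof -
  note \<tau> = assms(1)
  \<comment> \<open>Both excluded values of \<omega> enter through this condition, which keeps 2
    \<omega> off the zeros of \<open>theta1\<close>.\<close>
  have half: "2 * \<omega> \<noteq> pi * of_int k" for k :: int
  proof
    assume k: "2 * \<omega> = pi * of_int k"
    show False
    proof (cases "even k")
      case True
      then obtain j where "k = 2 * j" by blast
      then have "\<omega> = of_int j * pi" using k by simp
      then show False using assms(3) by blast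
    next
      case False
      then obtain j where "k = 2 * j + 1" using oddE by blast
      then have "\<omega> = pi / 2 + of_int j * pi" using k by (simp add: algebra_simps)
      then show False using assms(4) by blast
    qed
  qed
  have nz1: "theta1 \<tau> (2 * of_real \<omega>) \<noteq> 0"
  proof
    assume "theta1 \<tau> (2 * of_real \<omega>) = 0"
    then obtain m n :: int where mn: "2 * of_real \<omega> = of_real pi * of_int m + of_real pi * \<tau> * of_int n"
      using theta1_zero_lattice[OF \<tau>] by metis
    have "n = 0" using arg_cong[OF mn, of Im] \<tau> by simp
    then show False using arg_cong[OF mn, of Re] half[of m] by simp
  qed
  from assms(2) show ?thesis
  proof (elim disjE conjE)
    assume Re\<tau>: "Re \<tau> = 0" and ths: "ths = theta4 \<tau>" and w: "\<forall>k::int. w \<noteq> pi * Im \<tau> * of_int k"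
    have c\<tau>: "- cnj \<tau> = \<tau>" using Re\<tau> by (simp add: complex_eq_iff)
    have nzs: "theta4 \<tau> (of_real \<omega>) \<noteq> 0"
    proof
      assume "theta4 \<tau> (of_real \<omega>) = 0"
      then obtain m n :: int where mn: "of_real \<omega> = of_real pi * of_int m + of_real pi * \<tau> * (of_int n + 1/2)"
        using theta4_zero_lattice[OF \<tau>] by metis
      have "of_int (2 * n + 1) = (0 :: real)" using arg_cong[OF mn, of Im] \<tau> by simp
      then have "2 * n + 1 = 0" by (simp only: of_int_eq_0_iff)
      then show False by presburger
    qed
    have "theta_pair (theta1 \<tau>) (theta4 \<tau>) \<omega>
        (exp (- (\<i> * of_real pi * \<tau> / 4 + \<i> * (- of_real pi * \<tau> / 2 - of_real pi / 2)))) (- \<i>)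
        (- of_real pi * \<tau> / 2) 1"
    proof
      show "cnj (theta1 \<tau> z) = 1 * theta1 \<tau> (cnj z)" for z
        using theta2_cnj[OF \<tau>, of "z - of_real pi / 2"] by (simp add: theta1_eq_theta2 c\<tau>)
      show "cnj (theta4 \<tau> z) = 1 * theta4 \<tau> (cnj z)" for z
        using theta4_cnj[OF \<tau>, of z] by (simp add: c\<tau>)
    qed (use theta_holomorphic theta1_weierstrass theta1_minus theta4_minus theta4_shift \<tau> nz1 nzs in auto)
    moreover have "theta1 \<tau> ((of_real u + \<i> * of_real w + \<omega>) / 2) \<noteq> 0" for u :: real
    proof
      assume "theta1 \<tau> ((of_real u + \<i> * of_real w + \<omega>) / 2) = 0"
      then obtain m n :: int where "(of_real u + \<i> * of_real w + \<omega>) / 2 = of_real pi * of_int m + of_real pi * \<tau> * of_int n"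
        using theta1_zero_lattice[OF \<tau>] by metis
      \<comment> \<open>The denominator of the curve vanishes only over even multiples of pi Im
        \<tau>; the zeros of the derivative, treated next, lie over odd multiples.\<close>
      from arg_cong[OF this, of Im] have "w = pi * Im \<tau> * of_int (2 * n)" by simp
      then show False using w by blast
    qed
    moreover have "theta4 \<tau> ((of_real u + \<i> * of_real w - \<omega>) / 2) \<noteq> 0" for u :: real
    proof
      assume "theta4 \<tau> ((of_real u + \<i> * of_real w - \<omega>) / 2) = 0"
      then obtain m n :: int where "(of_real u + \<i> * of_real w - \<omega>) / 2 = of_real pi * of_int m + of_real pi * \<tau> * (of_int n + 1/2)"
        using theta4_zero_lattice[OF \<tau>] by metis
      from arg_cong[OF this, of Im] have "w = pi * Im \<tau> * of_int (2 * n + 1)" by (simp add: algebra_simps)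
      then show False using w by blast
    qed
    moreover have "theta1 \<tau> (\<i> * of_real w) \<noteq> 0"
    proof
      assume "theta1 \<tau> (\<i> * of_real w) = 0"
      then obtain m n :: int where "\<i> * of_real w = of_real pi * of_int m + of_real pi * \<tau> * of_int n"
        using theta1_zero_lattice[OF \<tau>] by metis
      from arg_cong[OF this, of Im] have "w = pi * Im \<tau> * of_int n" by simp
      then show False using w by blast
    qed
    moreover have "theta4 \<tau> (\<omega> - \<i> * of_real w) \<noteq> 0"
    proof
      assume "theta4 \<tau> (\<omega> - \<i> * of_real w) = 0"
      then obtain m n :: int where "\<omega> - \<i> * of_real w = of_real pi * of_int m + of_real pi * \<tau> * (of_int n + 1/2)"
        using theta4_zero_lattice[OF \<tau>] by metis
      \<comment> \<open>All zeros of \<open>theta4\<close> have real part in pi times the integers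
        when Re \<tau> = 0, so a zero of W1 would force \<omega> to be there for any w.\<close>
      from arg_cong[OF this, of Re] have "2 * \<omega> = pi * of_int (2 * m)" using Re\<tau> by simp
      then show False using half by blast
    qed
    ultimately show ?thesis unfolding ths using \<tau> by (intro theta_pair_elastica)
  next
    assume Re\<tau>: "Re \<tau> = 1/2" and ths: "ths = theta2 \<tau>" and w: "\<forall>k::int. w \<noteq> 2 * pi * Im \<tau> * of_int k"
    have c\<tau>: "- cnj \<tau> = \<tau> - 1" using Re\<tau> by (simp add: complex_eq_iff)
    have nzs: "theta2 \<tau> (of_real \<omega>) \<noteq> 0"
    proof
      assume "theta2 \<tau> (of_real \<omega>) = 0"
      then obtain m n :: int where mn: "of_real \<omega> = of_real pi * (of_int m + 1/2) + of_real pi * \<tau> * of_int n"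
        using theta2_zero_lattice[OF \<tau>] by metis
      have "n = 0" using arg_cong[OF mn, of Im] \<tau> by simp
      then have "2 * \<omega> = pi * of_int (2 * m + 1)" using arg_cong[OF mn, of Re] by (simp add: algebra_simps)
      then show False using half by blast
    qed
    \<comment> \<open>Here the shift is by the real half period, so no exponential factor occurs;
      the phase is that of \<open>theta2_minus_one\<close>.\<close>
    have "theta_pair (theta1 \<tau>) (theta2 \<tau>) \<omega> 1 0 (of_real pi / 2) (exp (- \<i> * of_real pi / 4))"
    proof
      show "cnj (theta2 \<tau> z) = exp (- \<i> * of_real pi / 4) * theta2 \<tau> (cnj z)" for z
        using theta2_cnj[OF \<tau>, of z] theta2_minus_one[OF \<tau>] by (simp add: c\<tau>)
      then show "cnj (theta1 \<tau> z) = exp (- \<i> * of_real pi / 4) * theta1 \<tau> (cnj z)" for z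
        by (simp add: theta1_eq_theta2)
      show "theta2 \<tau> z = 1 * exp (0 * z) * theta1 \<tau> (z + of_real pi / 2)" for z
        by (simp add: theta1_eq_theta2)
    qed (use theta_holomorphic theta1_weierstrass theta1_minus theta2_minus \<tau> nz1 nzs in auto)
    moreover have "theta1 \<tau> ((of_real u + \<i> * of_real w + \<omega>) / 2) \<noteq> 0" for u :: real
    proof
      assume "theta1 \<tau> ((of_real u + \<i> * of_real w + \<omega>) / 2) = 0"
      then obtain m n :: int where "(of_real u + \<i> * of_real w + \<omega>) / 2 = of_real pi * of_int m + of_real pi * \<tau> * of_int n"
        using theta1_zero_lattice[OF \<tau>] by metis
      from arg_cong[OF this, of Im] have "w = 2 * pi * Im \<tau> * of_int n" by simp
      then show False using w by blast
    qed
    moreover have "theta2 \<tau> ((of_real u + \<i> * of_real w - \<omega>) / 2) \<noteq> 0" for u :: real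
    proof
      assume "theta2 \<tau> ((of_real u + \<i> * of_real w - \<omega>) / 2) = 0"
      then obtain m n :: int where "(of_real u + \<i> * of_real w - \<omega>) / 2 = of_real pi * (of_int m + 1/2) + of_real pi * \<tau> * of_int n"
        using theta2_zero_lattice[OF \<tau>] by metis
      from arg_cong[OF this, of Im] have "w = 2 * pi * Im \<tau> * of_int n" by simp
      then show False using w by blast
    qed
    moreover have "theta1 \<tau> (\<i> * of_real w) \<noteq> 0"
    proof
      assume "theta1 \<tau> (\<i> * of_real w) = 0"
      then obtain m n :: int where mn: "\<i> * of_real w = of_real pi * of_int m + of_real pi * \<tau> * of_int n"
        using theta1_zero_lattice[OF \<tau>] by metis
      \<comment> \<open>As Re \<tau> = 1/2, a lattice point on the imaginary axis has n = - 2 m.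
        This is why only even multiples of pi Im \<tau> are excluded in the rhombic case.\<close>
      have "pi * (of_int n + 2 * of_int m) = 0" using arg_cong[OF mn, of Re] Re\<tau> by (simp add: algebra_simps)
      then have "of_int n = (- 2 * of_int m :: real)" by (simp add: add_eq_0_iff)
      then have "w = 2 * pi * Im \<tau> * of_int (- m)" using arg_cong[OF mn, of Im] by simp
      then show False using w by blast
    qed
    moreover have "theta2 \<tau> (\<omega> - \<i> * of_real w) \<noteq> 0"
    proof
      assume "theta2 \<tau> (\<omega> - \<i> * of_real w) = 0"
      then obtain m n :: int where "\<omega> - \<i> * of_real w = of_real pi * (of_int m + 1/2) + of_real pi * \<tau> * of_int n"
        using theta2_zero_lattice[OF \<tau>] by metis
      \<comment> \<open>The term n \<tau> shifts real parts by n/2 periods, so the zeros of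
        \<open>theta2\<close> reach all multiples of pi/2, and both excluded values of \<omega>
        matter.\<close>
      from arg_cong[OF this, of Re] have "2 * \<omega> = pi * of_int (2 * m + 1 + n)"
        using Re\<tau> by (simp add: algebra_simps)
      then show False using half by blast
    qed
    ultimately show ?thesis unfolding ths using \<tau> by (intro theta_pair_elastica)
  qed
qed

end
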